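(* The group $G=S(2^\infty)\ltimes \widetilde C(X;\mathbb{Z}_2)$ is amenable, ICC, contains a non-trivial abelian normal subgroup (namely $\widetilde C(X;\mathbb{Z}_2)$), and has the ISR property: every $G$-invariant von Neumann subalgebra of $L(G)$ is of the form $L(N)$ for a normal subgroup $N\trianglelefteq G$.
   Context: For a countable discrete group $G$, $L(G)\subseteq B(\ell^2(G))$ is the group von Neumann algebra generated by the unitaries $u_g$, $u_g\delta_h=\delta_{gh}$, with trace $\tau(x)=\langle\delta_e,x\delta_e\rangle$; for a subgroup $N$, $L(N)$ is the von Neumann subalgebra generated by $\{u_g:g\in N\}$. A von Neumann subalgebra $\mathcal M\subseteq L(G)$ is $G$-invariant if $u_g\mathcal M u_g^*\subseteq\mathcal M$ for all $g\in G$. $G$ has the ISR property if every $G$-invariant von Neumann subalgebra of $L(G)$ equals $L(N)$ for some normal subgroup $N\trianglelefteq G$. For $n\ge1$ let $S(2^n)$ be the symmetric group of the finite set $\{0,1\}^n$, embedded in $S(2^{n+1})$ via $s\mapsto\tilde s$, $\tilde s(x,y)=(s(x),y)$ ($x\in\{0,1\}^n$, $y\in\{0,1\}$); $S(2^\infty)=\bigcup_n S(2^n)$. Let $X=\{0,1\}^{\mathbb N}$; $S(2^\infty)$ acts on $X$ by homeomorphisms via $s(x,y)=(s(x),y)$ for $s\in S(2^n)$, $x\in\{0,1\}^n$, $y\in\{0,1\}^{\mathbb N}$. $C(X;\mathbb Z_2)$ is the abelian group of continuous maps $X\to\mathbb Z_2$ under pointwise addition; its elements are $f_A=\mathbf 1_A$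 for clopen $A\subseteq X$, with $f_Af_B=f_{A\triangle B}$. $S(2^\infty)$ acts by $g\cdot f_A=f_{g(A)}$. The constant functions $\{f_\emptyset,f_X\}$ form an invariant subgroup and $\widetilde C(X;\mathbb Z_2)$ is the quotient group; $\widetilde f_A$ denotes the class of $f_A$ (so $\widetilde f_A=\widetilde f_{X\setminus A}$). $G=S(2^\infty)\ltimes\widetilde C(X;\mathbb Z_2)$, with $g\widetilde f_Ag^{-1}=\widetilde f_{g(A)}$. *)

theory Defs
  imports "HOL-Analysis.Analysis" "HOL-Algebra.Algebra" "HOL-Combinatorics.Permutations"
begin

definition amenable_grp :: "('a, 'b) monoid_scheme \<Rightarrow> bool" where
  "amenable_grp G \<longleftrightarrow> (\<exists>\<mu> :: 'a set \<Rightarrow> real.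
      \<mu> (carrier G) = 1 \<and>
      (\<forall>A. A \<subseteq> carrier G \<longrightarrow> 0 \<le> \<mu> A) \<and>
      (\<forall>A B. A \<subseteq> carrier G \<longrightarrow> B \<subseteq> carrier G \<longrightarrow> A \<inter> B = {} \<longrightarrow>
          \<mu> (A \<union> B) = \<mu> A + \<mu> B) \<and>
      (\<forall>g A. g \<in> carrier G \<longrightarrow> A \<subseteq> carrier G \<longrightarrow> \<mu> (g <#\<^bsub>G\<^esub> A) = \<mu> A))"

definition icc_grp :: "('a, 'b) monoid_scheme \<Rightarrow> bool" where
  "icc_grp G \<longleftrightarrow> (\<forall>g \<in> carrier G. g \<noteq> \<one>\<^bsub>G\<^esub> \<longrightarrow>
      infinite {h \<otimes>\<^bsub>G\<^esub> g \<otimes>\<^bsub>G\<^esub> inv\<^bsub>G\<^esub> h | h. h \<in> carrier G})"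

definition l2 :: "('a, 'b) monoid_scheme \<Rightarrow> ('a \<Rightarrow> complex) set" where
  "l2 G = {\<xi>. (\<forall>g. g \<notin> carrier G \<longrightarrow> \<xi> g = 0) \<and>
                 (\<lambda>g. (cmod (\<xi> g))\<^sup>2) summable_on carrier G}"

definition inner_l2 :: "('a, 'b) monoid_scheme \<Rightarrow> ('a \<Rightarrow> complex) \<Rightarrow> ('a \<Rightarrow> complex) \<Rightarrow> complex" where
  "inner_l2 G \<xi> \<eta> = infsum (\<lambda>g. cnj (\<xi> g) * \<eta> g) (carrier G)"

definition norm_l2 :: "('a, 'b) monoid_scheme \<Rightarrow> ('a \<Rightarrow> complex) \<Rightarrow> real" where
  "norm_l2 G \<xi> = sqrt (infsum (\<lambda>g. (cmod (\<xi> g))\<^sup>2) (carrier G))"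

text \<open>Bounded linear operators on l2(G). An operator is a function on
type a => complex; to have a canonical representative it is required
to vanish outside l2(G).\<close>
definition Bop :: "('a, 'b) monoid_scheme \<Rightarrow> (('a \<Rightarrow> complex) \<Rightarrow> ('a \<Rightarrow> complex)) set" where
  "Bop G = {T. (\<forall>\<xi>. \<xi> \<notin> l2 G \<longrightarrow> T \<xi> = (\<lambda>_. 0)) \<and>
               (\<forall>\<xi> \<in> l2 G. T \<xi> \<in> l2 G) \<and>
               (\<forall>\<xi> \<in> l2 G. \<forall>\<eta> \<in> l2 G. T (\<lambda>g. \<xi> g + \<eta> g) = (\<lambda>g. T \<xi> g + T \<eta> g)) \<and>
               (\<forall>\<xi> \<in> l2 G. \<forall>a::complex. T (\<lambda>g. a * \<xi> g) = (\<lambda>g. a * T \<xi> g)) \<and>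
               (\<exists>C. \<forall>\<xi> \<in> l2 G. norm_l2 G (T \<xi>) \<le> C * norm_l2 G \<xi>)}"

definition idop :: "('a, 'b) monoid_scheme \<Rightarrow> ('a \<Rightarrow> complex) \<Rightarrow> ('a \<Rightarrow> complex)" where
  "idop G = (\<lambda>\<xi>. if \<xi> \<in> l2 G then \<xi> else (\<lambda>_. 0))"

definition is_adjoint :: "('a, 'b) monoid_scheme \<Rightarrow> (('a \<Rightarrow> complex) \<Rightarrow> ('a \<Rightarrow> complex))
     \<Rightarrow> (('a \<Rightarrow> complex) \<Rightarrow> ('a \<Rightarrow> complex)) \<Rightarrow> bool" where
  "is_adjoint G T S \<longleftrightarrow> (\<forall>\<xi> \<in> l2 G. \<forall>\<eta> \<in> l2 G. inner_l2 G (S \<xi>) \<eta> = inner_l2 G \<xi> (T \<eta>))"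

definition adj :: "('a, 'b) monoid_scheme \<Rightarrow> (('a \<Rightarrow> complex) \<Rightarrow> ('a \<Rightarrow> complex))
     \<Rightarrow> (('a \<Rightarrow> complex) \<Rightarrow> ('a \<Rightarrow> complex))" where
  "adj G T = (SOME S. S \<in> Bop G \<and> is_adjoint G T S)"

definition wot_closed :: "('a, 'b) monoid_scheme \<Rightarrow> (('a \<Rightarrow> complex) \<Rightarrow> ('a \<Rightarrow> complex)) set \<Rightarrow> bool" where
  "wot_closed G M \<longleftrightarrow> (\<forall>T \<in> Bop G.
      (\<forall>F \<epsilon>. finite F \<longrightarrow> F \<subseteq> l2 G \<times> l2 G \<longrightarrow> \<epsilon> > 0 \<longrightarrow>
          (\<exists>S \<in> M. \<forall>(\<xi>, \<eta>) \<in> F. cmod (inner_l2 G \<xi> (T \<eta>) - inner_l2 G \<xi> (S \<eta>)) < \<epsilon>))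
      \<longrightarrow> T \<in> M)"

definition is_vNa :: "('a, 'b) monoid_scheme \<Rightarrow> (('a \<Rightarrow> complex) \<Rightarrow> ('a \<Rightarrow> complex)) set \<Rightarrow> bool" where
  "is_vNa G M \<longleftrightarrow> M \<subseteq> Bop G \<and> idop G \<in> M \<and>
     (\<forall>T \<in> M. \<forall>S \<in> M. (\<lambda>\<xi> g. T \<xi> g + S \<xi> g) \<in> M) \<and>
     (\<forall>T \<in> M. \<forall>a::complex. (\<lambda>\<xi> g. a * T \<xi> g) \<in> M) \<and>
     (\<forall>T \<in> M. \<forall>S \<in> M. T \<circ> S \<in> M) \<and>
     (\<forall>T \<in> M. \<exists>S \<in> M. is_adjoint G T S) \<and>
     wot_closed G M"

definition vN_gen :: "('a, 'b) monoid_scheme \<Rightarrow> (('a \<Rightarrow> complex) \<Rightarrow> ('a \<Rightarrow> complex)) set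
     \<Rightarrow> (('a \<Rightarrow> complex) \<Rightarrow> ('a \<Rightarrow> complex)) set" where
  "vN_gen G S = \<Inter> {M. is_vNa G M \<and> S \<subseteq> M}"

definition lreg :: "('a, 'b) monoid_scheme \<Rightarrow> 'a \<Rightarrow> ('a \<Rightarrow> complex) \<Rightarrow> ('a \<Rightarrow> complex)" where
  "lreg G g = (\<lambda>\<xi>. if \<xi> \<in> l2 G
      then (\<lambda>h. if h \<in> carrier G then \<xi> (inv\<^bsub>G\<^esub> g \<otimes>\<^bsub>G\<^esub> h) else 0) else (\<lambda>_. 0))"

definition grpvN :: "('a, 'b) monoid_scheme \<Rightarrow> 'a set \<Rightarrow> (('a \<Rightarrow> complex) \<Rightarrow> ('a \<Rightarrow> complex)) set" where
  "grpvN G N = vN_gen G (lreg G ` N)"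

definition G_invariant :: "('a, 'b) monoid_scheme \<Rightarrow> (('a \<Rightarrow> complex) \<Rightarrow> ('a \<Rightarrow> complex)) set \<Rightarrow> bool" where
  "G_invariant G M \<longleftrightarrow> (\<forall>g \<in> carrier G. \<forall>x \<in> M. lreg G g \<circ> x \<circ> adj G (lreg G g) \<in> M)"

definition ISR :: "('a, 'b) monoid_scheme \<Rightarrow> bool" where
  "ISR G \<longleftrightarrow> (\<forall>M. is_vNa G M \<and> M \<subseteq> grpvN G (carrier G) \<and> G_invariant G M \<longrightarrow>
      (\<exists>N. N \<lhd> G \<and> M = grpvN G N))"

text \<open>X = {0,1}^N as nat \<Rightarrow> bool, with the product topology of discrete bool.
{0,1}^n is represented as the functions vanishing from index n on.\<close>
type_synonym cantor = "nat \<Rightarrow> bool"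

definition cube :: "nat \<Rightarrow> cantor set" where
  "cube n = {v. \<forall>k \<ge> n. \<not> v k}"

definition trunc :: "nat \<Rightarrow> cantor \<Rightarrow> cantor" where
  "trunc n x = (\<lambda>k. k < n \<and> x k)"

definition lift_perm :: "nat \<Rightarrow> (cantor \<Rightarrow> cantor) \<Rightarrow> cantor \<Rightarrow> cantor" where
  "lift_perm n s = (\<lambda>x k. if k < n then s (trunc n x) k else x k)"

definition S2inf :: "(cantor \<Rightarrow> cantor) set" where
  "S2inf = (\<Union>n. {lift_perm n s | s. s permutes cube n})"

definition clopen :: "cantor set \<Rightarrow> bool" where
  "clopen A \<longleftrightarrow> open A \<and> closed A"

text \<open>An element of C~(X;Z_2) is the class {A, X - A} of a clopen set A
(f_A and f_(X-A) are identified).\<close>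
definition Ctil :: "cantor set set set" where
  "Ctil = {{A, - A} | A. clopen A}"

definition cmult :: "cantor set set \<Rightarrow> cantor set set \<Rightarrow> cantor set set" where
  "cmult c d = {(A - B) \<union> (B - A) | A B. A \<in> c \<and> B \<in> d}"

definition cact :: "(cantor \<Rightarrow> cantor) \<Rightarrow> cantor set set \<Rightarrow> cantor set set" where
  "cact \<sigma> c = (\<lambda>A. \<sigma> ` A) ` c"

text \<open>Elements written as f~_A \<cdot> \<sigma>; (f~_A \<sigma>)(f~_B \<tau>) = f~_(A symdiff \<sigma>(B)) \<sigma>\<tau>,
which encodes \<sigma> f~_B \<sigma>^-1 = f~_(\<sigma>(B)).\<close>
definition Gsd :: "(cantor set set \<times> (cantor \<Rightarrow> cantor)) monoid" where
  "Gsd = \<lparr> carrier = Ctil \<times> S2inf,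
           mult = (\<lambda>(c, \<sigma>) (d, \<tau>). (cmult c (cact \<sigma> d), \<sigma> \<circ> \<tau>)),
           one = ({{}, UNIV}, id) \<rparr>"

definition Csub :: "(cantor set set \<times> (cantor \<Rightarrow> cantor)) set" where
  "Csub = Ctil \<times> {id}"

end

theory Submission
  imports Defs
begin

text \<open>
  \<open>G\<close> is the increasing union of the finite subgroups \<open>G\<^sub>n\<close> of elements depending on the first \<open>n\<close>
  coordinates only. Permutations \<open>c\<^sub>i\<close> of the remaining coordinates commute with \<open>G\<^sub>n\<close>, while
  \<open>c\<^sub>i g c\<^sub>i\<close> leaves every finite set when \<open>g\<close> is not in \<open>G\<^sub>n\<close>. This gives ICC, and it shows that for an
  invariant von Neumann subalgebra \<open>M\<close> the truncation of \<open>x \<in> M\<close> to \<open>G\<^sub>n\<close>, being the weak limit of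
  \<open>u x u*\<close> with \<open>u\<close> the unitary of \<open>c\<^sub>i\<close>, again lies in \<open>M\<close>. Hence \<open>M\<close> is determined by the *-algebra \<open>P\<close> of its
  finitely supported elements, the conditional expectation \<open>E\<close> maps \<open>\<complex>[G\<^sub>n]\<close> to itself, and it
  suffices to show that \<open>P\<close> is spanned by group elements.

  For \<open>f\<close> in the abelian normal subgroup, invariance of \<open>E f\<close> under the centralizer of \<open>f\<close> forces \<open>E f\<close> to
  be \<open>0\<close> or \<open>f\<close>, and one nontrivial \<open>f \<in> P\<close> yields all of them. If there is none, then for \<open>a \<in> P\<close> and \<open>f\<close> in
  general position the element \<open>a* f a f\<close> of \<open>P\<close> has a nonzero coefficient at a nontrivial element of the
  abelian subgroup, unless \<open>a\<close> is scalar. If all are in \<open>P\<close> and \<open>E g \<noteq> 0\<close> for some \<open>g\<close> with nontrivial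
  permutation part, then some commutators of \<open>g\<close> lie in \<open>P\<close>; they are products of two transpositions
  of cylinders, whose conjugates generate all permutations.
\<close>

subsection \<open>Square-summable functions\<close>

text \<open>Operators in \<open>M\<close> have infinitely many coefficients, so supports cannot be
  compared directly. Truncation turns every later argument into one about finite sums, and for
  \<open>g\<close> of level n the support of \<open>E g\<close> cannot leave level n. This is
  exploited in two ways: \<open>E g\<close> is constant on orbits of the centralizer of
  \<open>g\<close>, and \<open>E\<close> is bimodular over the group elements already known to lie
  in \<open>M\<close>. Swaps of half cylinders, one coordinate deeper than the level at hand, can be
  chosen to commute with the given element and yet destroy the level of an unwanted support point.
  Once the abelian subgroup A is inside \<open>M\<close>, the support of p = \<open>E g\<close> lies
  in the coset A g, so for a flip c commuting with the level n part of A the product of p* and c p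
  c\<inverse> is supported in a single coset of A; this is how one commutator can be isolated.
  Parity is the last obstruction, since products of two transpositions of cylinders are even at a
  fixed depth. It disappears in the union, where a transposition becomes a product of two at the
  next depth.\<close>

definition delta :: "'a \<Rightarrow> 'a \<Rightarrow> complex" where
  "delta g = (\<lambda>h. if h = g then 1 else 0)"

definition chop :: "'a set \<Rightarrow> ('a \<Rightarrow> complex) \<Rightarrow> 'a \<Rightarrow> complex" where
  "chop F \<xi> = (\<lambda>h. if h \<in> F then \<xi> h else 0)"

lemma l2_outside: "\<xi> \<in> l2 G \<Longrightarrow> g \<notin> carrier G \<Longrightarrow> \<xi> g = 0"
  by (simp add: l2_def)

lemma l2_summable: "\<xi> \<in> l2 G \<Longrightarrow> (\<lambda>g. (cmod (\<xi> g))\<^sup>2) summable_on carrier G"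
  by (simp add: l2_def)

lemma norm_l2_nonneg: "0 \<le> norm_l2 G \<xi>"
  by (auto simp: norm_l2_def intro!: infsum_nonneg)

lemma L2_set_le_norm_l2:
  assumes "\<xi> \<in> l2 G" "finite F" "F \<subseteq> carrier G"
  shows "L2_set (\<lambda>g. cmod (\<xi> g)) F \<le> norm_l2 G \<xi>"
  unfolding L2_set_def norm_l2_def
  by (intro real_sqrt_le_mono finite_sum_le_infsum) (use assms l2_summable in auto)

text \<open>Infinite sums are controlled through finite partial sums, so Minkowski's inequality and
  the bound for adjoints reduce to \<open>L2_set\<close> over finite sets. Membership and norm bound
  come from the same estimate.\<close>

lemma l2_boundI:
  assumes out: "\<And>g. g \<notin> carrier G \<Longrightarrow> \<xi> g = 0"
    and bd: "\<And>F. finite F \<Longrightarrow> F \<subseteq> carrier G \<Longrightarrow> L2_set (\<lambda>g. cmod (\<xi> g)) F \<le> B"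
  shows "\<xi> \<in> l2 G" "norm_l2 G \<xi> \<le> B"
proof -
  have B0: "0 \<le> B" using bd[of "{}"] by simp
  have le: "(\<Sum>g\<in>F. (cmod (\<xi> g))\<^sup>2) \<le> B\<^sup>2" if "finite F" "F \<subseteq> carrier G" for F
  proof -
    have "sqrt (\<Sum>g\<in>F. (cmod (\<xi> g))\<^sup>2) \<le> B"
      using bd[OF that] by (simp add: L2_set_def)
    then show ?thesis using B0 real_sqrt_le_iff sqrt_le_D by blast
  qed
  have sm: "(\<lambda>g. (cmod (\<xi> g))\<^sup>2) summable_on carrier G"
    using le by (intro nonneg_bdd_above_summable_on bdd_aboveI2[where M="B\<^sup>2"]) auto
  then show "\<xi> \<in> l2 G" using out by (simp add: l2_def)
  have "infsum (\<lambda>g. (cmod (\<xi> g))\<^sup>2) (carrier G) \<le> B\<^sup>2"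
    by (rule infsum_le_finite_sums[OF sm]) (rule le)
  then show "norm_l2 G \<xi> \<le> B"
    unfolding norm_l2_def using B0 real_le_lsqrt by blast
qed

lemma
  assumes "\<xi> \<in> l2 G" "\<eta> \<in> l2 G"
  shows l2_add: "(\<lambda>g. \<xi> g + \<eta> g) \<in> l2 G"
    and norm_l2_add: "norm_l2 G (\<lambda>g. \<xi> g + \<eta> g) \<le> norm_l2 G \<xi> + norm_l2 G \<eta>"
proof -
  have *: "L2_set (\<lambda>g. cmod (\<xi> g + \<eta> g)) F \<le> norm_l2 G \<xi> + norm_l2 G \<eta>"
    if "finite F" "F \<subseteq> carrier G" for F
  proof -
    have "L2_set (\<lambda>g. cmod (\<xi> g + \<eta> g)) F \<le> L2_set (\<lambda>g. cmod (\<xi> g) + cmod (\<eta> g)) F"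
      by (rule L2_set_mono) (auto intro: norm_triangle_ineq)
    also have "\<dots> \<le> L2_set (\<lambda>g. cmod (\<xi> g)) F + L2_set (\<lambda>g. cmod (\<eta> g)) F"
      by (rule L2_set_triangle_ineq)
    also have "\<dots> \<le> norm_l2 G \<xi> + norm_l2 G \<eta>"
      using L2_set_le_norm_l2 assms that by (intro add_mono) auto
    finally show ?thesis .
  qed
  have o: "\<xi> g + \<eta> g = 0" if "g \<notin> carrier G" for g using assms that by (simp add: l2_outside)
  show "(\<lambda>g. \<xi> g + \<eta> g) \<in> l2 G" "norm_l2 G (\<lambda>g. \<xi> g + \<eta> g) \<le> norm_l2 G \<xi> + norm_l2 G \<eta>"
    using l2_boundI[OF o *] by auto
qed

lemma
  assumes "\<xi> \<in> l2 G"
  shows l2_scale: "(\<lambda>g. a * \<xi> g) \<in> l2 G"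
    and norm_l2_scale: "norm_l2 G (\<lambda>g. a * \<xi> g) = cmod a * norm_l2 G \<xi>"
proof -
  have "(\<lambda>g. (cmod a)\<^sup>2 * (cmod (\<xi> g))\<^sup>2) summable_on carrier G"
    using l2_summable[OF assms] by (rule summable_on_cmult_right)
  then show "(\<lambda>g. a * \<xi> g) \<in> l2 G"
    using assms by (simp add: l2_def norm_mult power_mult_distrib)
  show "norm_l2 G (\<lambda>g. a * \<xi> g) = cmod a * norm_l2 G \<xi>"
    by (simp add: norm_l2_def norm_mult power_mult_distrib infsum_cmult_right' real_sqrt_mult)
qed

lemma l2_zero: "(\<lambda>_. 0) \<in> l2 G"
  by (simp add: l2_def)

lemma l2_diff: "\<xi> \<in> l2 G \<Longrightarrow> \<eta> \<in> l2 G \<Longrightarrow> (\<lambda>g. \<xi> g - \<eta> g) \<in> l2 G"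
  using l2_add[of \<xi> G "\<lambda>g. -1 * \<eta> g"] l2_scale[of \<eta> G "-1"] by simp

lemma l2_finite_support:
  assumes "finite F" "F \<subseteq> carrier G" "\<And>g. g \<notin> F \<Longrightarrow> \<xi> g = 0"
  shows "\<xi> \<in> l2 G"
proof -
  have "(\<lambda>g. (cmod (\<xi> g))\<^sup>2) summable_on carrier G \<longleftrightarrow> (\<lambda>g. (cmod (\<xi> g))\<^sup>2) summable_on F"
    by (rule summable_on_cong_neutral) (use assms in auto)
  then show ?thesis using assms by (auto simp: l2_def)
qed

lemma norm_l2_finite_support:
  assumes "finite F" "F \<subseteq> carrier G" "\<And>g. g \<notin> F \<Longrightarrow> \<xi> g = 0"
  shows "norm_l2 G \<xi> = L2_set (\<lambda>g. cmod (\<xi> g)) F"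
proof -
  have "infsum (\<lambda>g. (cmod (\<xi> g))\<^sup>2) (carrier G) = infsum (\<lambda>g. (cmod (\<xi> g))\<^sup>2) F"
    by (rule infsum_cong_neutral) (use assms in auto)
  then show ?thesis using assms by (simp add: norm_l2_def L2_set_def)
qed

lemma l2_delta: "g \<in> carrier G \<Longrightarrow> delta g \<in> l2 G"
  by (rule l2_finite_support[of "{g}"]) (auto simp: delta_def)

lemma norm_l2_delta: "g \<in> carrier G \<Longrightarrow> norm_l2 G (delta g) = 1"
  by (subst norm_l2_finite_support[of "{g}"]) (auto simp: delta_def)

lemma l2_chop:
  assumes "\<xi> \<in> l2 G"
  shows "chop F \<xi> \<in> l2 G"
proof -
  have "(\<lambda>g. (cmod (chop F \<xi> g))\<^sup>2) summable_on carrier G"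
    by (rule summable_on_comparison_test[OF l2_summable[OF assms]]) (auto simp: chop_def)
  then show ?thesis using assms by (auto simp: l2_def chop_def)
qed

lemma inner_abs_summable:
  assumes "\<xi> \<in> l2 G" "\<eta> \<in> l2 G"
  shows "(\<lambda>g. cmod (cnj (\<xi> g) * \<eta> g)) summable_on carrier G"
  by (rule abs_summable_product)
    (use l2_summable assms in \<open>auto simp: norm_mult power2_eq_square\<close>)

lemma inner_summable:
  assumes "\<xi> \<in> l2 G" "\<eta> \<in> l2 G"
  shows "(\<lambda>g. cnj (\<xi> g) * \<eta> g) summable_on carrier G"
  by (rule Infinite_Sum.abs_summable_summable[OF inner_abs_summable[OF assms]])

lemma inner_cauchy_schwarz:
  assumes "\<xi> \<in> l2 G" "\<eta> \<in> l2 G"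
  shows "cmod (inner_l2 G \<xi> \<eta>) \<le> norm_l2 G \<xi> * norm_l2 G \<eta>"
proof -
  have "cmod (inner_l2 G \<xi> \<eta>) \<le> infsum (\<lambda>g. cmod (cnj (\<xi> g) * \<eta> g)) (carrier G)"
    unfolding inner_l2_def by (rule norm_infsum_bound[OF inner_abs_summable[OF assms]])
  also have "\<dots> \<le> norm_l2 G \<xi> * norm_l2 G \<eta>"
  proof (rule infsum_le_finite_sums[OF inner_abs_summable[OF assms]])
    fix F assume F: "finite F" "F \<subseteq> carrier G"
    have "(\<Sum>g\<in>F. cmod (cnj (\<xi> g) * \<eta> g)) \<le> L2_set (\<lambda>g. cmod (\<xi> g)) F * L2_set (\<lambda>g. cmod (\<eta> g)) F"
      using L2_set_mult_ineq[of "\<lambda>g. cmod (\<xi> g)" "\<lambda>g. cmod (\<eta> g)" F] by (simp add: norm_mult)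
    also have "\<dots> \<le> norm_l2 G \<xi> * norm_l2 G \<eta>"
      using F L2_set_le_norm_l2 assms by (intro mult_mono norm_l2_nonneg) auto
    finally show "(\<Sum>g\<in>F. cmod (cnj (\<xi> g) * \<eta> g)) \<le> norm_l2 G \<xi> * norm_l2 G \<eta>" .
  qed
  finally show ?thesis .
qed

lemma inner_add_right:
  assumes "\<xi> \<in> l2 G" "\<eta> \<in> l2 G" "\<zeta> \<in> l2 G"
  shows "inner_l2 G \<xi> (\<lambda>g. \<eta> g + \<zeta> g) = inner_l2 G \<xi> \<eta> + inner_l2 G \<xi> \<zeta>"
  unfolding inner_l2_def distrib_left by (intro infsum_add inner_summable assms)

lemma inner_scale_right: "inner_l2 G \<xi> (\<lambda>g. a * \<eta> g) = a * inner_l2 G \<xi> \<eta>"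
  unfolding inner_l2_def by (simp add: mult.left_commute infsum_cmult_right')

lemma inner_cnj: "inner_l2 G \<xi> \<eta> = cnj (inner_l2 G \<eta> \<xi>)"
  unfolding inner_l2_def by (simp add: mult.commute flip: infsum_cnj)

lemma inner_add_left:
  assumes "\<xi> \<in> l2 G" "\<eta> \<in> l2 G" "\<zeta> \<in> l2 G"
  shows "inner_l2 G (\<lambda>g. \<eta> g + \<zeta> g) \<xi> = inner_l2 G \<eta> \<xi> + inner_l2 G \<zeta> \<xi>"
  using inner_add_right[OF assms] by (subst (1 2 3) inner_cnj) simp

lemma inner_scale_left: "inner_l2 G (\<lambda>g. a * \<eta> g) \<xi> = cnj a * inner_l2 G \<eta> \<xi>"
  by (subst (1 2) inner_cnj) (simp add: inner_scale_right)

lemma inner_diff_right: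
  assumes "\<xi> \<in> l2 G" "\<eta> \<in> l2 G" "\<zeta> \<in> l2 G"
  shows "inner_l2 G \<xi> (\<lambda>g. \<eta> g - \<zeta> g) = inner_l2 G \<xi> \<eta> - inner_l2 G \<xi> \<zeta>"
  using inner_add_right[OF assms(1,2) l2_scale[OF assms(3), of "-1"]] inner_scale_right[of G \<xi> "-1" \<zeta>]
  by simp

lemma inner_diff_left:
  assumes "\<xi> \<in> l2 G" "\<eta> \<in> l2 G" "\<zeta> \<in> l2 G"
  shows "inner_l2 G (\<lambda>g. \<eta> g - \<zeta> g) \<xi> = inner_l2 G \<eta> \<xi> - inner_l2 G \<zeta> \<xi>"
  using inner_diff_right[OF assms] by (subst (1 2 3) inner_cnj) simp

lemma inner_delta_left: "g \<in> carrier G \<Longrightarrow> inner_l2 G (delta g) \<xi> = \<xi> g"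
  unfolding inner_l2_def
  by (subst infsum_cong_neutral[where T="{g}" and g="\<lambda>_. \<xi> g"]) (auto simp: delta_def)

lemma inner_delta_right: "g \<in> carrier G \<Longrightarrow> inner_l2 G \<xi> (delta g) = cnj (\<xi> g)"
  by (subst inner_cnj) (simp add: inner_delta_left)

lemma l2_ext:
  assumes "\<xi> \<in> l2 G" "\<eta> \<in> l2 G" "\<And>\<zeta>. \<zeta> \<in> l2 G \<Longrightarrow> inner_l2 G \<zeta> \<xi> = inner_l2 G \<zeta> \<eta>"
  shows "\<xi> = \<eta>"
proof
  fix g show "\<xi> g = \<eta> g"
  proof (cases "g \<in> carrier G")
    case True then show ?thesis using assms(3)[OF l2_delta[OF True]] by (simp add: inner_delta_left)
  qed (use assms in \<open>simp add: l2_outside\<close>)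
qed

lemma l2_finite_approx:
  assumes "\<xi> \<in> l2 G" "\<epsilon> > 0"
  obtains F where "finite F" "F \<subseteq> carrier G" "norm_l2 G (\<lambda>g. \<xi> g - chop F \<xi> g) < \<epsilon>"
proof -
  let ?f = "\<lambda>g. (cmod (\<xi> g))\<^sup>2"
  note sm = l2_summable[OF assms(1)]
  obtain F where F: "finite F" "F \<subseteq> carrier G" "dist (sum ?f F) (infsum ?f (carrier G)) \<le> \<epsilon>\<^sup>2 / 2"
    using infsum_finite_approximation[OF sm, of "\<epsilon>\<^sup>2 / 2"] assms(2) by auto
  have "infsum (\<lambda>g. (cmod (\<xi> g - chop F \<xi> g))\<^sup>2) (carrier G) = infsum ?f (carrier G - F)"
    by (rule infsum_cong_neutral) (auto simp: chop_def)
  also have "\<dots> = infsum ?f (carrier G) - sum ?f F"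
    using F sm by (subst infsum_Diff) (auto simp: summable_on_finite)
  also have "\<dots> < \<epsilon>\<^sup>2" using F(3) assms(2) by (simp add: dist_real_def) (smt (verit) field_sum_of_halves zero_less_power)
  finally have "norm_l2 G (\<lambda>g. \<xi> g - chop F \<xi> g) < \<epsilon>"
    unfolding norm_l2_def using assms(2) by (simp add: real_less_lsqrt)
  then show ?thesis using F that by blast
qed

subsection \<open>Bounded operators\<close>

lemma BopD:
  assumes "T \<in> Bop G"
  shows "\<xi> \<notin> l2 G \<Longrightarrow> T \<xi> = (\<lambda>_. 0)"
    and "\<xi> \<in> l2 G \<Longrightarrow> T \<xi> \<in> l2 G"
    and "\<xi> \<in> l2 G \<Longrightarrow> \<eta> \<in> l2 G \<Longrightarrow> T (\<lambda>g. \<xi> g + \<eta> g) = (\<lambda>g. T \<xi> g + T \<eta> g)"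
    and "\<xi> \<in> l2 G \<Longrightarrow> T (\<lambda>g. a * \<xi> g) = (\<lambda>g. a * T \<xi> g)"
  using assms unfolding Bop_def by blast+

lemma Bop_bounded:
  assumes "T \<in> Bop G"
  obtains C where "C \<ge> 0" "\<And>\<xi>. \<xi> \<in> l2 G \<Longrightarrow> norm_l2 G (T \<xi>) \<le> C * norm_l2 G \<xi>"
proof -
  obtain C where C: "\<And>\<xi>. \<xi> \<in> l2 G \<Longrightarrow> norm_l2 G (T \<xi>) \<le> C * norm_l2 G \<xi>"
    using assms unfolding Bop_def by blast
  have "norm_l2 G (T \<xi>) \<le> \<bar>C\<bar> * norm_l2 G \<xi>" if "\<xi> \<in> l2 G" for \<xi>
    using C[OF that] mult_right_mono[OF abs_ge_self[of C] norm_l2_nonneg[of G \<xi>]] by linarith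
  then show ?thesis using that[of "\<bar>C\<bar>"] by auto
qed

lemma BopI:
  assumes "\<And>\<xi>. \<xi> \<notin> l2 G \<Longrightarrow> T \<xi> = (\<lambda>_. 0)"
    and "\<And>\<xi>. \<xi> \<in> l2 G \<Longrightarrow> T \<xi> \<in> l2 G"
    and "\<And>\<xi> \<eta>. \<xi> \<in> l2 G \<Longrightarrow> \<eta> \<in> l2 G \<Longrightarrow> T (\<lambda>g. \<xi> g + \<eta> g) = (\<lambda>g. T \<xi> g + T \<eta> g)"
    and "\<And>\<xi> a. \<xi> \<in> l2 G \<Longrightarrow> T (\<lambda>g. a * \<xi> g) = (\<lambda>g. a * T \<xi> g)"
    and "\<And>\<xi>. \<xi> \<in> l2 G \<Longrightarrow> norm_l2 G (T \<xi>) \<le> C * norm_l2 G \<xi>"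
  shows "T \<in> Bop G"
  unfolding Bop_def using assms by blast

lemma Bop_diff:
  assumes "T \<in> Bop G" "\<xi> \<in> l2 G" "\<eta> \<in> l2 G"
  shows "T (\<lambda>g. \<xi> g - \<eta> g) = (\<lambda>g. T \<xi> g - T \<eta> g)"
  using BopD(3)[OF assms(1,2) l2_scale[OF assms(3), of "-1"]] BopD(4)[OF assms(1,3), of "-1"] by simp

lemma Bop_ext:
  assumes "T \<in> Bop G" "S \<in> Bop G" "\<And>\<xi>. \<xi> \<in> l2 G \<Longrightarrow> T \<xi> = S \<xi>"
  shows "T = S"
  using assms BopD(1) by (metis ext)

lemma Bop_idop: "idop G \<in> Bop G"
  by (rule BopI[where C=1]) (auto simp: idop_def l2_add l2_scale)

lemma Bop_add:
  assumes "T \<in> Bop G" "S \<in> Bop G"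
  shows "(\<lambda>\<xi> g. T \<xi> g + S \<xi> g) \<in> Bop G"
proof -
  obtain C where C: "\<And>\<xi>. \<xi> \<in> l2 G \<Longrightarrow> norm_l2 G (T \<xi>) \<le> C * norm_l2 G \<xi>"
    using Bop_bounded[OF assms(1)] by blast
  obtain D where D: "\<And>\<xi>. \<xi> \<in> l2 G \<Longrightarrow> norm_l2 G (S \<xi>) \<le> D * norm_l2 G \<xi>"
    using Bop_bounded[OF assms(2)] by blast
  show ?thesis
  proof (rule BopI[where C="C+D"])
    fix \<xi> assume \<xi>: "\<xi> \<in> l2 G"
    show "norm_l2 G (\<lambda>g. T \<xi> g + S \<xi> g) \<le> (C + D) * norm_l2 G \<xi>"
      using norm_l2_add[OF BopD(2)[OF assms(1) \<xi>] BopD(2)[OF assms(2) \<xi>]] C[OF \<xi>] D[OF \<xi>]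
      by (simp add: distrib_right)
  qed (use assms in \<open>auto simp: BopD l2_add algebra_simps\<close>)
qed

lemma Bop_scale:
  assumes "T \<in> Bop G"
  shows "(\<lambda>\<xi> g. a * T \<xi> g) \<in> Bop G"
proof -
  obtain C where C: "\<And>\<xi>. \<xi> \<in> l2 G \<Longrightarrow> norm_l2 G (T \<xi>) \<le> C * norm_l2 G \<xi>"
    using Bop_bounded[OF assms] by blast
  show ?thesis
  proof (rule BopI[where C="cmod a * C"])
    fix \<xi> assume \<xi>: "\<xi> \<in> l2 G"
    show "norm_l2 G (\<lambda>g. a * T \<xi> g) \<le> cmod a * C * norm_l2 G \<xi>"
      using C[OF \<xi>] BopD(2)[OF assms \<xi>] by (simp add: norm_l2_scale mult_left_mono mult.assoc)
  qed (use assms in \<open>auto simp: BopD l2_scale algebra_simps\<close>)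
qed

lemma Bop_comp:
  assumes "T \<in> Bop G" "S \<in> Bop G"
  shows "T \<circ> S \<in> Bop G"
proof -
  obtain C where C: "C \<ge> 0" "\<And>\<xi>. \<xi> \<in> l2 G \<Longrightarrow> norm_l2 G (T \<xi>) \<le> C * norm_l2 G \<xi>"
    using Bop_bounded[OF assms(1)] by blast
  obtain D where D: "\<And>\<xi>. \<xi> \<in> l2 G \<Longrightarrow> norm_l2 G (S \<xi>) \<le> D * norm_l2 G \<xi>"
    using Bop_bounded[OF assms(2)] by blast
  have T0: "T (\<lambda>_. 0) = (\<lambda>_. 0)" using BopD(4)[OF assms(1) l2_zero, of 0] by simp
  show ?thesis
  proof (rule BopI[where C="C*D"])
    fix \<xi> assume \<xi>: "\<xi> \<in> l2 G"
    have "norm_l2 G (T (S \<xi>)) \<le> C * norm_l2 G (S \<xi>)" using C BopD(2)[OF assms(2) \<xi>] by blast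
    also have "\<dots> \<le> C * (D * norm_l2 G \<xi>)" using C D[OF \<xi>] by (simp add: mult_left_mono)
    finally show "norm_l2 G ((T \<circ> S) \<xi>) \<le> C * D * norm_l2 G \<xi>" by (simp add: mult.assoc)
  qed (use assms T0 in \<open>auto simp: BopD\<close>)
qed

lemma chop_eq_sum: "finite F \<Longrightarrow> chop F \<xi> = (\<lambda>g. \<Sum>k\<in>F. \<xi> k * delta k g)"
  by (auto simp: chop_def delta_def if_distrib if_distribR cong: if_cong)

lemma Bop_finite_sum:
  assumes "T \<in> Bop G" "finite F" "\<And>k. k \<in> F \<Longrightarrow> v k \<in> l2 G"
  shows "(\<lambda>g. \<Sum>k\<in>F. a k * v k g) \<in> l2 G"
    and "T (\<lambda>g. \<Sum>k\<in>F. a k * v k g) = (\<lambda>g. \<Sum>k\<in>F. a k * T (v k) g)"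
  using assms(2,3)
proof (induction F)
  case empty
  { case 1 show ?case by (simp add: l2_zero) }
  { case 2 show ?case using BopD(4)[OF assms(1) l2_zero, of 0] by simp }
next
  case (insert k F)
  { case 1 then show ?case using insert l2_add l2_scale by fastforce }
  { case 2 then show ?case using insert
      by (simp add: BopD(3)[OF assms(1)] BopD(4)[OF assms(1)] l2_scale) }
qed

lemma Bop_chop:
  assumes "T \<in> Bop G" "finite F" "F \<subseteq> carrier G"
  shows "T (chop F \<xi>) = (\<lambda>g. \<Sum>k\<in>F. \<xi> k * T (delta k) g)"
  unfolding chop_eq_sum[OF assms(2)]
  by (rule Bop_finite_sum(2)[OF assms(1,2), of delta \<xi>]) (use assms(3) in \<open>blast intro: l2_delta\<close>)

lemma inner_sum_right:
  assumes "finite F" "\<zeta> \<in> l2 G" "\<And>k. k \<in> F \<Longrightarrow> v k \<in> l2 G"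
  shows "inner_l2 G \<zeta> (\<lambda>g. \<Sum>k\<in>F. a k * v k g) = (\<Sum>k\<in>F. a k * inner_l2 G \<zeta> (v k))"
  using assms(1,3)
proof (induction F)
  case empty then show ?case by (simp add: inner_l2_def)
next
  case (insert k F)
  then show ?case using Bop_finite_sum(1)[OF Bop_idop, of F v G a] assms(2)
    by (simp add: inner_add_right l2_scale inner_scale_right)
qed

lemma inner_chop_left:
  assumes "finite F" "F \<subseteq> carrier G" "\<zeta> \<in> l2 G"
  shows "inner_l2 G (chop F \<xi>) \<zeta> = (\<Sum>k\<in>F. cnj (\<xi> k) * \<zeta> k)"
proof -
  have "inner_l2 G (chop F \<xi>) \<zeta> = cnj (\<Sum>k\<in>F. \<xi> k * inner_l2 G \<zeta> (delta k))"
    using assms by (subst inner_cnj, subst chop_eq_sum, simp, subst inner_sum_right) (auto simp: l2_delta)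
  also have "\<dots> = (\<Sum>k\<in>F. cnj (\<xi> k) * \<zeta> k)"
    using assms by (auto simp: inner_delta_right intro!: sum.cong)
  finally show ?thesis .
qed

text \<open>An epsilon/2 argument: finitely supported vectors are dense and the functionals are
  uniformly bounded. The map \<open>s\<close> covers linear functionals (identity) and conjugate
  linear ones (\<open>cnj\<close>) at once.\<close>

lemma bounded_functionals_tendsto_zero:
  fixes \<phi> :: "nat \<Rightarrow> ('a \<Rightarrow> complex) \<Rightarrow> complex"
  assumes bd: "\<And>i \<xi>. \<xi> \<in> l2 G \<Longrightarrow> cmod (\<phi> i \<xi>) \<le> K * norm_l2 G \<xi>"
    and diff: "\<And>i \<xi> \<eta>. \<xi> \<in> l2 G \<Longrightarrow> \<eta> \<in> l2 G \<Longrightarrow> \<phi> i (\<lambda>g. \<xi> g - \<eta> g) = \<phi> i \<xi> - \<phi> i \<eta>"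
    and fin: "\<And>i \<xi> F. finite F \<Longrightarrow> F \<subseteq> carrier G \<Longrightarrow> \<xi> \<in> l2 G \<Longrightarrow>
        \<phi> i (chop F \<xi>) = (\<Sum>k\<in>F. s (\<xi> k) * \<phi> i (delta k))"
    and lim: "\<And>k. k \<in> carrier G \<Longrightarrow> (\<lambda>i. \<phi> i (delta k)) \<longlonglongrightarrow> 0"
    and \<xi>: "\<xi> \<in> l2 G"
  shows "(\<lambda>i. \<phi> i \<xi>) \<longlonglongrightarrow> 0"
proof (rule LIMSEQ_I)
  fix r :: real assume "0 < r"
  \<comment> \<open>\<open>K\<close> carries no sign condition; \<open>\<bar>K\<bar> + 1\<close>
    dominates it and is a legitimate divisor.\<close>
  define \<epsilon> where "\<epsilon> = r / (2 * (\<bar>K\<bar> + 1))"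
  have \<epsilon>: "\<epsilon> > 0" using \<open>0 < r\<close> by (simp add: \<epsilon>_def add_nonneg_pos)
  obtain F where F: "finite F" "F \<subseteq> carrier G" "norm_l2 G (\<lambda>g. \<xi> g - chop F \<xi> g) < \<epsilon>"
    using l2_finite_approx[OF \<xi> \<epsilon>] .
  have small: "cmod (\<phi> i \<xi> - \<phi> i (chop F \<xi>)) < r / 2" for i
  proof -
    have "cmod (\<phi> i \<xi> - \<phi> i (chop F \<xi>)) \<le> K * norm_l2 G (\<lambda>g. \<xi> g - chop F \<xi> g)"
      using bd[of "\<lambda>g. \<xi> g - chop F \<xi> g" i] l2_diff[OF \<xi> l2_chop[OF \<xi>, of F]] diff[OF \<xi> l2_chop[OF \<xi>, of F]] by simp
    also have "\<dots> \<le> (\<bar>K\<bar> + 1) * norm_l2 G (\<lambda>g. \<xi> g - chop F \<xi> g)"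
      by (intro mult_right_mono norm_l2_nonneg) auto
    also have "\<dots> < (\<bar>K\<bar> + 1) * \<epsilon>" using F(3) by (intro mult_strict_left_mono) auto
    also have "\<dots> = r / 2" by (simp add: \<epsilon>_def field_simps add_nonneg_eq_0_iff)
    finally show ?thesis .
  qed
  have "(\<lambda>i. \<phi> i (chop F \<xi>)) \<longlonglongrightarrow> (\<Sum>k\<in>F. s (\<xi> k) * 0)"
    unfolding fin[OF F(1,2) \<xi>] using lim F by (intro tendsto_sum tendsto_mult tendsto_const) auto
  then obtain n0 where n0: "\<And>i. i \<ge> n0 \<Longrightarrow> cmod (\<phi> i (chop F \<xi>)) < r / 2"
    using LIMSEQ_D[of "\<lambda>i. \<phi> i (chop F \<xi>)" 0 "r/2"] \<open>0 < r\<close> by auto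
  show "\<exists>no. \<forall>n\<ge>no. cmod (\<phi> n \<xi> - 0) < r"
  proof (intro exI allI impI)
    fix n assume "n \<ge> n0"
    then show "cmod (\<phi> n \<xi> - 0) < r"
      using small[of n] n0[of n] norm_triangle_ineq[of "\<phi> n \<xi> - \<phi> n (chop F \<xi>)" "\<phi> n (chop F \<xi>)"] by simp
  qed
qed

text \<open>Under a uniform bound, weak convergence can be tested on matrix coefficients: density is
  used once in each argument of the form. The bound concerns the sesquilinear form instead of the
  operator norm, because \<open>conv_op_trunc\<close> obtains it in that shape as a limit.\<close>

lemma wot_tendsto:
  fixes T :: "nat \<Rightarrow> ('a \<Rightarrow> complex) \<Rightarrow> ('a \<Rightarrow> complex)"
  assumes Ti: "\<And>i. T i \<in> Bop G" and S: "S \<in> Bop G"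
    and bd: "\<And>i \<xi> \<eta>. \<xi> \<in> l2 G \<Longrightarrow> \<eta> \<in> l2 G \<Longrightarrow> cmod (inner_l2 G \<xi> (T i \<eta>)) \<le> C * norm_l2 G \<xi> * norm_l2 G \<eta>"
    and lim: "\<And>h k. h \<in> carrier G \<Longrightarrow> k \<in> carrier G \<Longrightarrow> (\<lambda>i. T i (delta k) h) \<longlonglongrightarrow> S (delta k) h"
    and \<xi>: "\<xi> \<in> l2 G" and \<eta>: "\<eta> \<in> l2 G"
  shows "(\<lambda>i. inner_l2 G \<xi> (T i \<eta>)) \<longlonglongrightarrow> inner_l2 G \<xi> (S \<eta>)"
proof -
  obtain D where D: "\<And>\<xi>. \<xi> \<in> l2 G \<Longrightarrow> norm_l2 G (S \<xi>) \<le> D * norm_l2 G \<xi>"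
    using Bop_bounded[OF S] by blast
  define b where "b i \<xi> \<eta> = inner_l2 G \<xi> (T i \<eta>) - inner_l2 G \<xi> (S \<eta>)" for i \<xi> \<eta>
  have bb: "cmod (b i \<xi> \<eta>) \<le> (C + D) * norm_l2 G \<xi> * norm_l2 G \<eta>" if "\<xi> \<in> l2 G" "\<eta> \<in> l2 G" for i \<xi> \<eta>
  proof -
    have "cmod (inner_l2 G \<xi> (S \<eta>)) \<le> norm_l2 G \<xi> * norm_l2 G (S \<eta>)"
      using inner_cauchy_schwarz that S BopD(2) by blast
    also have "\<dots> \<le> norm_l2 G \<xi> * (D * norm_l2 G \<eta>)"
      using D that norm_l2_nonneg by (intro mult_left_mono) auto
    finally show ?thesis
      using bd[OF that, of i] norm_triangle_ineq4[of "inner_l2 G \<xi> (T i \<eta>)" "inner_l2 G \<xi> (S \<eta>)"]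
      by (simp add: b_def algebra_simps)
  qed
  have step: "(\<lambda>i. b i \<xi> (delta k)) \<longlonglongrightarrow> 0" if k: "k \<in> carrier G" and \<xi>: "\<xi> \<in> l2 G" for k \<xi>
  proof (rule bounded_functionals_tendsto_zero[where \<phi>="\<lambda>i \<xi>. b i \<xi> (delta k)" and K="C + D" and s=cnj, OF _ _ _ _ \<xi>])
    note dk = l2_delta[OF k]
    note [simp] = BopD(2)[OF Ti dk] BopD(2)[OF S dk]
    show "cmod (b i \<xi> (delta k)) \<le> (C + D) * norm_l2 G \<xi>" if "\<xi> \<in> l2 G" for i \<xi>
      using bb[OF that dk, of i] by (simp add: norm_l2_delta[OF k])
    show "b i (\<lambda>g. \<xi> g - \<eta> g) (delta k) = b i \<xi> (delta k) - b i \<eta> (delta k)"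
      if "\<xi> \<in> l2 G" "\<eta> \<in> l2 G" for i \<xi> \<eta>
      using that by (simp add: b_def inner_diff_left)
    show "b i (chop F \<xi>) (delta k) = (\<Sum>h\<in>F. cnj (\<xi> h) * b i (delta h) (delta k))"
      if "finite F" "F \<subseteq> carrier G" "\<xi> \<in> l2 G" for i \<xi> F
      using that by (auto simp: b_def inner_chop_left inner_delta_left subset_iff right_diff_distrib
         simp flip: sum_subtractf intro!: sum.cong)
    show "(\<lambda>i. b i (delta h) (delta k)) \<longlonglongrightarrow> 0" if "h \<in> carrier G" for h
      using lim[OF that k] by (simp add: b_def inner_delta_left that LIM_zero)
  qed
  have "(\<lambda>i. b i \<xi> \<eta>) \<longlonglongrightarrow> 0"
  proof (rule bounded_functionals_tendsto_zero[where \<phi>="\<lambda>i \<eta>. b i \<xi> \<eta>" and K="(C + D) * norm_l2 G \<xi>" and s="\<lambda>x. x", OF _ _ _ _ \<eta>])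
    show "cmod (b i \<xi> \<eta>) \<le> (C + D) * norm_l2 G \<xi> * norm_l2 G \<eta>" if "\<eta> \<in> l2 G" for i \<eta>
      using bb[OF \<xi> that] .
    show "b i \<xi> (\<lambda>g. \<eta> g - \<zeta> g) = b i \<xi> \<eta> - b i \<xi> \<zeta>"
      if "\<eta> \<in> l2 G" "\<zeta> \<in> l2 G" for i \<eta> \<zeta>
      using that \<xi> by (simp add: b_def Bop_diff[OF Ti] Bop_diff[OF S] inner_diff_right BopD(2)[OF Ti] BopD(2)[OF S])
    show "b i \<xi> (chop F \<eta>) = (\<Sum>h\<in>F. \<eta> h * b i \<xi> (delta h))"
      if "finite F" "F \<subseteq> carrier G" "\<eta> \<in> l2 G" for i \<eta> F
      using that \<xi> by (subst b_def, subst (1 2) Bop_chop, simp_all add: Ti S, subst (1 2) inner_sum_right)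
        (auto simp: b_def subset_iff l2_delta BopD(2)[OF Ti] BopD(2)[OF S] right_diff_distrib simp flip: sum_subtractf)
    show "(\<lambda>i. b i \<xi> (delta h)) \<longlonglongrightarrow> 0" if "h \<in> carrier G" for h
      by (rule step[OF that \<xi>])
  qed
  then show ?thesis by (simp add: b_def LIM_zero_iff)
qed

text \<open>The constant sequence \<open>T\<close> converges weakly to \<open>S\<close> by
  \<open>wot_tendsto\<close>, and limits are unique.\<close>

lemma Bop_eq_on_delta:
  assumes "T \<in> Bop G" "S \<in> Bop G" "\<And>k. k \<in> carrier G \<Longrightarrow> T (delta k) = S (delta k)"
  shows "T = S"
proof (rule Bop_ext[OF assms(1,2)], rule l2_ext)
  fix \<eta> \<xi> assume \<eta>: "\<eta> \<in> l2 G" and \<xi>: "\<xi> \<in> l2 G"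
  obtain C where C: "\<And>\<xi>. \<xi> \<in> l2 G \<Longrightarrow> norm_l2 G (T \<xi>) \<le> C * norm_l2 G \<xi>"
    using Bop_bounded[OF assms(1)] by blast
  have "(\<lambda>i::nat. inner_l2 G \<xi> (T \<eta>)) \<longlonglongrightarrow> inner_l2 G \<xi> (S \<eta>)"
  proof (rule wot_tendsto[OF assms(1,2) _ _ \<xi> \<eta>])
    fix i :: nat and \<xi> \<eta> assume *: "\<xi> \<in> l2 G" "\<eta> \<in> l2 G"
    have "cmod (inner_l2 G \<xi> (T \<eta>)) \<le> norm_l2 G \<xi> * norm_l2 G (T \<eta>)"
      using * inner_cauchy_schwarz BopD(2)[OF assms(1)] by blast
    also have "\<dots> \<le> norm_l2 G \<xi> * (C * norm_l2 G \<eta>)"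
      using C * norm_l2_nonneg by (intro mult_left_mono) auto
    finally show "cmod (inner_l2 G \<xi> (T \<eta>)) \<le> C * norm_l2 G \<xi> * norm_l2 G \<eta>" by (simp add: algebra_simps)
  qed (use assms(3) in auto)
  then show "inner_l2 G \<xi> (T \<eta>) = inner_l2 G \<xi> (S \<eta>)" by (simp add: LIMSEQ_const_iff)
qed (use assms BopD(2) in auto)

text \<open>The adjoint is written down through its matrix coefficients. Pairing \<open>T\<close>
  applied to the finite piece \<open>chop F (S \<xi>)\<close> with \<open>\<xi>\<close> gives the
  squared norm of that piece, and cancelling one factor yields the bound
  \<open>C * norm_l2 G \<xi>\<close>.\<close>

lemma adjoint_exists:
  assumes T: "T \<in> Bop G"
  obtains S where "S \<in> Bop G" "is_adjoint G T S"
proof -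
  obtain C where C: "C \<ge> 0" "\<And>\<xi>. \<xi> \<in> l2 G \<Longrightarrow> norm_l2 G (T \<xi>) \<le> C * norm_l2 G \<xi>"
    using Bop_bounded[OF T] by blast
  define S where "S \<xi> = (\<lambda>g. if \<xi> \<in> l2 G \<and> g \<in> carrier G then inner_l2 G (T (delta g)) \<xi> else 0)" for \<xi>
  have Sl: "S \<xi> \<in> l2 G" "norm_l2 G (S \<xi>) \<le> C * norm_l2 G \<xi>" if \<xi>: "\<xi> \<in> l2 G" for \<xi>
  proof -
    have "L2_set (\<lambda>g. cmod (S \<xi> g)) F \<le> C * norm_l2 G \<xi>" if F: "finite F" "F \<subseteq> carrier G" for F
    proof -
      let ?n = "L2_set (\<lambda>g. cmod (S \<xi> g)) F"
      have chl: "chop F (S \<xi>) \<in> l2 G"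
        by (rule l2_finite_support[OF F]) (auto simp: chop_def)
      have nch: "norm_l2 G (chop F (S \<xi>)) = ?n"
        by (subst norm_l2_finite_support[OF F]) (auto simp: chop_def L2_set_def)
      have "inner_l2 G \<xi> (T (chop F (S \<xi>))) = (\<Sum>k\<in>F. S \<xi> k * inner_l2 G \<xi> (T (delta k)))"
        using F \<xi> by (subst Bop_chop[OF T F], subst inner_sum_right) (auto simp: l2_delta BopD(2)[OF T])
      also have "\<dots> = (\<Sum>k\<in>F. S \<xi> k * cnj (S \<xi> k))"
        using F \<xi> by (intro sum.cong refl, subst inner_cnj) (auto simp: S_def)
      also have "\<dots> = complex_of_real (?n\<^sup>2)"
        by (simp add: L2_set_def sum_nonneg complex_norm_square del: of_real_power)
      finally have "cmod (inner_l2 G \<xi> (T (chop F (S \<xi>)))) = ?n\<^sup>2" by (simp del: of_real_power)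
      moreover have "cmod (inner_l2 G \<xi> (T (chop F (S \<xi>)))) \<le> norm_l2 G \<xi> * norm_l2 G (T (chop F (S \<xi>)))"
        using inner_cauchy_schwarz \<xi> chl BopD(2)[OF T] by blast
      moreover have "\<dots> \<le> norm_l2 G \<xi> * (C * ?n)"
        using C(2)[OF chl] nch norm_l2_nonneg by (intro mult_left_mono) auto
      ultimately have "?n * ?n \<le> (C * norm_l2 G \<xi>) * ?n" by (simp add: power2_eq_square algebra_simps)
      then show ?thesis
        using C(1) norm_l2_nonneg[of G \<xi>] L2_set_nonneg[of "\<lambda>g. cmod (S \<xi> g)" F]
        by (metis mult_nonneg_nonneg mult_right_le_imp_le order_le_less)
    qed
    moreover have "S \<xi> g = 0" if "g \<notin> carrier G" for g using that by (simp add: S_def)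
    ultimately show "S \<xi> \<in> l2 G" "norm_l2 G (S \<xi>) \<le> C * norm_l2 G \<xi>"
      using l2_boundI[of G "S \<xi>"] by blast+
  qed
  have "S \<in> Bop G"
  proof (rule BopI[where C=C])
    show "S (\<lambda>g. \<xi> g + \<eta> g) = (\<lambda>g. S \<xi> g + S \<eta> g)" if "\<xi> \<in> l2 G" "\<eta> \<in> l2 G" for \<xi> \<eta>
      using that by (auto simp: S_def l2_add inner_add_right BopD(2)[OF T] l2_delta)
  qed (use Sl in \<open>auto simp: S_def l2_scale inner_scale_right\<close>)
  moreover have "is_adjoint G T S"
    unfolding is_adjoint_def
  proof (intro ballI)
    fix \<xi> \<eta> assume \<xi>: "\<xi> \<in> l2 G" and \<eta>: "\<eta> \<in> l2 G"
    \<comment> \<open>Again a constant sequence: a bounded functional that vanishes on all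
      \<open>delta h\<close> tends to 0, hence is 0.\<close>
    define \<phi> where "\<phi> = (\<lambda>(_::nat) \<eta>. inner_l2 G (S \<xi>) \<eta> - inner_l2 G \<xi> (T \<eta>))"
    have "(\<lambda>i. \<phi> i \<eta>) \<longlonglongrightarrow> 0"
    proof (rule bounded_functionals_tendsto_zero[where K="2 * C * norm_l2 G \<xi>" and s="\<lambda>x. x", OF _ _ _ _ \<eta>])
      show "cmod (\<phi> i \<eta>) \<le> 2 * C * norm_l2 G \<xi> * norm_l2 G \<eta>" if \<eta>: "\<eta> \<in> l2 G" for i \<eta>
      proof -
        have "cmod (inner_l2 G (S \<xi>) \<eta>) \<le> norm_l2 G (S \<xi>) * norm_l2 G \<eta>"
          by (intro inner_cauchy_schwarz Sl \<xi> \<eta>)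
        also have "\<dots> \<le> (C * norm_l2 G \<xi>) * norm_l2 G \<eta>" by (intro mult_right_mono Sl \<xi> norm_l2_nonneg)
        finally have 1: "cmod (inner_l2 G (S \<xi>) \<eta>) \<le> C * norm_l2 G \<xi> * norm_l2 G \<eta>" .
        have "cmod (inner_l2 G \<xi> (T \<eta>)) \<le> norm_l2 G \<xi> * norm_l2 G (T \<eta>)"
          by (intro inner_cauchy_schwarz \<xi> BopD(2)[OF T] \<eta>)
        also have "\<dots> \<le> norm_l2 G \<xi> * (C * norm_l2 G \<eta>)" by (intro mult_left_mono C \<eta> norm_l2_nonneg)
        finally show ?thesis using 1 norm_triangle_ineq4[of "inner_l2 G (S \<xi>) \<eta>" "inner_l2 G \<xi> (T \<eta>)"]
          by (simp add: \<phi>_def algebra_simps)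
      qed
      show "\<phi> i (\<lambda>g. \<eta> g - \<zeta> g) = \<phi> i \<eta> - \<phi> i \<zeta>" if "\<eta> \<in> l2 G" "\<zeta> \<in> l2 G" for i \<eta> \<zeta>
        using that Sl \<xi> by (simp add: \<phi>_def Bop_diff[OF T] inner_diff_right BopD(2)[OF T])
      show "\<phi> i (chop F \<eta>) = (\<Sum>k\<in>F. \<eta> k * \<phi> i (delta k))"
        if F: "finite F" "F \<subseteq> carrier G" "\<eta> \<in> l2 G" for i \<eta> F
      proof -
        have "inner_l2 G (S \<xi>) (chop F \<eta>) = (\<Sum>k\<in>F. \<eta> k * inner_l2 G (S \<xi>) (delta k))"
          unfolding chop_eq_sum[OF F(1)] using F Sl(1)[OF \<xi>] by (intro inner_sum_right) (auto intro: l2_delta)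
        moreover have "inner_l2 G \<xi> (T (chop F \<eta>)) = (\<Sum>k\<in>F. \<eta> k * inner_l2 G \<xi> (T (delta k)))"
          unfolding Bop_chop[OF T F(1,2)] using F \<xi> by (intro inner_sum_right BopD(2)[OF T]) (auto intro: l2_delta)
        ultimately show ?thesis by (simp add: \<phi>_def right_diff_distrib sum_subtractf)
      qed
      show "(\<lambda>i. \<phi> i (delta h)) \<longlonglongrightarrow> 0" if "h \<in> carrier G" for h
      proof -
        have "\<phi> i (delta h) = 0" for i
          using that \<xi> by (simp add: \<phi>_def inner_delta_right S_def flip: inner_cnj)
        then show ?thesis by simp
      qed
    qed
    then show "inner_l2 G (S \<xi>) \<eta> = inner_l2 G \<xi> (T \<eta>)" by (simp add: \<phi>_def LIMSEQ_const_iff)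
  qed
  ultimately show ?thesis using that by blast
qed

lemma is_adjoint_unique:
  assumes "S \<in> Bop G" "S' \<in> Bop G" "is_adjoint G T S" "is_adjoint G T S'"
  shows "S = S'"
proof (rule Bop_ext[OF assms(1,2)])
  fix \<xi> assume \<xi>: "\<xi> \<in> l2 G"
  show "S \<xi> = S' \<xi>"
  proof (rule l2_ext[of _ G])
    fix \<zeta> assume "\<zeta> \<in> l2 G"
    then show "inner_l2 G \<zeta> (S \<xi>) = inner_l2 G \<zeta> (S' \<xi>)"
      using assms(3,4) \<xi> unfolding is_adjoint_def by (subst (1 2) inner_cnj) simp
  qed (use assms \<xi> BopD(2) in auto)
qed

subsection \<open>The commutant of the right translations\<close>

lemma is_vNaD:
  assumes "is_vNa G M"
  shows "M \<subseteq> Bop G" "idop G \<in> M"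
    "T \<in> M \<Longrightarrow> S \<in> M \<Longrightarrow> (\<lambda>\<xi> g. T \<xi> g + S \<xi> g) \<in> M"
    "T \<in> M \<Longrightarrow> (\<lambda>\<xi> g. a * T \<xi> g) \<in> M"
    "T \<in> M \<Longrightarrow> S \<in> M \<Longrightarrow> T \<circ> S \<in> M"
    "T \<in> M \<Longrightarrow> \<exists>S\<in>M. is_adjoint G T S"
    "wot_closed G M"
  using assms unfolding is_vNa_def by blast+

lemma vNa_finite_sum:
  assumes "is_vNa G M" "finite F" "\<And>k. k \<in> F \<Longrightarrow> T k \<in> M"
  shows "(\<lambda>\<xi> g. \<Sum>k\<in>F. a k * T k \<xi> g) \<in> M"
  using assms(2,3)
proof (induction F)
  case empty
  show ?case using is_vNaD(4)[OF assms(1) is_vNaD(2)[OF assms(1)], of 0] by simp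
next
  case (insert k F)
  then show ?case using is_vNaD(3)[OF assms(1) is_vNaD(4)[OF assms(1), of "T k" "a k"]] by simp
qed

text \<open>A basic weak neighbourhood involves finitely many pairs of vectors only, so one index of
  the sequence serves all of them.\<close>

lemma wot_closed_sequential:
  assumes "wot_closed G M" "\<And>i::nat. T i \<in> M" "S \<in> Bop G"
    and lim: "\<And>\<xi> \<eta>. \<xi> \<in> l2 G \<Longrightarrow> \<eta> \<in> l2 G \<Longrightarrow> (\<lambda>i. inner_l2 G \<xi> (T i \<eta>)) \<longlonglongrightarrow> inner_l2 G \<xi> (S \<eta>)"
  shows "S \<in> M"
proof -
  have "\<exists>R\<in>M. \<forall>(\<xi>, \<eta>)\<in>F. cmod (inner_l2 G \<xi> (S \<eta>) - inner_l2 G \<xi> (R \<eta>)) < \<epsilon>"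
    if F: "finite F" "F \<subseteq> l2 G \<times> l2 G" and "\<epsilon> > 0" for F \<epsilon>
  proof -
    have "\<forall>\<^sub>F i in sequentially. \<forall>p\<in>F. cmod (inner_l2 G (fst p) (S (snd p)) - inner_l2 G (fst p) (T i (snd p))) < \<epsilon>"
    proof (subst eventually_ball_finite_distrib[OF F(1)], intro ballI)
      fix p assume "p \<in> F"
      then have "(\<lambda>i. inner_l2 G (fst p) (T i (snd p))) \<longlonglongrightarrow> inner_l2 G (fst p) (S (snd p))"
        using F(2) by (intro lim) auto
      from tendstoD[OF this \<open>\<epsilon> > 0\<close>]
      show "\<forall>\<^sub>F i in sequentially. cmod (inner_l2 G (fst p) (S (snd p)) - inner_l2 G (fst p) (T i (snd p))) < \<epsilon>"
        by (simp add: dist_norm norm_minus_commute)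
    qed
    then obtain i where "\<forall>p\<in>F. cmod (inner_l2 G (fst p) (S (snd p)) - inner_l2 G (fst p) (T i (snd p))) < \<epsilon>"
      using eventually_happens'[OF sequentially_bot] by blast
    then show ?thesis using assms(2)[of i] by (auto intro!: bexI[of _ "T i"])
  qed
  then show ?thesis using assms(1,3) unfolding wot_closed_def by blast
qed

definition rtrans :: "('a, 'b) monoid_scheme \<Rightarrow> 'a \<Rightarrow> ('a \<Rightarrow> complex) \<Rightarrow> ('a \<Rightarrow> complex)" where
  "rtrans G g \<xi> = (\<lambda>h. if h \<in> carrier G then \<xi> (h \<otimes>\<^bsub>G\<^esub> g) else 0)"

text \<open>The commutant of the right regular representation. It stands in for L(G): it contains
  L(G), and its elements are determined by their value at \<open>delta \<one>\<close>.\<close>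

definition rcomm :: "('a, 'b) monoid_scheme \<Rightarrow> (('a \<Rightarrow> complex) \<Rightarrow> ('a \<Rightarrow> complex)) set" where
  "rcomm G = {T \<in> Bop G. \<forall>g\<in>carrier G. \<forall>\<xi>\<in>l2 G. T (rtrans G g \<xi>) = rtrans G g (T \<xi>)}"

text \<open>Left convolution by \<open>a\<close>, that is, the group algebra element with
  coefficients \<open>a\<close>. It is meaningful for finite support only; a sum over an infinite
  index set is 0 by convention.\<close>

definition conv_op :: "('a, 'b) monoid_scheme \<Rightarrow> ('a \<Rightarrow> complex) \<Rightarrow> ('a \<Rightarrow> complex) \<Rightarrow> ('a \<Rightarrow> complex)" where
  "conv_op G a = (\<lambda>\<xi> h. \<Sum>k | a k \<noteq> 0. a k * lreg G k \<xi> h)"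

context group
begin

lemma
  assumes "g \<in> carrier G" "\<xi> \<in> l2 G"
  shows l2_rtrans: "rtrans G g \<xi> \<in> l2 G"
    and inner_rtrans: "inner_l2 G (rtrans G g \<xi>) (rtrans G g \<eta>) = inner_l2 G \<xi> \<eta>"
proof -
  have bij: "bij_betw (\<lambda>h. h \<otimes> g) (carrier G) (carrier G)"
    using assms(1) by (intro bij_betwI[where g="\<lambda>h. h \<otimes> inv g"]) (auto simp: m_assoc)
  have "(\<lambda>h. (cmod (\<xi> (h \<otimes> g)))\<^sup>2) summable_on carrier G"
    using summable_on_reindex_bij_betw[OF bij, of "\<lambda>h. (cmod (\<xi> h))\<^sup>2"] l2_summable[OF assms(2)] by simp
  then have "(\<lambda>h. (cmod (rtrans G g \<xi> h))\<^sup>2) summable_on carrier G"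
    by (subst summable_on_cong[where g="\<lambda>h. (cmod (\<xi> (h \<otimes> g)))\<^sup>2"]) (auto simp: rtrans_def)
  then show "rtrans G g \<xi> \<in> l2 G" by (simp add: l2_def rtrans_def)
  have "inner_l2 G (rtrans G g \<xi>) (rtrans G g \<eta>) = infsum (\<lambda>h. cnj (\<xi> (h \<otimes> g)) * \<eta> (h \<otimes> g)) (carrier G)"
    unfolding inner_l2_def by (rule infsum_cong) (auto simp: rtrans_def)
  then show "inner_l2 G (rtrans G g \<xi>) (rtrans G g \<eta>) = inner_l2 G \<xi> \<eta>"
    using infsum_reindex_bij_betw[OF bij, of "\<lambda>h. cnj (\<xi> h) * \<eta> h"] by (simp add: inner_l2_def)
qed

lemma rtrans_inv:
  assumes "g \<in> carrier G" "\<xi> \<in> l2 G"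
  shows "rtrans G g (rtrans G (inv g) \<xi>) = \<xi>" "rtrans G (inv g) (rtrans G g \<xi>) = \<xi>"
  using assms by (auto simp: rtrans_def m_assoc l2_outside)

lemma inner_rtrans_right:
  assumes "g \<in> carrier G" "\<xi> \<in> l2 G"
  shows "inner_l2 G \<xi> (rtrans G g \<eta>) = inner_l2 G (rtrans G (inv g) \<xi>) \<eta>"
  using inner_rtrans[OF assms(1) l2_rtrans[OF inv_closed[OF assms(1)] assms(2)], of \<eta>]
  by (simp add: rtrans_inv assms)

lemma
  assumes "g \<in> carrier G" "\<xi> \<in> l2 G"
  shows l2_lreg: "lreg G g \<xi> \<in> l2 G"
    and norm_lreg: "norm_l2 G (lreg G g \<xi>) = norm_l2 G \<xi>"
    and inner_lreg: "\<eta> \<in> l2 G \<Longrightarrow> inner_l2 G (lreg G g \<xi>) (lreg G g \<eta>) = inner_l2 G \<xi> \<eta>"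
proof -
  have bij: "bij_betw (\<lambda>h. inv g \<otimes> h) (carrier G) (carrier G)"
    using assms(1) by (intro bij_betwI[where g="\<lambda>h. g \<otimes> h"]) (auto simp flip: m_assoc)
  have e: "(cmod (lreg G g \<xi> h))\<^sup>2 = (cmod (\<xi> (inv g \<otimes> h)))\<^sup>2" if "h \<in> carrier G" for h
    using that assms by (simp add: lreg_def)
  have "(\<lambda>h. (cmod (\<xi> (inv g \<otimes> h)))\<^sup>2) summable_on carrier G"
    using summable_on_reindex_bij_betw[OF bij, of "\<lambda>h. (cmod (\<xi> h))\<^sup>2"] l2_summable[OF assms(2)] by simp
  then have "(\<lambda>h. (cmod (lreg G g \<xi> h))\<^sup>2) summable_on carrier G"
    by (subst summable_on_cong[OF e])
  then show "lreg G g \<xi> \<in> l2 G" using assms by (simp add: l2_def lreg_def)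
  show "norm_l2 G (lreg G g \<xi>) = norm_l2 G \<xi>"
    unfolding norm_l2_def using infsum_reindex_bij_betw[OF bij, of "\<lambda>h. (cmod (\<xi> h))\<^sup>2"] infsum_cong[of "carrier G", OF e]
    by presburger
  assume "\<eta> \<in> l2 G"
  then have "inner_l2 G (lreg G g \<xi>) (lreg G g \<eta>) = infsum (\<lambda>h. cnj (\<xi> (inv g \<otimes> h)) * \<eta> (inv g \<otimes> h)) (carrier G)"
    unfolding inner_l2_def using assms by (intro infsum_cong) (auto simp: lreg_def)
  then show "inner_l2 G (lreg G g \<xi>) (lreg G g \<eta>) = inner_l2 G \<xi> \<eta>"
    using infsum_reindex_bij_betw[OF bij, of "\<lambda>h. cnj (\<xi> h) * \<eta> h"] by (simp add: inner_l2_def)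
qed

lemma lreg_Bop: "g \<in> carrier G \<Longrightarrow> lreg G g \<in> Bop G"
proof (rule BopI[where C=1])
  fix \<xi> assume "g \<in> carrier G" "\<xi> \<in> l2 G"
  then show "lreg G g \<xi> \<in> l2 G" "norm_l2 G (lreg G g \<xi>) \<le> 1 * norm_l2 G \<xi>"
    by (simp_all add: l2_lreg norm_lreg)
qed (auto simp: lreg_def l2_add l2_scale)

lemma lreg_inv:
  assumes "g \<in> carrier G" "\<xi> \<in> l2 G"
  shows "lreg G g (lreg G (inv g) \<xi>) = \<xi>"
proof
  fix h show "lreg G g (lreg G (inv g) \<xi>) h = \<xi> h"
    using assms l2_lreg[of "inv g" \<xi>] by (auto simp: lreg_def l2_outside simp flip: m_assoc)
qed

text \<open>\<open>adj\<close> is a choice among adjoints, so its value is pinned down by uniqueness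
  inside \<open>Bop\<close>.\<close>

lemma adj_lreg:
  assumes "g \<in> carrier G"
  shows "adj G (lreg G g) = lreg G (inv g)"
proof -
  have "is_adjoint G (lreg G g) (lreg G (inv g))"
    unfolding is_adjoint_def
  proof (intro ballI)
    fix \<xi> \<eta> assume "\<xi> \<in> l2 G" "\<eta> \<in> l2 G"
    then show "inner_l2 G (lreg G (inv g) \<xi>) \<eta> = inner_l2 G \<xi> (lreg G g \<eta>)"
      using inner_lreg[OF assms l2_lreg[OF inv_closed[OF assms]], of \<xi> \<eta>] assms by (simp add: lreg_inv)
  qed
  then show ?thesis
    unfolding adj_def using assms lreg_Bop is_adjoint_unique by (intro some_equality) blast+
qed

lemma lreg_delta:
  assumes "g \<in> carrier G" "k \<in> carrier G"
  shows "lreg G g (delta k) = delta (g \<otimes> k)"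
proof
  fix h
  have "inv g \<otimes> h = k \<longleftrightarrow> h = g \<otimes> k" if "h \<in> carrier G"
    using assms that by (metis inv_closed inv_solve_left)
  then show "lreg G g (delta k) h = delta (g \<otimes> k) h"
    using assms l2_delta[OF assms(2)] by (auto simp: lreg_def) (auto simp: delta_def)
qed

text \<open>Adjoints stay in the commutant because the adjoint of a right translation is the
  translation by the inverse. Weak closedness holds because commuting with a translation is an
  equality between matrix coefficients.\<close>

lemma is_vNa_rcomm: "is_vNa G (rcomm G)"
  unfolding is_vNa_def
proof (intro conjI ballI allI)
  show "rcomm G \<subseteq> Bop G" by (auto simp: rcomm_def)
  show "idop G \<in> rcomm G" using Bop_idop[of G] by (auto simp: rcomm_def) (auto simp: idop_def l2_rtrans)
next
  fix T S assume TS: "T \<in> rcomm G" "S \<in> rcomm G"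
  then have "(\<lambda>\<xi> g. T \<xi> g + S \<xi> g) \<in> Bop G" by (auto simp: rcomm_def intro: Bop_add)
  moreover have "(\<lambda>h. T (rtrans G g \<xi>) h + S (rtrans G g \<xi>) h) = rtrans G g (\<lambda>h. T \<xi> h + S \<xi> h)"
    if "g \<in> carrier G" "\<xi> \<in> l2 G" for g \<xi>
  proof -
    have "T (rtrans G g \<xi>) = rtrans G g (T \<xi>)" "S (rtrans G g \<xi>) = rtrans G g (S \<xi>)"
      using TS that by (auto simp: rcomm_def)
    then show ?thesis by (simp only:) (simp add: rtrans_def fun_eq_iff)
  qed
  ultimately show "(\<lambda>\<xi> g. T \<xi> g + S \<xi> g) \<in> rcomm G" by (simp add: rcomm_def)
  from TS have "T \<circ> S \<in> Bop G" by (auto simp: rcomm_def intro: Bop_comp)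
  moreover have "T (S (rtrans G g \<xi>)) = rtrans G g (T (S \<xi>))" if "g \<in> carrier G" "\<xi> \<in> l2 G" for g \<xi>
    using TS that BopD(2)[of S G \<xi>] by (simp add: rcomm_def)
  ultimately show "T \<circ> S \<in> rcomm G" by (simp add: rcomm_def)
next
  fix T and a :: complex assume T: "T \<in> rcomm G"
  then have "(\<lambda>\<xi> g. a * T \<xi> g) \<in> Bop G" by (auto simp: rcomm_def intro: Bop_scale)
  moreover have "(\<lambda>h. a * T (rtrans G g \<xi>) h) = rtrans G g (\<lambda>h. a * T \<xi> h)"
    if "g \<in> carrier G" "\<xi> \<in> l2 G" for g \<xi>
  proof -
    have "T (rtrans G g \<xi>) = rtrans G g (T \<xi>)" using T that by (auto simp: rcomm_def)
    then show ?thesis by (simp only:) (simp add: rtrans_def fun_eq_iff)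
  qed
  ultimately show "(\<lambda>\<xi> g. a * T \<xi> g) \<in> rcomm G" by (simp add: rcomm_def)
next
  fix T assume T: "T \<in> rcomm G"
  then have TB: "T \<in> Bop G" by (simp add: rcomm_def)
  obtain S where S: "S \<in> Bop G" "is_adjoint G T S" using adjoint_exists[OF TB] .
  have "S (rtrans G g \<xi>) = rtrans G g (S \<xi>)" if g: "g \<in> carrier G" and \<xi>: "\<xi> \<in> l2 G" for g \<xi>
  proof (rule l2_ext[of _ G])
    fix \<eta> assume \<eta>: "\<eta> \<in> l2 G"
    have ad: "inner_l2 G \<eta> (S \<xi>) = inner_l2 G (T \<eta>) \<xi>" if "\<xi> \<in> l2 G" "\<eta> \<in> l2 G" for \<xi> \<eta>
      using S(2) that unfolding is_adjoint_def by (subst (1 2) inner_cnj) simp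
    have "inner_l2 G \<eta> (S (rtrans G g \<xi>)) = inner_l2 G (T \<eta>) (rtrans G g \<xi>)"
      using ad l2_rtrans g \<xi> \<eta> by simp
    also have "\<dots> = inner_l2 G (rtrans G (inv g) (T \<eta>)) \<xi>"
      using g \<eta> BopD(2)[OF TB] by (simp add: inner_rtrans_right)
    also have "\<dots> = inner_l2 G (T (rtrans G (inv g) \<eta>)) \<xi>"
      using T g \<eta> by (simp add: rcomm_def)
    also have "\<dots> = inner_l2 G \<eta> (rtrans G g (S \<xi>))"
      using g \<xi> \<eta> ad by (simp add: l2_rtrans inner_rtrans_right)
    finally show "inner_l2 G \<eta> (S (rtrans G g \<xi>)) = inner_l2 G \<eta> (rtrans G g (S \<xi>))" .
  qed (use g \<xi> BopD(2)[OF S(1)] l2_rtrans in blast)+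
  then show "\<exists>S\<in>rcomm G. is_adjoint G T S" using S by (auto simp: rcomm_def)
next
  show "wot_closed G (rcomm G)"
    unfolding wot_closed_def
  proof (intro ballI impI)
    fix T assume T: "T \<in> Bop G"
      and ap: "\<forall>F \<epsilon>. finite F \<longrightarrow> F \<subseteq> l2 G \<times> l2 G \<longrightarrow> 0 < \<epsilon> \<longrightarrow>
           (\<exists>S\<in>rcomm G. \<forall>(\<xi>, \<eta>)\<in>F. cmod (inner_l2 G \<xi> (T \<eta>) - inner_l2 G \<xi> (S \<eta>)) < \<epsilon>)"
    have "T (rtrans G g \<xi>) = rtrans G g (T \<xi>)" if g: "g \<in> carrier G" and \<xi>: "\<xi> \<in> l2 G" for g \<xi>
    proof (rule l2_ext[of _ G])
      fix \<zeta> assume \<zeta>: "\<zeta> \<in> l2 G"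
      let ?a = "inner_l2 G \<zeta> (T (rtrans G g \<xi>))" and ?b = "inner_l2 G (rtrans G (inv g) \<zeta>) (T \<xi>)"
      \<comment> \<open>\<open>?a\<close> and \<open>?b\<close> are two matrix coefficients of
        \<open>T\<close> that coincide for every member of the commutant, so a two-element test set
        is enough.\<close>
      have "cmod (?a - ?b) \<le> 0 + e" if "e > 0" for e
      proof -
        obtain S where S: "S \<in> rcomm G"
          "cmod (?a - inner_l2 G \<zeta> (S (rtrans G g \<xi>))) < e/2"
          "cmod (?b - inner_l2 G (rtrans G (inv g) \<zeta>) (S \<xi>)) < e/2"
          using ap[rule_format, of "{(\<zeta>, rtrans G g \<xi>), (rtrans G (inv g) \<zeta>, \<xi>)}" "e/2"] \<open>e > 0\<close> \<xi> \<zeta> g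
          by (auto simp: l2_rtrans)
        have "inner_l2 G \<zeta> (S (rtrans G g \<xi>)) = inner_l2 G (rtrans G (inv g) \<zeta>) (S \<xi>)"
          using S(1) g \<xi> \<zeta> by (simp add: rcomm_def inner_rtrans_right)
        then have "?a - ?b = (?a - inner_l2 G \<zeta> (S (rtrans G g \<xi>))) - (?b - inner_l2 G (rtrans G (inv g) \<zeta>) (S \<xi>))"
          by simp
        then show ?thesis using S(2,3)
          norm_triangle_ineq4[of "?a - inner_l2 G \<zeta> (S (rtrans G g \<xi>))" "?b - inner_l2 G (rtrans G (inv g) \<zeta>) (S \<xi>)"]
          by simp
      qed
      then have "cmod (?a - ?b) \<le> 0" by (rule field_le_epsilon)
      then show "inner_l2 G \<zeta> (T (rtrans G g \<xi>)) = inner_l2 G \<zeta> (rtrans G g (T \<xi>))"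
        using g \<zeta> by (simp add: inner_rtrans_right)
    qed (use g \<xi> BopD(2)[OF T] l2_rtrans in blast)+
    then show "T \<in> rcomm G" using T by (simp add: rcomm_def)
  qed
qed

lemma lreg_rcomm:
  assumes "g \<in> carrier G"
  shows "lreg G g \<in> rcomm G"
  unfolding rcomm_def
proof (intro CollectI conjI ballI)
  show "lreg G g \<in> Bop G" using assms by (rule lreg_Bop)
  fix k \<xi> assume "k \<in> carrier G" "\<xi> \<in> l2 G"
  then show "lreg G g (rtrans G k \<xi>) = rtrans G k (lreg G g \<xi>)"
    using assms l2_rtrans[of k \<xi>] by (simp add: lreg_def) (auto simp: rtrans_def m_assoc)
qed

text \<open>Through this inclusion the hypothesis that \<open>M\<close> lies in L(G) enters the
  argument: it makes coefficients available for elements of \<open>M\<close>.\<close>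

lemma grpvN_subset_rcomm: "grpvN G (carrier G) \<subseteq> rcomm G"
  unfolding grpvN_def vN_gen_def using is_vNa_rcomm lreg_rcomm by blast

text \<open>\<open>delta k\<close> is a right translate of \<open>delta \<one>\<close>, so the
  matrix of \<open>T\<close> depends on \<open>h \<otimes> inv k\<close> alone, and
  \<open>T (delta \<one>)\<close> is the sequence of Fourier coefficients of
  \<open>T\<close>.\<close>

lemma rcomm_delta:
  assumes "T \<in> rcomm G" "k \<in> carrier G" "h \<in> carrier G"
  shows "T (delta k) h = T (delta \<one>) (h \<otimes> inv k)"
proof -
  have "delta k = rtrans G (inv k) (delta \<one>)"
  proof
    fix h
    have "h \<otimes> inv k = \<one> \<longleftrightarrow> h = k" if "h \<in> carrier G" using inv_solve_right[of \<one> h k] assms(2) that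
      by auto
    then show "delta k h = rtrans G (inv k) (delta \<one>) h" using assms(2) by (auto simp: delta_def rtrans_def)
  qed
  moreover have "T (rtrans G (inv k) (delta \<one>)) = rtrans G (inv k) (T (delta \<one>))"
    using assms l2_delta[OF one_closed] by (simp add: rcomm_def)
  ultimately have "T (delta k) = rtrans G (inv k) (T (delta \<one>))" by simp
  then show ?thesis using assms by (simp add: rtrans_def)
qed

lemma rcomm_eqI:
  assumes "T \<in> rcomm G" "S \<in> rcomm G" "T (delta \<one>) = S (delta \<one>)"
  shows "T = S"
proof (rule Bop_eq_on_delta[of _ G])
  show B: "T \<in> Bop G" "S \<in> Bop G" using assms(1,2) unfolding rcomm_def by blast+
  fix k assume k: "k \<in> carrier G"
  show "T (delta k) = S (delta k)"
  proof
    fix h show "T (delta k) h = S (delta k) h"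
    proof (cases "h \<in> carrier G")
      case True
      then show ?thesis
        using rcomm_delta[OF assms(1) k True] rcomm_delta[OF assms(2) k True] assms(3) by simp
    next
      case False
      then show ?thesis
        using l2_outside[OF BopD(2)[OF B(1) l2_delta[OF k]]] l2_outside[OF BopD(2)[OF B(2) l2_delta[OF k]]] by simp
    qed
  qed
qed

lemma
  assumes "finite {k. a k \<noteq> 0}" "{k. a k \<noteq> 0} \<subseteq> carrier G"
  shows conv_op_rcomm: "conv_op G a \<in> rcomm G"
    and conv_op_delta_one: "conv_op G a (delta \<one>) = a"
proof -
  show "conv_op G a \<in> rcomm G"
    unfolding conv_op_def by (rule vNa_finite_sum[OF is_vNa_rcomm assms(1)]) (use assms(2) lreg_rcomm in auto)
  have "lreg G k (delta \<one>) = delta k" if "k \<in> {k. a k \<noteq> 0}" for k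
    using that assms(2) lreg_delta[of k \<one>] by auto
  then have "conv_op G a (delta \<one>) = chop {k. a k \<noteq> 0} a"
    by (simp add: conv_op_def chop_eq_sum[OF assms(1)])
  then show "conv_op G a (delta \<one>) = a" by (auto simp: chop_def)
qed

end

subsection \<open>Locally finite groups\<close>

locale locally_finite_group = group G for G :: "('a, 'b) monoid_scheme" (structure) +
  fixes Gn :: "nat \<Rightarrow> 'a set"
  assumes Gn_finite: "finite (Gn n)"
    and Gn_subgroup: "subgroup (Gn n) G"
    and Gn_mono: "n \<le> m \<Longrightarrow> Gn n \<subseteq> Gn m"
    and Gn_Union: "carrier G = (\<Union>n. Gn n)"
begin

lemma Gn_carrier: "Gn n \<subseteq> carrier G"
  using Gn_subgroup subgroup.subset by blast

lemma Gn_exhausts_finite: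
  assumes "finite F" "F \<subseteq> carrier G"
  obtains n where "F \<subseteq> Gn n"
proof -
  have "\<exists>n. F \<subseteq> Gn n" using assms
  proof (induction F)
    case (insert g F)
    then obtain n m where "F \<subseteq> Gn n" "g \<in> Gn m" using Gn_Union by auto
    then have "insert g F \<subseteq> Gn (max n m)" using Gn_mono[of n "max n m"] Gn_mono[of m "max n m"] by auto
    then show ?case by blast
  qed simp
  then show ?thesis using that by blast
qed

text \<open>The mean is a cluster point of the counting densities of the subgroups
  \<open>Gn n\<close> in a compact product of unit intervals. A cluster point is taken because the
  densities need not converge. It satisfies every closed condition that holds for all large
  \<open>n\<close>, and each axiom of a mean is such a condition.\<close>

theorem amenable: "amenable_grp G"
proof -
  define m :: "nat \<Rightarrow> 'a set \<Rightarrow> real" where "m n A = card (A \<inter> Gn n) / card (Gn n)" for n A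
  have pos: "card (Gn n) > 0" for n
    using Gn_finite subgroup.one_closed[OF Gn_subgroup] by (auto simp: card_gt_0_iff)
  define U :: "('a set \<Rightarrow> real) set" where "U = PiE UNIV (\<lambda>_. {0..1})"
  have "compactin (product_topology (\<lambda>_. euclidean) UNIV) U"
    unfolding U_def by (subst compactin_PiE) auto
  then have "compact U" by (simp add: euclidean_product_topology)
  have mU: "m n \<in> U" for n
  proof -
    have "card (A \<inter> Gn n) \<le> card (Gn n)" for A using Gn_finite by (intro card_mono) auto
    then show ?thesis using pos[of n] by (auto simp: U_def m_def PiE_iff)
  qed
  have "filtermap m sequentially \<noteq> bot" by (simp add: filtermap_bot_iff)
  moreover have "eventually (\<lambda>x. x \<in> U) (filtermap m sequentially)" by (simp add: eventually_filtermap mU)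
  ultimately obtain \<mu> where \<mu>: "\<mu> \<in> U" "inf (nhds \<mu>) (filtermap m sequentially) \<noteq> bot"
    using \<open>compact U\<close> unfolding compact_filter by blast
  have limit: "\<mu> \<in> K" if "closed K" "eventually (\<lambda>n. m n \<in> K) sequentially" for K
  proof (rule ccontr)
    assume "\<mu> \<notin> K"
    then have "eventually (\<lambda>x. x \<in> - K) (nhds \<mu>)" using that(1) by (intro eventually_nhds_in_open) auto
    moreover have "eventually (\<lambda>x. x \<in> K) (filtermap m sequentially)" using that(2) by (simp add: eventually_filtermap)
    ultimately have "eventually (\<lambda>_. False) (inf (nhds \<mu>) (filtermap m sequentially))"
      unfolding eventually_inf by (intro exI conjI) auto
    then show False using \<mu>(2) by (simp add: eventually_False)
  qed
  show ?thesis
    unfolding amenable_grp_def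
  proof (intro exI[of _ \<mu>] conjI allI impI)
    have "closed {x::'a set \<Rightarrow> real. x (carrier G) = 1}" by (intro closed_Collect_eq) auto
    moreover have "m n (carrier G) = 1" for n
      using pos[of n] Gn_carrier[of n] by (simp add: m_def Int_absorb1)
    ultimately have "\<mu> \<in> {x. x (carrier G) = 1}" by (intro limit) auto
    then show "\<mu> (carrier G) = 1" by simp
  next
    fix A show "0 \<le> \<mu> A" using \<mu>(1) by (auto simp: U_def PiE_iff)
  next
    fix A B :: "'a set" assume AB: "A \<inter> B = {}"
    have "closed {x::'a set \<Rightarrow> real. x (A \<union> B) = x A + x B}" by (intro closed_Collect_eq continuous_intros) auto
    moreover have "m n (A \<union> B) = m n A + m n B" for n
    proof -
      have "card ((A \<union> B) \<inter> Gn n) = card (A \<inter> Gn n) + card (B \<inter> Gn n)"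
        using AB Gn_finite by (subst Int_Un_distrib2, intro card_Un_disjoint) auto
      then show ?thesis by (simp add: m_def add_divide_distrib)
    qed
    ultimately have "\<mu> \<in> {x. x (A \<union> B) = x A + x B}" by (intro limit) auto
    then show "\<mu> (A \<union> B) = \<mu> A + \<mu> B" by simp
  next
    fix g A assume g: "g \<in> carrier G" and A: "A \<subseteq> carrier G"
    obtain N where N: "g \<in> Gn N" using g Gn_Union by blast
    have "closed {x::'a set \<Rightarrow> real. x (g <# A) = x A}" by (intro closed_Collect_eq) auto
    \<comment> \<open>Translation by \<open>g\<close> permutes \<open>Gn n\<close> once
      \<open>g\<close> belongs to it, so invariance holds from \<open>N\<close> on.\<close>
    moreover have "eventually (\<lambda>n. m n \<in> {x. x (g <# A) = x A}) sequentially"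
    proof (rule eventually_sequentiallyI[of N])
      fix n assume "n \<ge> N"
      then have gn: "g \<in> Gn n" using N Gn_mono by blast
      have sub: "subgroup (Gn n) G" by (rule Gn_subgroup)
      have "(g <# A) \<inter> Gn n = (\<lambda>a. g \<otimes> a) ` (A \<inter> Gn n)"
      proof (intro equalityI subsetI)
        fix y assume "y \<in> (g <# A) \<inter> Gn n"
        then obtain a where a: "a \<in> A" "y = g \<otimes> a" "y \<in> Gn n" by (auto simp: l_coset_def)
        then have "a = inv g \<otimes> y" using g A by (auto simp flip: m_assoc)
        then have "a \<in> Gn n"
          using subgroup.m_closed[OF sub subgroup.m_inv_closed[OF sub gn] a(3)] by simp
        then show "y \<in> (\<lambda>a. g \<otimes> a) ` (A \<inter> Gn n)" using a by blast
      qed (use gn sub in \<open>auto simp: l_coset_def subgroup.m_closed\<close>)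
      moreover have "inj_on (\<lambda>a. g \<otimes> a) (A \<inter> Gn n)" using g A l_cancel[of g] by (auto simp: inj_on_def subset_iff)
      ultimately show "m n \<in> {x. x (g <# A) = x A}" by (simp add: m_def card_image)
    qed
    ultimately have "\<mu> \<in> {x. x (g <# A) = x A}" by (rule limit)
    then show "\<mu> (g <# A) = \<mu> A" by simp
  qed
qed

end

text \<open>By \<open>Gn_exhausts_finite\<close>, leaving every \<open>Gn N\<close> amounts to
  leaving every finite subset. The threshold for \<open>i\<close> may depend on \<open>g\<close> and
  \<open>N\<close>, which is enough for convergence coefficient by coefficient.\<close>

locale escaping_group = locally_finite_group +
  assumes escape: "\<exists>c :: nat \<Rightarrow> 'a. (\<forall>i. c i \<in> carrier G) \<and>
     (\<forall>i. \<forall>g\<in>Gn n. inv (c i) \<otimes> g \<otimes> c i = g) \<and>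
     (\<forall>g\<in>carrier G - Gn n. \<forall>N. \<forall>\<^sub>F i in sequentially. inv (c i) \<otimes> g \<otimes> c i \<notin> Gn N)"
begin

text \<open>When level 0 is trivial, every \<open>g \<noteq> \<one>\<close> has an escaping sequence
  of conjugates, so no finite set contains its conjugacy class.\<close>

theorem icc:
  assumes "Gn 0 = {\<one>}"
  shows "icc_grp G"
  unfolding icc_grp_def
proof (intro ballI impI notI)
  fix g assume g: "g \<in> carrier G" "g \<noteq> \<one>"
    and fin: "finite {h \<otimes> g \<otimes> inv h | h. h \<in> carrier G}"
  obtain c where c: "\<And>i. c i \<in> carrier G" "\<And>N. \<forall>\<^sub>F i in sequentially. inv (c i) \<otimes> g \<otimes> c i \<notin> Gn N"
    using escape[of 0] g assms by blast
  obtain N where N: "{h \<otimes> g \<otimes> inv h | h. h \<in> carrier G} \<subseteq> Gn N"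
    using Gn_exhausts_finite[OF fin] g(1) by blast
  obtain i where "inv (c i) \<otimes> g \<otimes> c i \<notin> Gn N"
    using eventually_happens'[OF sequentially_bot c(2)] by blast
  moreover have "inv (c i) \<otimes> g \<otimes> c i \<in> {h \<otimes> g \<otimes> inv h | h. h \<in> carrier G}"
    using c(1)[of i] by (intro CollectI exI[of _ "inv (c i)"]) auto
  ultimately show False using N by blast
qed

end

text \<open>Converts escape in the group into convergence to 0 of the escaping coefficients.\<close>

lemma l2_vanishes_at_infinity:
  assumes "\<xi> \<in> l2 G" "\<epsilon> > 0"
  obtains F where "finite F" "F \<subseteq> carrier G" "\<And>h. h \<in> carrier G \<Longrightarrow> h \<notin> F \<Longrightarrow> cmod (\<xi> h) < \<epsilon>"
proof -
  obtain F where F: "finite F" "F \<subseteq> carrier G" "norm_l2 G (\<lambda>g. \<xi> g - chop F \<xi> g) < \<epsilon>"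
    using l2_finite_approx[OF assms] .
  have "cmod (\<xi> h) < \<epsilon>" if "h \<in> carrier G" "h \<notin> F" for h
    using L2_set_le_norm_l2[OF l2_diff[OF assms(1) l2_chop[OF assms(1), of F]], of "{h}"] that F(3)
    by (simp add: chop_def)
  then show ?thesis using F that by blast
qed

section \<open>Truncating the elements of an invariant von Neumann algebra\<close>

locale invariant_vNa = escaping_group +
  fixes M :: "(('a \<Rightarrow> complex) \<Rightarrow> 'a \<Rightarrow> complex) set"
  assumes vNa: "is_vNa G M" and M_sub: "M \<subseteq> grpvN G (carrier G)" and M_inv: "G_invariant G M"
begin

lemma M_rcomm: "M \<subseteq> rcomm G"
  using M_sub grpvN_subset_rcomm by blast

lemma M_Bop: "M \<subseteq> Bop G"
  using is_vNaD(1)[OF vNa] .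

lemma coeff_l2: "T \<in> M \<Longrightarrow> T (delta \<one>) \<in> l2 G"
  using BopD(2)[OF _ l2_delta[OF one_closed]] M_Bop by blast

lemma conj_in_M:
  assumes "T \<in> M" "g \<in> carrier G"
  shows "lreg G g \<circ> T \<circ> lreg G (inv g) \<in> M"
  using M_inv assms adj_lreg unfolding G_invariant_def by fastforce

lemma conj_coeff:
  assumes T: "T \<in> M" and g: "g \<in> carrier G" and h: "h \<in> carrier G"
  shows "(lreg G g \<circ> T \<circ> lreg G (inv g)) (delta \<one>) h = T (delta \<one>) (inv g \<otimes> h \<otimes> g)"
proof -
  have "T (delta (inv g)) \<in> l2 G" using BopD(2)[OF _ l2_delta[of "inv g"]] M_Bop T g by blast
  then have "(lreg G g \<circ> T \<circ> lreg G (inv g)) (delta \<one>) h = T (delta (inv g)) (inv g \<otimes> h)"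
    using g h lreg_delta[of "inv g" \<one>] by (simp add: lreg_def[of G g])
  also have "\<dots> = T (delta \<one>) (inv g \<otimes> h \<otimes> g)"
    using rcomm_delta[of T "inv g" "inv g \<otimes> h"] M_rcomm T g h by auto
  finally show ?thesis .
qed

lemma trunc_support:
  fixes a :: "'a \<Rightarrow> complex"
  shows "finite {k. chop (Gn n) a k \<noteq> 0}" "{k. chop (Gn n) a k \<noteq> 0} \<subseteq> carrier G" "{k. chop (Gn n) a k \<noteq> 0} \<subseteq> Gn n"
proof -
  show "{k. chop (Gn n) a k \<noteq> 0} \<subseteq> Gn n" by (auto simp: chop_def)
  then show "finite {k. chop (Gn n) a k \<noteq> 0}" "{k. chop (Gn n) a k \<noteq> 0} \<subseteq> carrier G"
    using Gn_finite[of n] Gn_carrier[of n] finite_subset by blast+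
qed

text \<open>Conjugation by the escaping sequence fixes the coefficients on \<open>Gn n\<close> and pushes all
  others to infinity, so the truncation is a weak operator limit of conjugates.\<close>

lemma conv_op_trunc:
  fixes n :: nat
  assumes x: "x \<in> M" and C: "\<And>\<xi>. \<xi> \<in> l2 G \<Longrightarrow> norm_l2 G (x \<xi>) \<le> C * norm_l2 G \<xi>"
  defines "t \<equiv> chop (Gn n) (x (delta \<one>))"
  shows "conv_op G t \<in> M"
    and "\<xi> \<in> l2 G \<Longrightarrow> \<eta> \<in> l2 G \<Longrightarrow> cmod (inner_l2 G \<xi> (conv_op G t \<eta>)) \<le> C * norm_l2 G \<xi> * norm_l2 G \<eta>"
proof -
  obtain c where c: "\<And>i. c i \<in> carrier G" "\<And>i g. g \<in> Gn n \<Longrightarrow> inv (c i) \<otimes> g \<otimes> c i = g"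
    "\<And>g N. g \<in> carrier G \<Longrightarrow> g \<notin> Gn n \<Longrightarrow> \<forall>\<^sub>F i in sequentially. inv (c i) \<otimes> g \<otimes> c i \<notin> Gn N"
    using escape[of n] by blast
  define T where "T i = lreg G (c i) \<circ> x \<circ> lreg G (inv (c i))" for i
  have TM: "T i \<in> M" for i unfolding T_def using conj_in_M x c(1) by blast
  have TB: "T i \<in> Bop G" for i using TM M_Bop by blast
  have S: "conv_op G t \<in> rcomm G" "conv_op G t (delta \<one>) = t"
    unfolding t_def by (intro conv_op_rcomm conv_op_delta_one trunc_support)+
  have SB: "conv_op G t \<in> Bop G" using S(1) by (simp add: rcomm_def)
  have bd: "cmod (inner_l2 G \<xi> (T i \<eta>)) \<le> C * norm_l2 G \<xi> * norm_l2 G \<eta>"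
    if "\<xi> \<in> l2 G" "\<eta> \<in> l2 G" for i \<xi> \<eta>
  proof -
    have l: "lreg G (inv (c i)) \<eta> \<in> l2 G" "x (lreg G (inv (c i)) \<eta>) \<in> l2 G"
      using c(1) that l2_lreg BopD(2) M_Bop x by (meson inv_closed subsetD)+
    have "norm_l2 G (T i \<eta>) = norm_l2 G (x (lreg G (inv (c i)) \<eta>))"
      using norm_lreg[OF c(1) l(2)] by (simp add: T_def)
    also have "\<dots> \<le> C * norm_l2 G \<eta>" using C[OF l(1)] norm_lreg[of "inv (c i)" \<eta>] c(1) that by simp
    finally have "norm_l2 G \<xi> * norm_l2 G (T i \<eta>) \<le> norm_l2 G \<xi> * (C * norm_l2 G \<eta>)"
      using norm_l2_nonneg by (intro mult_left_mono) auto
    then show ?thesis using inner_cauchy_schwarz[OF that(1) BopD(2)[OF TB that(2)], of i] by (simp add: algebra_simps)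
  qed
  have lim1: "(\<lambda>i. T i (delta \<one>) g) \<longlonglongrightarrow> t g" if g: "g \<in> carrier G" for g
  proof (cases "g \<in> Gn n")
    case True
    then have "T i (delta \<one>) g = t g" for i
      using conj_coeff[OF x c(1) g] c(2) by (simp add: T_def t_def chop_def)
    then show ?thesis by simp
  next
    case False
    have "(\<lambda>i. T i (delta \<one>) g) \<longlonglongrightarrow> 0"
    proof (rule tendstoI)
      fix e :: real assume "e > 0"
      obtain F where F: "finite F" "F \<subseteq> carrier G" "\<And>h. h \<in> carrier G \<Longrightarrow> h \<notin> F \<Longrightarrow> cmod (x (delta \<one>) h) < e"
        using l2_vanishes_at_infinity[OF coeff_l2[OF x] \<open>e > 0\<close>] by blast
      obtain N where N: "F \<subseteq> Gn N" using Gn_exhausts_finite[OF F(1,2)] by blast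
      show "\<forall>\<^sub>F i in sequentially. dist (T i (delta \<one>) g) 0 < e"
      proof (rule eventually_mono[OF c(3)[OF g False, of N]])
        fix i assume "inv (c i) \<otimes> g \<otimes> c i \<notin> Gn N"
        then show "dist (T i (delta \<one>) g) 0 < e"
          using conj_coeff[OF x c(1) g] F(3)[of "inv (c i) \<otimes> g \<otimes> c i"] N c(1)[of i] g by (auto simp: T_def)
      qed
    qed
    then show ?thesis using False by (simp add: t_def chop_def)
  qed
  have lim: "(\<lambda>i. inner_l2 G \<xi> (T i \<eta>)) \<longlonglongrightarrow> inner_l2 G \<xi> (conv_op G t \<eta>)"
    if "\<xi> \<in> l2 G" "\<eta> \<in> l2 G" for \<xi> \<eta>
  proof (rule wot_tendsto[OF TB SB bd _ that])
    fix h k assume hk: "h \<in> carrier G" "k \<in> carrier G"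
    have "T i (delta k) h = T i (delta \<one>) (h \<otimes> inv k)" for i
      using TM M_rcomm hk by (intro rcomm_delta) auto
    moreover have "conv_op G t (delta k) h = t (h \<otimes> inv k)"
      using rcomm_delta[OF S(1) hk(2,1)] S(2) by simp
    ultimately show "(\<lambda>i. T i (delta k) h) \<longlonglongrightarrow> conv_op G t (delta k) h"
      using lim1[of "h \<otimes> inv k"] hk by simp
  qed
  show "conv_op G t \<in> M"
    by (rule wot_closed_sequential[OF is_vNaD(7)[OF vNa] TM SB lim])
  \<comment> \<open>Conjugation by unitaries keeps the bound \<open>C\<close>, and the limit
    inherits it. Its independence of \<open>n\<close> is what the convergence of truncations in
    \<open>M_eq_grpvN\<close> rests on.\<close>
  show "cmod (inner_l2 G \<xi> (conv_op G t \<eta>)) \<le> C * norm_l2 G \<xi> * norm_l2 G \<eta>" if "\<xi> \<in> l2 G" "\<eta> \<in> l2 G"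
    by (rule LIMSEQ_le_const2[OF tendsto_norm[OF lim[OF that]]]) (use bd that in blast)
qed

text \<open>The intersection of \<open>M\<close> with the complex group algebra, encoded by
  coefficient functions; these determine the operators by \<open>rcomm_eqI\<close>.\<close>

definition P :: "('a \<Rightarrow> complex) set" where
  "P = {a. (\<exists>n. {k. a k \<noteq> 0} \<subseteq> Gn n) \<and> (\<exists>T\<in>M. T (delta \<one>) = a)}"

lemma P_finite_support:
  assumes "a \<in> P"
  shows "finite {k. a k \<noteq> 0}" "{k. a k \<noteq> 0} \<subseteq> carrier G"
proof -
  obtain n where "{k. a k \<noteq> 0} \<subseteq> Gn n" using assms by (auto simp: P_def)
  then show "finite {k. a k \<noteq> 0}" "{k. a k \<noteq> 0} \<subseteq> carrier G"
    using Gn_finite[of n] Gn_carrier[of n] finite_subset by blast+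
qed

lemma P_I:
  assumes "T \<in> M" "T (delta \<one>) = a" "finite {k. a k \<noteq> 0}"
  shows "a \<in> P"
proof -
  have "{k. a k \<noteq> 0} \<subseteq> carrier G"
    using l2_outside[OF coeff_l2[OF assms(1)]] assms(2) by auto
  then show ?thesis using assms Gn_exhausts_finite[OF assms(3)] unfolding P_def by blast
qed

lemma P_trunc: "a \<in> P \<Longrightarrow> chop (Gn n) a \<in> P"
proof -
  assume "a \<in> P"
  then obtain T where T: "T \<in> M" "T (delta \<one>) = a" by (auto simp: P_def)
  obtain C where C: "\<And>\<xi>. \<xi> \<in> l2 G \<Longrightarrow> norm_l2 G (T \<xi>) \<le> C * norm_l2 G \<xi>"
    using Bop_bounded M_Bop T(1) by blast
  show ?thesis
    using P_I[OF conv_op_trunc(1)[OF T(1) C, of n]] conv_op_delta_one trunc_support T(2) by simp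
qed

lemma P_one: "delta \<one> \<in> P"
proof (rule P_I[OF is_vNaD(2)[OF vNa]])
  show "idop G (delta \<one>) = delta \<one>" using l2_delta[of \<one> G] by (simp add: idop_def)
qed (simp add: delta_def)

lemma P_add:
  assumes "a \<in> P" "b \<in> P"
  shows "(\<lambda>k. a k + b k) \<in> P"
proof -
  obtain T S where "T \<in> M" "T (delta \<one>) = a" "S \<in> M" "S (delta \<one>) = b" using assms by (auto simp: P_def)
  moreover have "finite {k. a k + b k \<noteq> 0}"
    by (rule finite_subset[of _ "{k. a k \<noteq> 0} \<union> {k. b k \<noteq> 0}"]) (use assms P_finite_support in auto)
  ultimately show ?thesis using P_I[OF is_vNaD(3)[OF vNa, of T S]] by simp
qed

lemma P_scale:
  assumes "a \<in> P"
  shows "(\<lambda>k. z * a k) \<in> P"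
proof -
  obtain T where "T \<in> M" "T (delta \<one>) = a" using assms by (auto simp: P_def)
  moreover have "finite {k. z * a k \<noteq> 0}"
    by (rule finite_subset[of _ "{k. a k \<noteq> 0}"]) (use assms P_finite_support in auto)
  ultimately show ?thesis using P_I[OF is_vNaD(4)[OF vNa, of T z]] by simp
qed

lemma P_conj:
  assumes "a \<in> P" "g \<in> carrier G"
  shows "(\<lambda>k. if k \<in> carrier G then a (inv g \<otimes> k \<otimes> g) else 0) \<in> P"
proof -
  obtain T where T: "T \<in> M" "T (delta \<one>) = a" using assms by (auto simp: P_def)
  let ?S = "lreg G g \<circ> T \<circ> lreg G (inv g)"
  have S: "?S \<in> M" using conj_in_M T(1) assms(2) .
  have eq: "?S (delta \<one>) = (\<lambda>k. if k \<in> carrier G then a (inv g \<otimes> k \<otimes> g) else 0)"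
  proof
    fix h show "?S (delta \<one>) h = (if h \<in> carrier G then a (inv g \<otimes> h \<otimes> g) else 0)"
      using conj_coeff[OF T(1) assms(2), of h] T(2) l2_outside[OF coeff_l2[OF S], of h] by auto
  qed
  have "{k. (if k \<in> carrier G then a (inv g \<otimes> k \<otimes> g) else 0) \<noteq> 0} \<subseteq> (\<lambda>k. g \<otimes> k \<otimes> inv g) ` {k. a k \<noteq> 0}"
  proof
    fix k assume "k \<in> {k. (if k \<in> carrier G then a (inv g \<otimes> k \<otimes> g) else 0) \<noteq> 0}"
    then have k: "k \<in> carrier G" "a (inv g \<otimes> k \<otimes> g) \<noteq> 0" by (auto split: if_splits)
    have "k = g \<otimes> (inv g \<otimes> k \<otimes> g) \<otimes> inv g" using k(1) assms(2) by (simp add: m_assoc) (simp flip: m_assoc)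
    then show "k \<in> (\<lambda>k. g \<otimes> k \<otimes> inv g) ` {k. a k \<noteq> 0}" using k(2) by blast
  qed
  then have "finite {k. (if k \<in> carrier G then a (inv g \<otimes> k \<otimes> g) else 0) \<noteq> 0}"
    using P_finite_support(1)[OF assms(1)] finite_surj by blast
  then show ?thesis by (intro P_I[OF S eq])
qed

text \<open>The function is the coefficient sequence of a* b. Star and product are treated together
  because the adjoint relation evaluates the pairing of \<open>S b\<close> with
  \<open>delta h\<close> as that of \<open>b\<close> with \<open>T (delta h)\<close>, so no
  coefficients of the adjoint itself are needed.\<close>

lemma P_star_mult:
  assumes a: "a \<in> P" and b: "b \<in> P"
  shows "(\<lambda>h. if h \<in> carrier G then \<Sum>k | a k \<noteq> 0. cnj (a k) * b (k \<otimes> h) else 0) \<in> P" (is "?f \<in> P")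
proof -
  obtain T where T: "T \<in> M" "T (delta \<one>) = a" using a by (auto simp: P_def)
  obtain R where R: "R \<in> M" "R (delta \<one>) = b" using b by (auto simp: P_def)
  obtain S where S: "S \<in> M" "is_adjoint G T S" using is_vNaD(6)[OF vNa T(1)] by blast
  note fa = P_finite_support[OF a] and fb = P_finite_support[OF b]
  have SR: "S \<circ> R \<in> M" using is_vNaD(5)[OF vNa S(1) R(1)] .
  have bl: "b \<in> l2 G" using coeff_l2[OF R(1)] R(2) by simp
  have eq: "(S \<circ> R) (delta \<one>) = ?f"
  proof
    fix h show "(S \<circ> R) (delta \<one>) h = ?f h"
    proof (cases "h \<in> carrier G")
      case False
      then show ?thesis using l2_outside[OF coeff_l2[OF SR]] by simp
    next
      case True
      have Tl: "T (delta h) \<in> l2 G" using BopD(2)[OF _ l2_delta[OF True]] M_Bop T(1) by blast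
      have "chop {k. b k \<noteq> 0} b = b" by (auto simp: chop_def)
      then have ib: "inner_l2 G b (T (delta h)) = (\<Sum>k | b k \<noteq> 0. cnj (b k) * T (delta h) k)"
        using inner_chop_left[OF fb Tl, of b] by simp
      have "(S \<circ> R) (delta \<one>) h = S b h" using R(2) by simp
      also have "\<dots> = cnj (inner_l2 G (S b) (delta h))" using True by (simp add: inner_delta_right)
      also have "\<dots> = cnj (inner_l2 G b (T (delta h)))"
        using S(2) bl l2_delta[OF True] by (simp add: is_adjoint_def)
      also have "\<dots> = (\<Sum>k | b k \<noteq> 0. b k * cnj (T (delta h) k))" unfolding ib by simp
      also have "\<dots> = (\<Sum>k | b k \<noteq> 0. b k * cnj (a (k \<otimes> inv h)))"
        using rcomm_delta[of T h] M_rcomm T True fb(2) by (intro sum.cong) auto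
      \<comment> \<open>Substituting \<open>k \<otimes> h\<close> for \<open>k\<close> does not
        match the two supports exactly; the sets \<open>S'\<close> and \<open>T'\<close> collect the
        indices at which the other factor vanishes.\<close>
      also have "\<dots> = (\<Sum>k | a k \<noteq> 0. cnj (a k) * b (k \<otimes> h))"
      proof (rule sum.reindex_bij_witness_not_neutral[where i="\<lambda>k. k \<otimes> h" and j="\<lambda>k. k \<otimes> inv h"
            and S'="{k. b k \<noteq> 0 \<and> a (k \<otimes> inv h) = 0}" and T'="{k. a k \<noteq> 0 \<and> b (k \<otimes> h) = 0}"])
        show "finite {k. b k \<noteq> 0 \<and> a (k \<otimes> inv h) = 0}" using fb(1) by (rule rev_finite_subset) auto
        show "finite {k. a k \<noteq> 0 \<and> b (k \<otimes> h) = 0}" using fa(1) by (rule rev_finite_subset) auto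
      qed (use fa(2) fb(2) True in \<open>auto simp: m_assoc subset_iff\<close>)
      finally show ?thesis using True by simp
    qed
  qed
  have "{h. ?f h \<noteq> 0} \<subseteq> (\<lambda>(k,l). inv k \<otimes> l) ` ({k. a k \<noteq> 0} \<times> {k. b k \<noteq> 0})"
  proof
    fix h assume "h \<in> {h. ?f h \<noteq> 0}"
    then have h: "h \<in> carrier G" "(\<Sum>k | a k \<noteq> 0. cnj (a k) * b (k \<otimes> h)) \<noteq> 0" by (auto split: if_splits)
    then obtain k where "a k \<noteq> 0" "cnj (a k) * b (k \<otimes> h) \<noteq> 0" using sum.not_neutral_contains_not_neutral by blast
    moreover from this have "h = inv k \<otimes> (k \<otimes> h)" using fa(2) h(1) by (auto simp flip: m_assoc)
    ultimately show "h \<in> (\<lambda>(k,l). inv k \<otimes> l) ` ({k. a k \<noteq> 0} \<times> {k. b k \<noteq> 0})"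
      by (intro image_eqI[of _ _ "(k, k \<otimes> h)"]) auto
  qed
  then have "finite {h. ?f h \<noteq> 0}"
    by (rule finite_subset) (intro finite_imageI finite_cartesian_product fa(1) fb(1))
  then show ?thesis by (rule P_I[OF SR eq])
qed

lemma lreg_in_M:
  assumes "delta g \<in> P" "g \<in> carrier G"
  shows "lreg G g \<in> M"
proof -
  obtain T where T: "T \<in> M" "T (delta \<one>) = delta g" using assms by (auto simp: P_def)
  then have "T = lreg G g"
    using M_rcomm lreg_rcomm lreg_delta[OF assms(2) one_closed] assms(2) by (intro rcomm_eqI) auto
  then show ?thesis using T by simp
qed

text \<open>For the harder inclusion, an arbitrary von Neumann algebra containing the generators is
  considered. The truncations of \<open>x\<close> lie in it by \<open>supp\<close>; they are
  uniformly bounded and each coefficient is eventually constant, so they converge weakly to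
  \<open>x\<close>.\<close>

lemma M_eq_grpvN:
  assumes supp: "\<And>a k. a \<in> P \<Longrightarrow> a k \<noteq> 0 \<Longrightarrow> delta k \<in> P"
  defines "N \<equiv> {g \<in> carrier G. delta g \<in> P}"
  shows "M = grpvN G N"
proof
  have "lreg G ` N \<subseteq> M" using lreg_in_M by (auto simp: N_def)
  then show "grpvN G N \<subseteq> M" unfolding grpvN_def vN_gen_def using vNa by blast
  show "M \<subseteq> grpvN G N"
    unfolding grpvN_def vN_gen_def
  proof (intro subsetI InterI)
    fix x M' assume x: "x \<in> M" and "M' \<in> {M. is_vNa G M \<and> lreg G ` N \<subseteq> M}"
    then have M': "is_vNa G M'" "lreg G ` N \<subseteq> M'" by auto
    obtain C where C: "\<And>\<xi>. \<xi> \<in> l2 G \<Longrightarrow> norm_l2 G (x \<xi>) \<le> C * norm_l2 G \<xi>"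
      using Bop_bounded M_Bop x by blast
    define t where "t n = chop (Gn n) (x (delta \<one>))" for n
    have tM: "conv_op G (t n) \<in> M" for n unfolding t_def by (rule conv_op_trunc(1)[OF x C])
    have tr: "conv_op G (t n) \<in> rcomm G" "conv_op G (t n) (delta \<one>) = t n" for n
      unfolding t_def by (intro conv_op_rcomm conv_op_delta_one trunc_support)+
    have tP: "t n \<in> P" for n
      using P_I[OF tM tr(2)] trunc_support(1) by (simp add: t_def)
    have "{k. t n k \<noteq> 0} \<subseteq> N" for n
      using supp[OF tP] P_finite_support(2)[OF tP] by (auto simp: N_def)
    then have tM': "conv_op G (t n) \<in> M'" for n
      unfolding conv_op_def using M'(2) P_finite_support(1)[OF tP] by (intro vNa_finite_sum[OF M'(1)]) auto
    have xr: "x \<in> rcomm G" using M_rcomm x by blast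
    have xB: "x \<in> Bop G" using M_Bop x by blast
    show "x \<in> M'"
    proof (rule wot_closed_sequential[OF is_vNaD(7)[OF M'(1)] tM' xB])
      fix \<xi> \<eta> assume "\<xi> \<in> l2 G" "\<eta> \<in> l2 G"
      then show "(\<lambda>n. inner_l2 G \<xi> (conv_op G (t n) \<eta>)) \<longlonglongrightarrow> inner_l2 G \<xi> (x \<eta>)"
      proof (rule wot_tendsto[rotated 4])
        show "conv_op G (t n) \<in> Bop G" for n using tM M_Bop by blast
        show "x \<in> Bop G" by fact
        show "cmod (inner_l2 G \<xi> (conv_op G (t n) \<eta>)) \<le> C * norm_l2 G \<xi> * norm_l2 G \<eta>"
          if "\<xi> \<in> l2 G" "\<eta> \<in> l2 G" for n \<xi> \<eta>
          unfolding t_def by (rule conv_op_trunc(2)[OF x C that])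
        fix h k assume hk: "h \<in> carrier G" "k \<in> carrier G"
        have e1: "conv_op G (t n) (delta k) h = t n (h \<otimes> inv k)" for n
          using rcomm_delta[OF tr(1) hk(2,1)] tr(2) by simp
        have e2: "x (delta k) h = x (delta \<one>) (h \<otimes> inv k)" using rcomm_delta[OF xr hk(2,1)] .
        obtain m where m: "h \<otimes> inv k \<in> Gn m" using hk Gn_Union by (metis UN_E inv_closed m_closed)
        have "\<forall>\<^sub>F n in sequentially. conv_op G (t n) (delta k) h = x (delta k) h"
        proof (rule eventually_sequentiallyI[of m])
          fix n assume "m \<le> n"
          then have "t n (h \<otimes> inv k) = x (delta \<one>) (h \<otimes> inv k)"
            using m Gn_mono[of m n] by (auto simp: t_def chop_def)
          then show "conv_op G (t n) (delta k) h = x (delta k) h" using e1 e2 by simp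
        qed
        then show "(\<lambda>n. conv_op G (t n) (delta k) h) \<longlonglongrightarrow> x (delta k) h"
          by (rule tendsto_eventually)
      qed
    qed
  qed
qed

end

subsection \<open>The conditional expectation on group elements\<close>

lemma inner_finite_support:
  assumes "finite F" "F \<subseteq> carrier G" "\<And>g. g \<notin> F \<Longrightarrow> a g = 0" "b \<in> l2 G"
  shows "inner_l2 G a b = (\<Sum>k\<in>F. cnj (a k) * b k)"
proof -
  have "chop F a = a" using assms(3) by (auto simp: chop_def)
  then show ?thesis using inner_chop_left[OF assms(1,2,4), of a] by simp
qed

lemma inner_self_finite_support:
  assumes "finite F" "F \<subseteq> carrier G" "\<And>g. g \<notin> F \<Longrightarrow> a g = 0"
  shows "inner_l2 G a a = complex_of_real (\<Sum>k\<in>F. (cmod (a k))\<^sup>2)"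
  using inner_finite_support[of F G a a, OF assms l2_finite_support[of F G a, OF assms]]
  by (simp add: complex_norm_square mult.commute del: of_real_power)

lemma inner_self_eq_0:
  assumes "finite F" "F \<subseteq> carrier G" "\<And>g. g \<notin> F \<Longrightarrow> a g = 0" "inner_l2 G a a = 0"
  shows "a = (\<lambda>_. 0)"
proof -
  have "(\<Sum>k\<in>F. (cmod (a k))\<^sup>2) = 0"
    using inner_self_finite_support[of F G a] assms by (simp del: of_real_sum of_real_power)
  then have *: "\<forall>k\<in>F. a k = 0" using assms(1) by (subst (asm) sum_nonneg_eq_0_iff) auto
  show ?thesis
  proof
    fix k show "a k = 0" using * assms(3) by (cases "k \<in> F") auto
  qed
qed

text \<open>Gram-Schmidt by induction on the support: the vectors of \<open>V\<close> vanishing at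
  the new point \<open>x\<close> form a subspace \<open>W\<close> of codimension at most one, to
  which the induction hypothesis applies.\<close>

lemma finite_dim_projection:
  assumes "finite F" "F \<subseteq> carrier G" "\<And>a g. a \<in> V \<Longrightarrow> g \<notin> F \<Longrightarrow> a g = 0"
    and "(\<lambda>_. 0) \<in> V" "\<And>a b. a \<in> V \<Longrightarrow> b \<in> V \<Longrightarrow> (\<lambda>k. a k + b k) \<in> V"
    and "\<And>a z. a \<in> V \<Longrightarrow> (\<lambda>k. z * a k) \<in> V" and "\<eta> \<in> l2 G"
  shows "\<exists>\<xi>\<in>V. \<forall>y\<in>V. inner_l2 G y \<xi> = inner_l2 G y \<eta>"
  using assms
proof (induction F arbitrary: V \<eta>)
  case empty
  then have "y k = 0" if "y \<in> V" for y k using that by blast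
  then have "inner_l2 G y (\<lambda>_. 0) = inner_l2 G y \<eta>" if "y \<in> V" for y
    using that unfolding inner_l2_def by (intro infsum_cong) simp
  then show ?case using empty.prems(3) by blast
next
  case (insert x F)
  define W where "W = {y \<in> V. y x = 0}"
  have Vl: "a \<in> l2 G" if "a \<in> V" for a
    using insert.prems(1,2) insert.hyps(1) that by (intro l2_finite_support[of "insert x F"]) auto
  have IH: "\<exists>\<xi>\<in>W. \<forall>y\<in>W. inner_l2 G y \<xi> = inner_l2 G y \<eta>" if "\<eta> \<in> l2 G" for \<eta>
  proof (rule insert.IH)
    show "a g = 0" if "a \<in> W" "g \<notin> F" for a g
      using insert.prems(2)[of a g] that by (cases "g = x") (auto simp: W_def)
  qed (use insert.prems that in \<open>auto simp: W_def\<close>)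
  show ?case
  proof (cases "V = W")
    case True
    then show ?thesis using IH insert.prems by blast
  next
    case False
    then obtain v where v: "v \<in> V" "v x \<noteq> 0" by (auto simp: W_def)
    obtain v' where v': "v' \<in> W" "\<And>y. y \<in> W \<Longrightarrow> inner_l2 G y v' = inner_l2 G y v"
      using IH[OF Vl[OF v(1)]] by blast
    obtain \<xi>' where \<xi>': "\<xi>' \<in> W" "\<And>y. y \<in> W \<Longrightarrow> inner_l2 G y \<xi>' = inner_l2 G y \<eta>"
      using IH[OF insert.prems(6)] by blast
    have WV: "y \<in> V" if "y \<in> W" for y using that by (simp add: W_def)
    \<comment> \<open>\<open>v'\<close> is the projection of \<open>v\<close> to \<open>W\<close>,
      so \<open>w\<close> spans the orthogonal complement of \<open>W\<close> in
      \<open>V\<close>.\<close>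
    define w where "w = (\<lambda>k. v k + (-1) * v' k)"
    have wV: "w \<in> V" unfolding w_def by (intro insert.prems(4,5) v WV v')
    have wx: "w x \<noteq> 0" using v v'(1) by (simp add: w_def W_def)
    have yw: "inner_l2 G y w = 0" if "y \<in> W" for y
    proof -
      have "inner_l2 G y w = inner_l2 G y v + (-1) * inner_l2 G y v'"
        unfolding w_def using Vl WV v v' that l2_scale[OF Vl[OF WV[OF v'(1)]], of "-1"]
        by (subst inner_add_right) (auto simp only: inner_scale_right)
      then show ?thesis using v'(2)[OF that] by simp
    qed
    have wy: "inner_l2 G w y = 0" if "y \<in> W" for y using yw[OF that] by (subst inner_cnj) simp
    have ww: "inner_l2 G w w \<noteq> 0"
    proof
      assume "inner_l2 G w w = 0"
      then have "w = (\<lambda>_. 0)"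
        using insert.prems(1,2) insert.hyps(1) wV by (intro inner_self_eq_0[of "insert x F" G]) auto
      then show False using wx by simp
    qed
    define z where "z = inner_l2 G w \<eta> / inner_l2 G w w"
    define \<xi> where "\<xi> = (\<lambda>k. \<xi>' k + z * w k)"
    have \<xi>V: "\<xi> \<in> V" unfolding \<xi>_def by (intro insert.prems(4,5) wV WV \<xi>')
    have "inner_l2 G y \<xi> = inner_l2 G y \<eta>" if y: "y \<in> V" for y
    proof -
      \<comment> \<open>Chosen so that subtracting \<open>s\<close> times \<open>w\<close> from
        \<open>y\<close> kills the value at \<open>x\<close> and lands in \<open>W\<close>.\<close>
      define s where "s = y x / w x"
      define y' where "y' = (\<lambda>k. y k + (- s) * w k)"
      have y'W: "y' \<in> W" unfolding W_def
      proof (intro CollectI conjI)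
        show "y' \<in> V" unfolding y'_def by (intro insert.prems(4,5) wV y)
        show "y' x = 0" using wx by (simp add: y'_def s_def)
      qed
      have ysplit: "y = (\<lambda>k. y' k + s * w k)" by (simp add: y'_def)
      note l = Vl[OF WV[OF y'W]] Vl[OF wV] Vl[OF WV[OF \<xi>'(1)]] insert.prems(6) l2_scale[OF Vl[OF wV]]
      have "inner_l2 G y \<xi> = inner_l2 G y' \<xi> + cnj s * inner_l2 G w \<xi>"
        using l Vl[OF \<xi>V] by (subst ysplit) (simp add: inner_add_left inner_scale_left)
      also have "inner_l2 G y' \<xi> = inner_l2 G y' \<eta>"
        unfolding \<xi>_def using l yw[OF y'W] \<xi>'(2)[OF y'W] by (simp add: inner_add_right inner_scale_right)
      also have "inner_l2 G w \<xi> = inner_l2 G w \<eta>"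
        unfolding \<xi>_def using l wy[OF \<xi>'(1)] ww by (simp add: inner_add_right inner_scale_right) (simp add: z_def)
      also have "inner_l2 G y' \<eta> + cnj s * inner_l2 G w \<eta> = inner_l2 G y \<eta>"
        using l by (subst ysplit) (simp add: inner_add_left inner_scale_left)
      finally show ?thesis .
    qed
    then show ?thesis using \<xi>V by blast
  qed
qed

context invariant_vNa
begin

lemma P_zero: "(\<lambda>_. 0) \<in> P"
  using P_scale[OF P_one, of 0] by simp

lemma P_l2: "a \<in> P \<Longrightarrow> a \<in> l2 G"
  using P_finite_support[of a] by (intro l2_finite_support[of "{k. a k \<noteq> 0}"]) auto

lemma P_support: "a \<in> P \<Longrightarrow> a k \<noteq> 0 \<Longrightarrow> k \<in> carrier G"
  using P_finite_support(2) by blast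

lemma P_inner: "a \<in> P \<Longrightarrow> b \<in> l2 G \<Longrightarrow> inner_l2 G a b = (\<Sum>k | a k \<noteq> 0. cnj (a k) * b k)"
  using P_finite_support[of a] by (intro inner_finite_support) auto

lemma P_inner_self: "a \<in> P \<Longrightarrow> inner_l2 G a a = complex_of_real (\<Sum>k | a k \<noteq> 0. (cmod (a k))\<^sup>2)"
  using P_finite_support[of a] by (intro inner_self_finite_support) auto

text \<open>The coefficient function of the conditional expectation of the unitary of \<open>g\<close>.\<close>

definition E :: "'a \<Rightarrow> 'a \<Rightarrow> complex" where
  "E g = (SOME \<xi>. \<xi> \<in> P \<and> (\<forall>y\<in>P. inner_l2 G y \<xi> = cnj (y g)))"

lemma E_unique:
  assumes "\<xi> \<in> P" "\<eta> \<in> P" "\<And>y. y \<in> P \<Longrightarrow> inner_l2 G y \<xi> = inner_l2 G y \<eta>"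
  shows "\<xi> = \<eta>"
proof -
  define d where "d = (\<lambda>k. \<xi> k + (-1) * \<eta> k)"
  have dP: "d \<in> P" unfolding d_def by (intro P_add P_scale assms)
  have "inner_l2 G d (\<lambda>k. \<xi> k + (-1) * \<eta> k) = inner_l2 G d \<xi> + (-1) * inner_l2 G d \<eta>"
    using inner_add_right[OF P_l2[OF dP] P_l2[OF assms(1)] l2_scale[OF P_l2[OF assms(2)], of "-1"]]
    by (simp only: inner_scale_right)
  then have "inner_l2 G d d = inner_l2 G d \<xi> + (-1) * inner_l2 G d \<eta>" by (simp only: d_def[symmetric])
  also have "\<dots> = 0" using assms(3)[OF dP] by simp
  finally have "d = (\<lambda>_. 0)"
    using P_finite_support[OF dP] by (intro inner_self_eq_0[of "{k. d k \<noteq> 0}" G]) auto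
  then show ?thesis by (auto simp: d_def fun_eq_iff)
qed

text \<open>Paired with a function supported on \<open>Gn n\<close>, an element of \<open>P\<close>
  is seen only through its truncation, which is again in \<open>P\<close>. Hence the
  finite-dimensional projection onto \<open>V\<close> already serves all of \<open>P\<close>, and
  the expectation respects levels.\<close>

lemma E_exists:
  assumes "g \<in> Gn n"
  shows "\<exists>\<xi>\<in>P. (\<forall>k. k \<notin> Gn n \<longrightarrow> \<xi> k = 0) \<and> (\<forall>y\<in>P. inner_l2 G y \<xi> = cnj (y g))"
proof -
  have g: "g \<in> carrier G" using assms Gn_carrier by blast
  define V where "V = {a \<in> P. \<forall>k. k \<notin> Gn n \<longrightarrow> a k = 0}"
  have "\<exists>\<xi>\<in>V. \<forall>y\<in>V. inner_l2 G y \<xi> = inner_l2 G y (delta g)"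
    by (rule finite_dim_projection[OF Gn_finite[of n] Gn_carrier])
      (auto simp: V_def P_zero P_add P_scale l2_delta[OF g])
  then obtain \<xi> where \<xi>: "\<xi> \<in> V" "\<And>y. y \<in> V \<Longrightarrow> inner_l2 G y \<xi> = inner_l2 G y (delta g)" by blast
  have "inner_l2 G y \<xi> = cnj (y g)" if "y \<in> P" for y
  proof -
    have cV: "chop (Gn n) y \<in> V" using P_trunc[OF that] by (auto simp: V_def chop_def)
    have "inner_l2 G y \<xi> = inner_l2 G (chop (Gn n) y) \<xi>"
      unfolding inner_l2_def using \<xi>(1) by (intro infsum_cong) (auto simp: V_def chop_def)
    also have "\<dots> = cnj (y g)" using \<xi>(2)[OF cV] assms by (simp add: inner_delta_right[OF g] chop_def)
    finally show ?thesis .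
  qed
  then show ?thesis using \<xi>(1) by (auto simp: V_def)
qed

lemma
  assumes "g \<in> carrier G"
  shows E_P: "E g \<in> P" and E_inner: "y \<in> P \<Longrightarrow> inner_l2 G y (E g) = cnj (y g)"
proof -
  obtain n where "g \<in> Gn n" using assms Gn_Union by blast
  from E_exists[OF this] have "\<exists>\<xi>. \<xi> \<in> P \<and> (\<forall>y\<in>P. inner_l2 G y \<xi> = cnj (y g))" by blast
  then have "E g \<in> P \<and> (\<forall>y\<in>P. inner_l2 G y (E g) = cnj (y g))" unfolding E_def by (rule someI_ex)
  then show "E g \<in> P" "y \<in> P \<Longrightarrow> inner_l2 G y (E g) = cnj (y g)" by auto
qed

lemma E_eqI:
  assumes "g \<in> carrier G" "\<xi> \<in> P" "\<And>y. y \<in> P \<Longrightarrow> inner_l2 G y \<xi> = cnj (y g)"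
  shows "E g = \<xi>"
  using assms E_P E_inner by (intro E_unique) auto

lemma E_support:
  assumes "g \<in> Gn n" "E g k \<noteq> 0"
  shows "k \<in> Gn n"
proof -
  obtain \<xi> where \<xi>: "\<xi> \<in> P" "\<forall>k. k \<notin> Gn n \<longrightarrow> \<xi> k = 0" "\<forall>y\<in>P. inner_l2 G y \<xi> = cnj (y g)"
    using E_exists[OF assms(1)] by blast
  have "E g = \<xi>" using assms(1) Gn_carrier \<xi> by (intro E_eqI) auto
  then show ?thesis using \<xi>(2) assms(2) by blast
qed

text \<open>The defining relation of \<open>E g\<close> tested on \<open>E g\<close> itself: the
  diagonal coefficient is the squared norm, as for any orthogonal projection.\<close>

lemma E_self:
  assumes "g \<in> carrier G"
  shows "E g g = complex_of_real (\<Sum>k | E g k \<noteq> 0. (cmod (E g k))\<^sup>2)"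
proof -
  have "cnj (E g g) = complex_of_real (\<Sum>k | E g k \<noteq> 0. (cmod (E g k))\<^sup>2)"
    using E_inner[OF assms E_P[OF assms]] P_inner_self[OF E_P[OF assms]] by simp
  then show ?thesis by (metis complex_cnj_complex_of_real complex_cnj_cnj)
qed

lemma E_self_nonzero:
  assumes "g \<in> carrier G" "E g k \<noteq> 0"
  shows "E g g \<noteq> 0"
proof -
  have "(\<Sum>k | E g k \<noteq> 0. (cmod (E g k))\<^sup>2) > 0"
    using P_finite_support(1)[OF E_P[OF assms(1)]] assms(2) by (intro sum_pos) auto
  then show ?thesis unfolding E_self[OF assms(1)] of_real_eq_0_iff by simp
qed

text \<open>Used mostly in contraposed form: if \<open>E g g\<close> vanishes, no element of
  \<open>P\<close> has \<open>g\<close> in its support.\<close>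

lemma E_nonzero:
  assumes "y \<in> P" "y g \<noteq> 0"
  shows "E g g \<noteq> 0"
proof -
  have g: "g \<in> carrier G" using P_support assms .
  have "inner_l2 G y (E g) \<noteq> 0" using E_inner[OF g assms(1)] assms(2) by simp
  then have "E g \<noteq> (\<lambda>_. 0)" by (auto simp: inner_l2_def)
  then show ?thesis using E_self_nonzero[OF g] by blast
qed

text \<open>By \<open>E_self\<close> the squared norm is 1, and the coefficient at \<open>g\<close>
  exhausts it.\<close>

lemma E_eq_delta:
  assumes g: "g \<in> carrier G" and "E g g = 1"
  shows "delta g \<in> P"
proof -
  let ?S = "{k. E g k \<noteq> 0}"
  have fin: "finite ?S" using P_finite_support(1)[OF E_P[OF g]] .
  have "complex_of_real (\<Sum>k\<in>?S. (cmod (E g k))\<^sup>2) = complex_of_real 1"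
    using E_self[OF g] assms(2) by (simp del: of_real_sum of_real_power)
  then have "(\<Sum>k\<in>?S. (cmod (E g k))\<^sup>2) = 1" by (simp only: of_real_eq_iff)
  moreover have "(\<Sum>k\<in>?S. (cmod (E g k))\<^sup>2) = (cmod (E g g))\<^sup>2 + (\<Sum>k\<in>?S - {g}. (cmod (E g k))\<^sup>2)"
    using fin assms(2) by (intro sum.remove) auto
  ultimately have "(\<Sum>k\<in>?S - {g}. (cmod (E g k))\<^sup>2) = 0" using assms(2) by simp
  then have "\<forall>k\<in>?S - {g}. E g k = 0" using fin by (subst (asm) sum_nonneg_eq_0_iff) auto
  then have "E g = delta g" using assms(2) by (auto simp: delta_def fun_eq_iff)
  then show ?thesis using E_P[OF g] by simp
qed

lemma E_dichotomy:
  assumes g: "g \<in> carrier G" and "\<And>k. E g k \<noteq> 0 \<Longrightarrow> k = g" and "E g g \<noteq> 0"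
  shows "delta g \<in> P"
proof (rule E_eq_delta[OF g])
  have "{k. E g k \<noteq> 0} = {g}" using assms by blast
  then have *: "E g g = complex_of_real ((cmod (E g g))\<^sup>2)" using E_self[OF g] by simp
  then have "cmod (E g g) = (cmod (E g g))\<^sup>2" by (metis abs_power2 norm_of_real)
  then have "cmod (E g g) = 1" using assms(3) by (simp add: power2_eq_square)
  then show "E g g = 1" using * by simp
qed

text \<open>\<open>P\<close> is stable under conjugation, so the conjugate of \<open>E g\<close>
  satisfies the relation that characterizes the expectation of the conjugate.\<close>

lemma E_conj:
  assumes g: "g \<in> carrier G" and h: "h \<in> carrier G" and k: "k \<in> carrier G"
  shows "E (h \<otimes> g \<otimes> inv h) k = E g (inv h \<otimes> k \<otimes> h)"
proof -
  let ?\<xi> = "\<lambda>k. if k \<in> carrier G then E g (inv h \<otimes> k \<otimes> h) else 0"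
  have bij: "bij_betw (\<lambda>k. inv h \<otimes> k \<otimes> h) (carrier G) (carrier G)"
    using h by (intro bij_betwI[where g="\<lambda>k. h \<otimes> k \<otimes> inv h"]) (auto simp: m_assoc, auto simp flip: m_assoc)
  have "E (h \<otimes> g \<otimes> inv h) = ?\<xi>"
  proof (rule E_eqI)
    show "?\<xi> \<in> P" by (rule P_conj[OF E_P[OF g] h])
    fix y assume y: "y \<in> P"
    let ?y = "\<lambda>k. if k \<in> carrier G then y (inv (inv h) \<otimes> k \<otimes> inv h) else 0"
    have yP: "?y \<in> P" by (rule P_conj[OF y inv_closed[OF h]])
    have "inner_l2 G y ?\<xi> = infsum (\<lambda>k. cnj (?y (inv h \<otimes> k \<otimes> h)) * E g (inv h \<otimes> k \<otimes> h)) (carrier G)"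
      unfolding inner_l2_def
    proof (rule infsum_cong)
      fix k assume k: "k \<in> carrier G"
      then have "h \<otimes> (inv h \<otimes> k \<otimes> h) \<otimes> inv h = k" using h by (simp add: m_assoc) (simp flip: m_assoc)
      then show "cnj (y k) * ?\<xi> k = cnj (?y (inv h \<otimes> k \<otimes> h)) * E g (inv h \<otimes> k \<otimes> h)" using h k by simp
    qed
    also have "\<dots> = inner_l2 G ?y (E g)"
      unfolding inner_l2_def by (rule infsum_reindex_bij_betw[OF bij, of "\<lambda>k. cnj (?y k) * E g k"])
    also have "\<dots> = cnj (y (h \<otimes> g \<otimes> inv h))" using E_inner[OF g yP] g h by simp
    finally show "inner_l2 G y ?\<xi> = cnj (y (h \<otimes> g \<otimes> inv h))" .
  qed (use g h in auto)
  then show ?thesis using k by simp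
qed

text \<open>The product of the adjoint of the unitary of \<open>f\<close> with \<open>y\<close>;
  hence the argument \<open>f \<otimes> k\<close> and not \<open>inv f \<otimes> k\<close>.\<close>

lemma P_left_mult:
  assumes y: "y \<in> P" and f: "f \<in> carrier G" "delta f \<in> P"
  shows "(\<lambda>k. if k \<in> carrier G then y (f \<otimes> k) else 0) \<in> P"
proof -
  have *: "{k. delta f k \<noteq> 0} = {f}" by (auto simp: delta_def)
  have "(\<lambda>h. if h \<in> carrier G then \<Sum>k | delta f k \<noteq> 0. cnj (delta f k) * y (k \<otimes> h) else 0)
      = (\<lambda>k. if k \<in> carrier G then y (f \<otimes> k) else 0)"
    unfolding * by (intro ext) (simp add: delta_def)
  then show ?thesis using P_star_mult[OF f(2) y] by (simp only:)
qed

definition N :: "'a set" where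
  "N = {g \<in> carrier G. delta g \<in> P}"

lemma N_normal: "N \<lhd> G"
proof -
  \<comment> \<open>\<open>P_left_mult\<close> produces this combination; \<open>b = \<one>\<close>
    then gives inverses, and replacing \<open>a\<close> by its inverse gives products.\<close>
  have dm: "inv a \<otimes> b \<in> N" if "a \<in> N" "b \<in> N" for a b
  proof -
    have ab: "a \<in> carrier G" "b \<in> carrier G" using that by (auto simp: N_def)
    have "(\<lambda>k. if k \<in> carrier G then delta b (a \<otimes> k) else 0) = delta (inv a \<otimes> b)"
    proof
      fix k
      have "a \<otimes> k = b \<longleftrightarrow> k = inv a \<otimes> b" if "k \<in> carrier G" using ab that inv_solve_left by metis
      then show "(if k \<in> carrier G then delta b (a \<otimes> k) else 0) = delta (inv a \<otimes> b) k"
        using ab by (auto simp: delta_def)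
    qed
    then show ?thesis using P_left_mult[of "delta b" a] that ab by (simp add: N_def)
  qed
  have one: "\<one> \<in> N" using P_one by (simp add: N_def)
  have i: "inv a \<in> N" if "a \<in> N" for a using dm[OF that one] that by (auto simp: N_def)
  have sub: "subgroup N G"
  proof (rule subgroupI)
    show "a \<otimes> b \<in> N" if "a \<in> N" "b \<in> N" for a b
      using dm[OF i[OF that(1)] that(2)] that by (simp add: N_def)
  qed (use one i in \<open>auto simp: N_def\<close>)
  show ?thesis
  proof (rule normal_invI[OF sub])
    fix x h assume x: "x \<in> carrier G" and "h \<in> N"
    then have h: "h \<in> carrier G" "delta h \<in> P" by (auto simp: N_def)
    have "(\<lambda>k. if k \<in> carrier G then delta h (inv x \<otimes> k \<otimes> x) else 0) = delta (x \<otimes> h \<otimes> inv x)"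
    proof
      fix k
      have "inv x \<otimes> k \<otimes> x = h \<longleftrightarrow> k = x \<otimes> h \<otimes> inv x" if k: "k \<in> carrier G"
      proof
        assume "inv x \<otimes> k \<otimes> x = h"
        then have "x \<otimes> h \<otimes> inv x = x \<otimes> (inv x \<otimes> k \<otimes> x) \<otimes> inv x" by simp
        also have "\<dots> = k" using x k by (simp add: m_assoc) (simp flip: m_assoc)
        finally show "k = x \<otimes> h \<otimes> inv x" ..
      qed (use x h k in \<open>simp add: m_assoc, simp flip: m_assoc\<close>)
      then show "(if k \<in> carrier G then delta h (inv x \<otimes> k \<otimes> x) else 0) = delta (x \<otimes> h \<otimes> inv x) k"
        using x h by (auto simp: delta_def)
    qed
    then show "x \<otimes> h \<otimes> inv x \<in> N" using P_conj[OF h(2) x] x h by (simp add: N_def)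
  qed
qed

lemma N_subgroup: "subgroup N G"
  using N_normal normal_imp_subgroup by blast

text \<open>Left modularity of a conditional expectation over elements of \<open>M\<close>, read off
  at the level of coefficients.\<close>

lemma E_left:
  assumes g: "g \<in> carrier G" and f: "f \<in> N" and k: "k \<in> carrier G"
  shows "E (f \<otimes> g) k = E g (inv f \<otimes> k)"
proof -
  have fc: "f \<in> carrier G" "delta f \<in> P" using f by (auto simp: N_def)
  have fi: "inv f \<in> carrier G" "delta (inv f) \<in> P"
    using subgroup.m_inv_closed[OF N_subgroup f] by (auto simp: N_def)
  let ?\<xi> = "\<lambda>k. if k \<in> carrier G then E g (inv f \<otimes> k) else 0"
  have bij: "bij_betw (\<lambda>k. inv f \<otimes> k) (carrier G) (carrier G)"
    using fc by (intro bij_betwI[where g="\<lambda>k. f \<otimes> k"]) (auto simp flip: m_assoc)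
  have "E (f \<otimes> g) = ?\<xi>"
  proof (rule E_eqI)
    show "?\<xi> \<in> P" by (rule P_left_mult[OF E_P[OF g] fi])
    fix y assume y: "y \<in> P"
    let ?y = "\<lambda>k. if k \<in> carrier G then y (f \<otimes> k) else 0"
    have yP: "?y \<in> P" by (rule P_left_mult[OF y fc])
    have "inner_l2 G y ?\<xi> = infsum (\<lambda>k. cnj (?y (inv f \<otimes> k)) * E g (inv f \<otimes> k)) (carrier G)"
      unfolding inner_l2_def using fc by (intro infsum_cong) (auto simp flip: m_assoc)
    also have "\<dots> = inner_l2 G ?y (E g)"
      unfolding inner_l2_def by (rule infsum_reindex_bij_betw[OF bij, of "\<lambda>k. cnj (?y k) * E g k"])
    also have "\<dots> = cnj (y (f \<otimes> g))" using E_inner[OF g yP] g by simp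
    finally show "inner_l2 G y ?\<xi> = cnj (y (f \<otimes> g))" .
  qed (use g fc in auto)
  then show ?thesis using k by simp
qed

text \<open>Writes g f as f times a conjugate of g, so that \<open>E_left\<close> and
  \<open>E_conj\<close> apply.\<close>

lemma E_right:
  assumes g: "g \<in> carrier G" and f: "f \<in> N" and k: "k \<in> carrier G"
  shows "E (g \<otimes> f) k = E g (k \<otimes> inv f)"
proof -
  have fc: "f \<in> carrier G" using f by (auto simp: N_def)
  have "g \<otimes> f = f \<otimes> (inv f \<otimes> g \<otimes> inv (inv f))" using g fc by (simp add: m_assoc) (simp flip: m_assoc)
  then have "E (g \<otimes> f) k = E (inv f \<otimes> g \<otimes> inv (inv f)) (inv f \<otimes> k)"
    using E_left[of "inv f \<otimes> g \<otimes> inv (inv f)" f k] g f fc k by simp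
  also have "\<dots> = E g (inv (inv f) \<otimes> (inv f \<otimes> k) \<otimes> inv f)"
    using E_conj[of g "inv f" "inv f \<otimes> k"] g fc k by simp
  also have "inv (inv f) \<otimes> (inv f \<otimes> k) \<otimes> inv f = k \<otimes> inv f" using fc k by (simp flip: m_assoc)
  finally show ?thesis .
qed

text \<open>Together with \<open>E_support\<close> this is an exclusion principle: an element
  commuting with \<open>g\<close> cannot conjugate a support point of \<open>E g\<close> out of the
  level of \<open>g\<close>.\<close>

lemma E_centralizer:
  assumes "g \<in> carrier G" "h \<in> carrier G" "k \<in> carrier G" "h \<otimes> g = g \<otimes> h"
  shows "E g (h \<otimes> k \<otimes> inv h) = E g k"
proof -
  have "h \<otimes> g \<otimes> inv h = g" using assms by (simp add: m_assoc)
  moreover have "inv h \<otimes> (h \<otimes> k \<otimes> inv h) \<otimes> h = k" using assms by (simp add: m_assoc) (simp flip: m_assoc)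
  ultimately show ?thesis using E_conj[of g h "h \<otimes> k \<otimes> inv h"] assms by simp
qed

end

section \<open>Invariant algebras and an abelian normal subgroup in general position\<close>

locale generic_invariant_vNa = invariant_vNa +
  fixes A :: "'a set"
  assumes A_normal: "A \<lhd> G"
    and A_comm: "f \<in> A \<Longrightarrow> f' \<in> A \<Longrightarrow> f \<otimes> f' = f' \<otimes> f"
    and A_square: "f \<in> A \<Longrightarrow> f \<otimes> f = \<one>"
    \<comment> \<open>Since \<open>f\<close> is its own inverse,
      \<open>f \<otimes> r \<otimes> f\<close> is a conjugate of \<open>r\<close>; only elements of
      \<open>A\<close> may stay at level \<open>n\<close> under it.\<close>
    and A_generic: "\<exists>f\<in>A. \<forall>r\<in>Gn n. f \<otimes> r \<otimes> f \<in> Gn n \<longrightarrow> r \<in> A"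
begin

lemma A_subgroup: "subgroup A G"
  using A_normal normal_imp_subgroup by blast

lemma A_carrier: "f \<in> A \<Longrightarrow> f \<in> carrier G"
  using subgroup.subset[OF A_subgroup] by blast

lemma A_conj: "x \<in> carrier G \<Longrightarrow> f \<in> A \<Longrightarrow> x \<otimes> f \<otimes> inv x \<in> A"
  using A_normal normal_inv_iff by blast

lemma A_conj': "x \<in> carrier G \<Longrightarrow> f \<in> A \<Longrightarrow> inv x \<otimes> f \<otimes> x \<in> A"
  using A_conj[of "inv x" f] by simp

lemma A_inv: "f \<in> A \<Longrightarrow> inv f = f"
  using A_square A_carrier inv_equality by blast

text \<open>For \<open>k0 \<notin> A\<close> in the support of \<open>a\<close>, the coefficient of \<open>a* f a f\<close> at \<open>inv k0 \<otimes> f \<otimes> k0 \<otimes> f\<close> is the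
  sum of \<open>\<bar>a k\<bar>\<^sup>2\<close> over the coset of \<open>k0\<close>.\<close>

lemma support_trivial:
  assumes zero: "\<And>f. f \<in> A \<Longrightarrow> f \<noteq> \<one> \<Longrightarrow> E f f = 0" and a: "a \<in> P" and k0: "a k0 \<noteq> 0"
  shows "k0 = \<one>"
proof -
  have coeff0: "y h = 0" if "y \<in> P" "h \<in> A" "h \<noteq> \<one>" for y h
    using E_nonzero[OF that(1), of h] zero[OF that(2,3)] by blast
  have "k0 \<in> A"
  proof (rule ccontr)
    assume k0A: "k0 \<notin> A"
    obtain n where n: "{k. a k \<noteq> 0} \<subseteq> Gn n"
      using Gn_exhausts_finite[OF P_finite_support[OF a]] .
    obtain f where f: "f \<in> A" "\<And>r. r \<in> Gn n \<Longrightarrow> f \<otimes> r \<otimes> f \<in> Gn n \<Longrightarrow> r \<in> A"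
      using A_generic[of n] by blast
    have k0n: "k0 \<in> Gn n" using n k0 by blast
    have c[simp]: "k0 \<in> carrier G" "f \<in> carrier G" using P_support[OF a k0] A_carrier[OF f(1)] by auto
    define b where "b = (\<lambda>k. if k \<in> carrier G then a (inv f \<otimes> k \<otimes> f) else 0)"
    have bP: "b \<in> P" unfolding b_def by (rule P_conj[OF a c(2)])
    define h where "h = inv k0 \<otimes> f \<otimes> k0 \<otimes> f"
    have hA: "h \<in> A" unfolding h_def using A_conj'[of k0 f] f(1) subgroup.m_closed[OF A_subgroup] by simp
    have hc[simp]: "h \<in> carrier G" using A_carrier[OF hA] .
    \<comment> \<open>Otherwise \<open>f\<close> would commute with \<open>k0\<close>, leaving
      \<open>k0\<close> at level \<open>n\<close>, which general position forbids outside
      \<open>A\<close>.\<close>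
    have h1: "h \<noteq> \<one>"
    proof
      assume "h = \<one>"
      then have "k0 \<otimes> h = k0" by simp
      moreover have "k0 \<otimes> h = f \<otimes> k0 \<otimes> f" unfolding h_def by (simp add: m_assoc) (simp flip: m_assoc)
      ultimately show False using f(2)[OF k0n] k0n k0A by simp
    qed
    define y where "y = (\<lambda>h. if h \<in> carrier G then \<Sum>k | a k \<noteq> 0. cnj (a k) * b (k \<otimes> h) else 0)"
    have "y \<in> P" unfolding y_def by (rule P_star_mult[OF a bP])
    then have "y h = 0" using coeff0 hA h1 by blast
    moreover have "y h = (\<Sum>k | a k \<noteq> 0. if k \<otimes> inv k0 \<in> A then complex_of_real ((cmod (a k))\<^sup>2) else 0)"
    proof -
      have "cnj (a k) * b (k \<otimes> h) = (if k \<otimes> inv k0 \<in> A then complex_of_real ((cmod (a k))\<^sup>2) else 0)"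
        if ak: "a k \<noteq> 0" for k
      proof -
        have k[simp]: "k \<in> carrier G" and kn: "k \<in> Gn n" using P_support[OF a ak] n ak by auto
        let ?r = "k \<otimes> inv k0"
        have rn: "?r \<in> Gn n" using kn k0n by (meson Gn_subgroup subgroup.m_closed subgroup.m_inv_closed)
        \<comment> \<open>The choice of \<open>h\<close> is made for this identity. If
          \<open>?r\<close> is in \<open>A\<close>, the right side is \<open>k\<close> and the term
          is a squared modulus; otherwise general position pushes it off level \<open>n\<close>,
          hence out of the support of \<open>a\<close>.\<close>
        have "inv f \<otimes> (k \<otimes> h) \<otimes> f = f \<otimes> ?r \<otimes> f \<otimes> k0"
          unfolding h_def A_inv[OF f(1)] using A_square[OF f(1)] by (simp add: m_assoc)
        then have bk: "b (k \<otimes> h) = a (f \<otimes> ?r \<otimes> f \<otimes> k0)" by (simp add: b_def)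
        show ?thesis
        proof (cases "?r \<in> A")
          case True
          then have "f \<otimes> ?r \<otimes> f = ?r"
            using A_comm[OF f(1) True] A_square[OF f(1)] by (simp add: m_assoc)
          then have "f \<otimes> ?r \<otimes> f \<otimes> k0 = k" by (simp add: m_assoc)
          then show ?thesis using True by (simp add: bk complex_norm_square mult.commute del: of_real_power)
        next
          case False
          have "a (f \<otimes> ?r \<otimes> f \<otimes> k0) = 0"
          proof (rule ccontr)
            assume "a (f \<otimes> ?r \<otimes> f \<otimes> k0) \<noteq> 0"
            then have "f \<otimes> ?r \<otimes> f \<otimes> k0 \<in> Gn n" using n by blast
            then have "f \<otimes> ?r \<otimes> f \<otimes> k0 \<otimes> inv k0 \<in> Gn n"
              using k0n by (meson Gn_subgroup subgroup.m_closed subgroup.m_inv_closed)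
            then have "f \<otimes> ?r \<otimes> f \<in> Gn n" by (simp add: m_assoc)
            then show False using f(2)[OF rn] False by blast
          qed
          then show ?thesis using False bk by simp
        qed
      qed
      then show ?thesis unfolding y_def by (simp del: of_real_power)
    qed
    ultimately have "complex_of_real (\<Sum>k | a k \<noteq> 0. if k \<otimes> inv k0 \<in> A then (cmod (a k))\<^sup>2 else 0) = 0"
      by (simp add: if_distrib cong: if_cong)
    then have "(\<Sum>k | a k \<noteq> 0. if k \<otimes> inv k0 \<in> A then (cmod (a k))\<^sup>2 else 0) = 0"
      using of_real_eq_0_iff by blast
    then have "\<forall>k\<in>{k. a k \<noteq> 0}. (if k \<otimes> inv k0 \<in> A then (cmod (a k))\<^sup>2 else 0) = 0"
      using P_finite_support(1)[OF a] by (subst (asm) sum_nonneg_eq_0_iff) auto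
    then show False using k0 subgroup.one_closed[OF A_subgroup] by force
  qed
  then show ?thesis using coeff0[OF a] k0 by blast
qed

text \<open>As g f = (g f g\<inverse>) g, evaluating the expectation of this element by both module
  properties shows that the support of \<open>E g\<close> is invariant under k \<mapsto> (g f
  g\<inverse>) k f\<inverse>. It stays at level \<open>n\<close>, so general position applies to
  \<open>inv g \<otimes> k\<close>.\<close>

lemma E_support_coset:
  assumes AN: "A \<subseteq> N" and g: "g \<in> carrier G" and k: "E g k \<noteq> 0"
  shows "k \<otimes> inv g \<in> A"
proof -
  obtain n where n: "g \<in> Gn n" using g Gn_Union by blast
  have kn: "k \<in> Gn n" using E_support[OF n k] .
  have kc[simp]: "k \<in> carrier G" using kn Gn_carrier by blast
  obtain f where f: "f \<in> A" "\<And>r. r \<in> Gn n \<Longrightarrow> f \<otimes> r \<otimes> f \<in> Gn n \<Longrightarrow> r \<in> A"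
    using A_generic[of n] by blast
  note [simp] = g A_carrier[OF f(1)]
  let ?f = "g \<otimes> f \<otimes> inv g"
  have fA: "?f \<in> A" using A_conj[OF g f(1)] .
  have "E g (?f \<otimes> k \<otimes> inv f) = E (g \<otimes> f) (?f \<otimes> k)"
    using E_right[of g f "?f \<otimes> k"] AN f(1) by auto
  also have "\<dots> = E (?f \<otimes> g) (?f \<otimes> k)" by (simp add: m_assoc)
  also have "\<dots> = E g (inv ?f \<otimes> (?f \<otimes> k))"
    using E_left[of g ?f "?f \<otimes> k"] AN fA by auto
  also have "\<dots> = E g k" using A_carrier[OF fA] kc m_assoc[of "inv ?f" ?f k] by (metis inv_closed l_inv l_one)
  finally have "E g (?f \<otimes> k \<otimes> inv f) \<noteq> 0" using k by simp
  then have "?f \<otimes> k \<otimes> f \<in> Gn n" using E_support[OF n] A_inv[OF f(1)] by simp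
  then have "inv g \<otimes> (?f \<otimes> k \<otimes> f) \<in> Gn n"
    using n by (meson Gn_subgroup subgroup.m_closed subgroup.m_inv_closed)
  moreover have "inv g \<otimes> (?f \<otimes> k \<otimes> f) = f \<otimes> (inv g \<otimes> k) \<otimes> f"
    by (simp add: m_assoc) (simp flip: m_assoc)
  moreover have "inv g \<otimes> k \<in> Gn n" using n kn by (meson Gn_subgroup subgroup.m_closed subgroup.m_inv_closed)
  ultimately have "inv g \<otimes> k \<in> A" using f(2) by simp
  then have "g \<otimes> (inv g \<otimes> k) \<otimes> inv g \<in> A" using A_conj[OF g] by blast
  then show ?thesis by (simp flip: m_assoc)
qed

text \<open>With \<open>p = E g\<close> and \<open>\<rho>\<close> the commutator, \<open>p* c p c\<inverse>\<close> is supported on \<open>(A \<inter> Gn n) \<rho>\<close>, which meets the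
  support of \<open>E \<rho>\<close> in \<open>\<rho>\<close> at most; pairing the two gives \<open>E \<rho> \<rho> = 1\<close>.\<close>

lemma commutator_in_N:
  assumes AN: "A \<subseteq> N" and g: "g \<in> Gn n" and Eg: "E g g \<noteq> 0" and c: "c \<in> carrier G"
    and comm: "\<And>f. f \<in> A \<Longrightarrow> f \<in> Gn n \<Longrightarrow> c \<otimes> f = f \<otimes> c"
    and indep: "\<And>f. f \<in> A \<Longrightarrow> f \<in> Gn n \<Longrightarrow> f \<noteq> \<one> \<Longrightarrow>
        E (inv g \<otimes> c \<otimes> g \<otimes> inv c) (f \<otimes> (inv g \<otimes> c \<otimes> g \<otimes> inv c)) = 0"
  shows "inv g \<otimes> c \<otimes> g \<otimes> inv c \<in> N"
proof -
  define \<rho> where "\<rho> = inv g \<otimes> c \<otimes> g \<otimes> inv c"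
  have gc[simp]: "g \<in> carrier G" "c \<in> carrier G" using g Gn_carrier c by auto
  have rc[simp]: "\<rho> \<in> carrier G" by (simp add: \<rho>_def)
  define p where "p = E g"
  have pP: "p \<in> P" unfolding p_def by (rule E_P) simp
  define b where "b = (\<lambda>k. if k \<in> carrier G then p (inv c \<otimes> k \<otimes> c) else 0)"
  have bP: "b \<in> P" unfolding b_def by (rule P_conj[OF pP c])
  define z where "z = (\<lambda>h. if h \<in> carrier G then \<Sum>k | p k \<noteq> 0. cnj (p k) * b (k \<otimes> h) else 0)"
  have zP: "z \<in> P" unfolding z_def by (rule P_star_mult[OF pP bP])
  have psupp: "\<exists>f\<in>A. f \<in> Gn n \<and> k = f \<otimes> g" if "p k \<noteq> 0" for k
  proof (intro bexI conjI)
    show "k \<otimes> inv g \<in> A" using E_support_coset[OF AN] that by (simp add: p_def)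
    have "k \<in> Gn n" using E_support[OF g] that by (simp add: p_def)
    then show "k \<otimes> inv g \<in> Gn n" using g by (meson Gn_subgroup subgroup.m_closed subgroup.m_inv_closed)
    show "k = k \<otimes> inv g \<otimes> g" using P_support[OF pP that] by (simp add: m_assoc)
  qed
  have commf: "inv c \<otimes> f \<otimes> c = f" if "f \<in> A" "f \<in> Gn n" for f
    using comm[OF that] A_carrier[OF that(1)] by (metis gc(2) inv_closed inv_solve_left m_assoc m_closed)
  have zrho: "z \<rho> = complex_of_real (\<Sum>k | p k \<noteq> 0. (cmod (p k))\<^sup>2)"
  proof -
    have "cnj (p k) * b (k \<otimes> \<rho>) = complex_of_real ((cmod (p k))\<^sup>2)" if pk: "p k \<noteq> 0" for k
    proof -
      obtain f where f: "f \<in> A" "f \<in> Gn n" "k = f \<otimes> g" using psupp[OF pk] by blast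
      have [simp]: "f \<in> carrier G" using A_carrier f by blast
      \<comment> \<open>Because \<open>c\<close> commutes with \<open>f\<close>, this is
        \<open>k\<close> itself, so every term of \<open>z \<rho>\<close> is a squared modulus and
        nothing cancels.\<close>
      have "inv c \<otimes> (k \<otimes> \<rho>) \<otimes> c = inv c \<otimes> f \<otimes> c \<otimes> g"
        unfolding f(3) \<rho>_def by (simp add: m_assoc) (simp flip: m_assoc)
      then have "inv c \<otimes> (k \<otimes> \<rho>) \<otimes> c = k" using commf[OF f(1,2)] f(3) by simp
      then show ?thesis using P_support[OF pP that]
        by (simp add: b_def complex_norm_square mult.commute del: of_real_power)
    qed
    then show ?thesis by (simp add: z_def del: of_real_power)
  qed
  \<comment> \<open>Both factors have support in a translate of the level \<open>n\<close> part of
    \<open>A\<close>. Moving \<open>c\<close> past \<open>f'\<close> and conjugating by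
    \<open>g\<close>, which has level \<open>n\<close>, gathers these contributions in front of
    \<open>\<rho>\<close>.\<close>
  have zsupp: "\<exists>f\<in>A. f \<in> Gn n \<and> h = f \<otimes> \<rho>" if zh: "z h \<noteq> 0" for h
  proof -
    have h[simp]: "h \<in> carrier G" using P_support[OF zP zh] .
    have "(\<Sum>k | p k \<noteq> 0. cnj (p k) * b (k \<otimes> h)) \<noteq> 0" using zh by (simp add: z_def)
    then obtain k where "k \<in> {k. p k \<noteq> 0}" "cnj (p k) * b (k \<otimes> h) \<noteq> 0"
      by (rule sum.not_neutral_contains_not_neutral)
    then have k: "p k \<noteq> 0" "b (k \<otimes> h) \<noteq> 0" by auto
    have kc[simp]: "k \<in> carrier G" using P_support[OF pP k(1)] .
    have "p (inv c \<otimes> (k \<otimes> h) \<otimes> c) \<noteq> 0" using k(2) by (simp add: b_def)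
    then obtain f' where f': "f' \<in> A" "f' \<in> Gn n" "inv c \<otimes> (k \<otimes> h) \<otimes> c = f' \<otimes> g" using psupp by blast
    obtain f where f: "f \<in> A" "f \<in> Gn n" "k = f \<otimes> g" using psupp[OF k(1)] by blast
    note [simp] = A_carrier[OF f(1)] A_carrier[OF f'(1)]
    let ?d = "inv g \<otimes> (inv f \<otimes> f') \<otimes> g"
    have "k \<otimes> h = c \<otimes> (f' \<otimes> g) \<otimes> inv c"
      unfolding f'(3)[symmetric] by (simp add: m_assoc) (simp flip: m_assoc)
    then have "h = inv k \<otimes> (c \<otimes> (f' \<otimes> g) \<otimes> inv c)" by (simp add: inv_solve_left)
    also have "\<dots> = inv g \<otimes> inv f \<otimes> (c \<otimes> f') \<otimes> g \<otimes> inv c"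
      unfolding f(3) by (simp add: inv_mult_group m_assoc)
    also have "\<dots> = ?d \<otimes> \<rho>"
      unfolding comm[OF f'(1,2)] \<rho>_def by (simp add: m_assoc) (simp flip: m_assoc)
    finally have "h = ?d \<otimes> \<rho>" .
    moreover have "inv f \<otimes> f' \<in> A" "inv f \<otimes> f' \<in> Gn n"
      using f f' by (meson A_subgroup Gn_subgroup subgroup.m_closed subgroup.m_inv_closed)+
    then have "?d \<in> A" "?d \<in> Gn n"
      using A_conj'[OF gc(1)] g by (blast, meson Gn_subgroup subgroup.m_closed subgroup.m_inv_closed)
    ultimately show ?thesis by blast
  qed
  have "z \<rho> \<noteq> 0"
  proof -
    have "(\<Sum>k | p k \<noteq> 0. (cmod (p k))\<^sup>2) > 0"
      using P_finite_support(1)[OF pP] Eg by (intro sum_pos) (auto simp: p_def)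
    then show ?thesis unfolding zrho of_real_eq_0_iff by simp
  qed
  \<comment> \<open>The relation defining \<open>E \<rho>\<close> is compared with the sum, in which
    \<open>indep\<close> leaves the term at \<open>\<rho>\<close> alone; the nonzero factor
    \<open>cnj (z \<rho>)\<close> then cancels.\<close>
  have "cnj (z \<rho>) = inner_l2 G z (E \<rho>)" using E_inner[OF rc zP] by simp
  also have "\<dots> = (\<Sum>k | z k \<noteq> 0. cnj (z k) * E \<rho> k)" by (rule P_inner[OF zP P_l2[OF E_P[OF rc]]])
  also have "\<dots> = (\<Sum>k\<in>{\<rho>}. cnj (z k) * E \<rho> k)"
  proof (rule sum.mono_neutral_right[OF P_finite_support(1)[OF zP]])
    show "{\<rho>} \<subseteq> {k. z k \<noteq> 0}" using \<open>z \<rho> \<noteq> 0\<close> by blast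
    show "\<forall>k\<in>{k. z k \<noteq> 0} - {\<rho>}. cnj (z k) * E \<rho> k = 0"
    proof
      fix k assume k: "k \<in> {k. z k \<noteq> 0} - {\<rho>}"
      then obtain f where f: "f \<in> A" "f \<in> Gn n" "k = f \<otimes> \<rho>" using zsupp by blast
      then have "f \<noteq> \<one>" using k by auto
      then show "cnj (z k) * E \<rho> k = 0" using indep[OF f(1,2)] f(3) by (simp add: \<rho>_def)
    qed
  qed
  finally have "E \<rho> \<rho> = 1" using \<open>z \<rho> \<noteq> 0\<close> by simp
  then show ?thesis using E_eq_delta[OF rc] by (simp add: N_def \<rho>_def)
qed

end

subsection \<open>Coordinates on the Cantor space\<close>

definition eqon :: "nat set \<Rightarrow> cantor \<Rightarrow> cantor \<Rightarrow> bool" where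
  "eqon J x y \<longleftrightarrow> (\<forall>k\<in>J. x k = y k)"

definition meas :: "nat set \<Rightarrow> cantor set \<Rightarrow> bool" where
  "meas J A \<longleftrightarrow> (\<forall>x y. eqon J x y \<longrightarrow> (x \<in> A \<longleftrightarrow> y \<in> A))"

text \<open>\<open>J\<close> is an arbitrary set of coordinates, since a permutation of coordinates
  carries initial segments to other sets. The map changes only the coordinates in \<open>J\<close>
  and reads only these to do so.\<close>

definition loc :: "nat set \<Rightarrow> (cantor \<Rightarrow> cantor) \<Rightarrow> bool" where
  "loc J \<sigma> \<longleftrightarrow> bij \<sigma> \<and> (\<forall>x. \<forall>k. k \<notin> J \<longrightarrow> \<sigma> x k = x k) \<and> (\<forall>x y. eqon J x y \<longrightarrow> eqon J (\<sigma> x) (\<sigma> y))"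

definition symdiff :: "'a set \<Rightarrow> 'a set \<Rightarrow> 'a set" where
  "symdiff A B = (A - B) \<union> (B - A)"

lemma eqon_refl: "eqon J x x" by (simp add: eqon_def)
lemma eqon_sym: "eqon J x y \<Longrightarrow> eqon J y x" by (simp add: eqon_def)
lemma eqon_trans: "eqon J x y \<Longrightarrow> eqon J y z \<Longrightarrow> eqon J x z" by (simp add: eqon_def)
lemma eqon_mono: "J \<subseteq> J' \<Longrightarrow> eqon J' x y \<Longrightarrow> eqon J x y" by (auto simp: eqon_def)

lemma measD: "meas J A \<Longrightarrow> eqon J x y \<Longrightarrow> x \<in> A \<longleftrightarrow> y \<in> A"
  by (simp add: meas_def)

lemma meas_mono: "meas J A \<Longrightarrow> J \<subseteq> J' \<Longrightarrow> meas J' A"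
  unfolding meas_def using eqon_mono by blast

lemma meas_Compl: "meas J (- A) \<longleftrightarrow> meas J A"
  by (auto simp: meas_def)

lemma meas_symdiff: "meas J A \<Longrightarrow> meas J B \<Longrightarrow> meas J (symdiff A B)"
  unfolding meas_def symdiff_def by blast

lemma meas_empty: "meas J {}"
  by (simp add: meas_def)

lemma locD:
  assumes "loc J \<sigma>"
  shows "bij \<sigma>" "k \<notin> J \<Longrightarrow> \<sigma> x k = x k" "eqon J x y \<Longrightarrow> eqon J (\<sigma> x) (\<sigma> y)"
  using assms by (auto simp: loc_def)

lemma locI:
  assumes "bij \<sigma>" "\<And>x k. k \<notin> J \<Longrightarrow> \<sigma> x k = x k" "\<And>x y. eqon J x y \<Longrightarrow> eqon J (\<sigma> x) (\<sigma> y)"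
  shows "loc J \<sigma>"
  using assms by (auto simp: loc_def)

lemma loc_id: "loc J id"
  by (simp add: loc_def)

lemma loc_comp: "loc J \<sigma> \<Longrightarrow> loc J \<tau> \<Longrightarrow> loc J (\<sigma> \<circ> \<tau>)"
  by (auto simp: loc_def bij_comp)

lemma loc_mono:
  assumes "loc J \<sigma>" "J \<subseteq> J'"
  shows "loc J' \<sigma>"
proof (rule locI)
  fix x y assume xy: "eqon J' x y"
  then have "eqon J (\<sigma> x) (\<sigma> y)" using locD(3)[OF assms(1)] eqon_mono[OF assms(2)] by blast
  show "eqon J' (\<sigma> x) (\<sigma> y)"
    unfolding eqon_def
  proof
    fix k assume "k \<in> J'"
    then show "\<sigma> x k = \<sigma> y k"
      using xy \<open>eqon J (\<sigma> x) (\<sigma> y)\<close> locD(2)[OF assms(1), of k] by (cases "k \<in> J") (auto simp: eqon_def)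
  qed
qed (use assms(2) locD(1,2)[OF assms(1)] in blast)+

text \<open>Glue the preimage of \<open>x\<close> on \<open>J\<close> to the preimage of
  \<open>y\<close> off \<open>J\<close>. The glued point \<open>z\<close> is mapped to
  \<open>y\<close>, so it is the preimage of \<open>y\<close>, and it agrees on \<open>J\<close>
  with that of \<open>x\<close>.\<close>

lemma loc_inv:
  assumes s: "loc J \<sigma>"
  shows "loc J (inv_into UNIV \<sigma>)"
proof (rule locI)
  have b: "bij \<sigma>" using locD(1)[OF s] .
  let ?i = "inv_into UNIV \<sigma>"
  have i: "\<sigma> (?i x) = x" for x using b by (simp add: bij_is_surj surj_f_inv_f)
  show "bij ?i" using b by (rule bij_imp_bij_inv)
  show "?i x k = x k" if "k \<notin> J" for x k using locD(2)[OF s that, of "?i x"] i by simp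
  fix x y assume xy: "eqon J x y"
  define z where "z = (\<lambda>k. if k \<in> J then ?i x k else ?i y k)"
  have "\<sigma> z = \<sigma> (?i y)"
  proof
    fix k
    have "eqon J z (?i x)" by (simp add: eqon_def z_def)
    then have *: "eqon J (\<sigma> z) x" using locD(3)[OF s] i by metis
    show "\<sigma> z k = \<sigma> (?i y) k"
    proof (cases "k \<in> J")
      case True then show ?thesis using * xy i by (simp add: eqon_def)
    next
      case False then show ?thesis using locD(2)[OF s False] by (simp add: z_def)
    qed
  qed
  then have zy: "z = ?i y" using b by (simp add: bij_is_inj inj_eq)
  have "eqon J (?i x) z" by (simp add: eqon_def z_def)
  then show "eqon J (?i x) (?i y)" by (simp only: zy)
qed

lemma mem_image_bij:
  assumes "bij f"
  shows "x \<in> f ` A \<longleftrightarrow> inv_into UNIV f x \<in> A"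
proof
  show "inv_into UNIV f x \<in> A" if "x \<in> f ` A" using that assms by (auto simp: bij_is_inj)
  assume *: "inv_into UNIV f x \<in> A"
  have "x = f (inv_into UNIV f x)" using assms by (simp add: bij_is_surj surj_f_inv_f)
  then show "x \<in> f ` A" using * by (rule image_eqI)
qed

lemma meas_image:
  assumes A: "meas J A" and s: "loc J \<sigma>"
  shows "meas J (\<sigma> ` A)"
proof -
  show ?thesis
    unfolding meas_def mem_image_bij[OF locD(1)[OF s]] using A locD(3)[OF loc_inv[OF s]] measD by blast
qed

text \<open>Pass from \<open>x\<close> to \<open>y\<close> through a point that agrees with
  \<open>x\<close> on \<open>J\<close> and with \<open>y\<close> on \<open>J'\<close>; the two
  prescriptions are compatible on the overlap. The same point serves \<open>loc_Int\<close>.\<close>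

lemma meas_Int:
  assumes "meas J A" "meas J' A"
  shows "meas (J \<inter> J') A"
  unfolding meas_def
proof (intro allI impI)
  fix x y assume xy: "eqon (J \<inter> J') x y"
  define z where "z = (\<lambda>k. if k \<in> J then x k else y k)"
  have "eqon J x z" "eqon J' z y" using xy by (auto simp: eqon_def z_def)
  then show "x \<in> A \<longleftrightarrow> y \<in> A" using assms measD by blast
qed

lemma loc_Int:
  assumes "loc J \<sigma>" "loc J' \<sigma>"
  shows "loc (J \<inter> J') \<sigma>"
proof (rule locI)
  show "\<sigma> x k = x k" if "k \<notin> J \<inter> J'" for x k using that locD(2)[OF assms(1)] locD(2)[OF assms(2)] by blast
  fix x y assume xy: "eqon (J \<inter> J') x y"
  define z where "z = (\<lambda>k. if k \<in> J then x k else y k)"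
  have "eqon J x z" "eqon J' z y" using xy by (auto simp: eqon_def z_def)
  then have "eqon J (\<sigma> x) (\<sigma> z)" "eqon J' (\<sigma> z) (\<sigma> y)" using assms locD(3) by blast+
  then show "eqon (J \<inter> J') (\<sigma> x) (\<sigma> y)" by (simp add: eqon_def)
qed (use locD(1)[OF assms(1)] in blast)

lemma loc_empty: "loc {} \<sigma> \<Longrightarrow> \<sigma> = id"
  by (intro ext) (use locD(2) in auto)

lemma meas_empty_coords: "meas {} A \<Longrightarrow> A = {} \<or> A = UNIV"
  by (auto simp: meas_def eqon_def)

section \<open>Coordinate description of \<open>S2inf\<close> and of clopen sets\<close>

lemma finite_cube: "finite (cube n)"
proof -
  have "cube n \<subseteq> (\<lambda>S k. k \<in> S) ` Pow {..<n}"
  proof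
    fix v assume "v \<in> cube n"
    then have "v = (\<lambda>k. k \<in> {k. v k})" "{k. v k} \<in> Pow {..<n}"
      by (auto simp: cube_def not_le[symmetric])
    then show "v \<in> (\<lambda>S k. k \<in> S) ` Pow {..<n}" by (rule image_eqI)
  qed
  then show ?thesis by (rule finite_subset) auto
qed

lemma trunc_in_cube: "trunc n x \<in> cube n"
  by (simp add: trunc_def cube_def)

lemma eqon_trunc: "eqon {..<n} (trunc n x) x"
  by (simp add: eqon_def trunc_def)

lemma trunc_cong: "eqon {..<n} x y \<Longrightarrow> trunc n x = trunc n y"
  by (auto simp: eqon_def trunc_def)

lemma trunc_cube: "v \<in> cube n \<Longrightarrow> trunc n v = v"
  by (auto simp: trunc_def cube_def fun_eq_iff not_le[symmetric])

lemma cube_eqI: "v \<in> cube n \<Longrightarrow> w \<in> cube n \<Longrightarrow> eqon {..<n} v w \<Longrightarrow> v = w"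
  using trunc_cong trunc_cube by metis

lemma lift_perm_comp:
  assumes "p permutes cube n"
  shows "lift_perm n q (lift_perm n p x) = lift_perm n (q \<circ> p) x"
proof -
  have "p (trunc n x) \<in> cube n" using assms trunc_in_cube by (simp add: permutes_in_image)
  then have "trunc n (lift_perm n p x) = p (trunc n x)"
    by (auto simp: lift_perm_def trunc_def[of n "\<lambda>k. _ k"] trunc_cube cube_def fun_eq_iff trunc_def not_less)
  then have *: "q (trunc n (lift_perm n p x)) = (q \<circ> p) (trunc n x)" by simp
  show ?thesis unfolding lift_perm_def[of n q] lift_perm_def[of n "q \<circ> p"] *
    by (rule ext) (simp add: lift_perm_def)
qed

lemma lift_perm_id: "lift_perm n id = id"
  by (auto simp: lift_perm_def trunc_def fun_eq_iff)

lemma lift_perm_loc: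
  assumes "s permutes cube n"
  shows "loc {..<n} (lift_perm n s)"
proof (rule locI)
  have "lift_perm n s (lift_perm n (inv_into UNIV s) x) = x" "lift_perm n (inv_into UNIV s) (lift_perm n s x) = x" for x
    using assms lift_perm_id[of n] by (simp_all add: lift_perm_comp permutes_inv permutes_inv_o)
  then show "bij (lift_perm n s)" by (intro o_bij[of "lift_perm n (inv_into UNIV s)"]) (auto simp: fun_eq_iff)
  show "lift_perm n s x k = x k" if "k \<notin> {..<n}" for x k using that by (simp add: lift_perm_def)
  show "eqon {..<n} (lift_perm n s x) (lift_perm n s y)" if "eqon {..<n} x y" for x y
    using trunc_cong[OF that] by (simp add: eqon_def lift_perm_def)
qed

text \<open>\<open>cube n\<close> is preserved because coordinates from \<open>n\<close> on are
  untouched; on this finite set injectivity gives a permutation, which determines \<sigma> since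
  only the truncation matters.\<close>

lemma loc_lift_perm:
  assumes s: "loc {..<n} \<sigma>"
  obtains p where "p permutes cube n" "\<sigma> = lift_perm n p"
proof -
  define p where "p = (\<lambda>v. if v \<in> cube n then \<sigma> v else v)"
  have into: "\<sigma> v \<in> cube n" if "v \<in> cube n" for v
    using that locD(2)[OF s] by (auto simp: cube_def)
  have "inj_on \<sigma> (cube n)" using locD(1)[OF s] by (meson bij_is_inj inj_on_subset subset_UNIV)
  then have "bij_betw \<sigma> (cube n) (cube n)"
    unfolding bij_betw_def using into endo_inj_surj[OF finite_cube, of \<sigma> n] by blast
  then have "bij_betw p (cube n) (cube n)" by (subst bij_betw_cong[of _ p \<sigma>]) (auto simp: p_def)
  then have "p permutes cube n" by (rule bij_imp_permutes) (simp add: p_def)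
  moreover have "\<sigma> x k = lift_perm n p x k" for x k
  proof (cases "k < n")
    case True
    have "eqon {..<n} (\<sigma> x) (\<sigma> (trunc n x))" using locD(3)[OF s] eqon_sym eqon_trunc by blast
    then show ?thesis using True by (simp add: lift_perm_def p_def trunc_in_cube eqon_def)
  next
    case False
    then show ?thesis using locD(2)[OF s, of k x] by (simp add: lift_perm_def)
  qed
  then have "\<sigma> = lift_perm n p" by blast
  ultimately show ?thesis using that by blast
qed

lemma S2inf_iff: "\<sigma> \<in> S2inf \<longleftrightarrow> (\<exists>n. loc {..<n} \<sigma>)"
proof
  assume "\<exists>n. loc {..<n} \<sigma>"
  then obtain n where "loc {..<n} \<sigma>" by blast
  from loc_lift_perm[OF this] obtain p where "p permutes cube n" "\<sigma> = lift_perm n p" .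
  then show "\<sigma> \<in> S2inf" unfolding S2inf_def by auto
next
  assume "\<sigma> \<in> S2inf"
  then obtain n s where "s permutes cube n" "\<sigma> = lift_perm n s" by (auto simp: S2inf_def)
  then show "\<exists>n. loc {..<n} \<sigma>" using lift_perm_loc by blast
qed

lemma loc_S2inf: "loc {..<n} \<sigma> \<Longrightarrow> \<sigma> \<in> S2inf"
  using S2inf_iff by blast

lemma S2inf_bij: "\<sigma> \<in> S2inf \<Longrightarrow> bij \<sigma>"
  using S2inf_iff locD(1) by blast

lemma S2inf_id: "id \<in> S2inf"
  using loc_S2inf[OF loc_id[of "{..<0}"]] .

lemma S2inf_comp:
  assumes "\<sigma> \<in> S2inf" "\<tau> \<in> S2inf"
  shows "\<sigma> \<circ> \<tau> \<in> S2inf"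
proof -
  obtain n m where "loc {..<n} \<sigma>" "loc {..<m} \<tau>" using assms S2inf_iff by blast
  then have "loc {..<max n m} \<sigma>" "loc {..<max n m} \<tau>" by (auto elim!: loc_mono)
  then show ?thesis using loc_comp loc_S2inf by blast
qed

lemma S2inf_inv: "\<sigma> \<in> S2inf \<Longrightarrow> inv_into UNIV \<sigma> \<in> S2inf"
  using S2inf_iff loc_inv by blast

lemma finite_loc: "finite {\<sigma>. loc {..<n} \<sigma>}"
proof -
  have "{\<sigma>. loc {..<n} \<sigma>} \<subseteq> lift_perm n ` {p. p permutes cube n}"
  proof
    fix \<sigma> assume "\<sigma> \<in> {\<sigma>. loc {..<n} \<sigma>}"
    then obtain p where "p permutes cube n" "\<sigma> = lift_perm n p" using loc_lift_perm[of n \<sigma>] by auto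
    then show "\<sigma> \<in> lift_perm n ` {p. p permutes cube n}" by blast
  qed
  then show ?thesis by (rule finite_subset) (intro finite_imageI finite_permutations finite_cube)
qed

lemma finite_meas: "finite {A. meas {..<n} A}"
proof -
  have "{A. meas {..<n} A} \<subseteq> (\<lambda>Q. {x. trunc n x \<in> Q}) ` Pow (cube n)"
  proof
    fix A assume "A \<in> {A. meas {..<n} A}"
    then have "A = {x. trunc n x \<in> A \<inter> cube n}"
      using measD[OF _ eqon_trunc] trunc_in_cube by blast
    then show "A \<in> (\<lambda>Q. {x. trunc n x \<in> Q}) ` Pow (cube n)" by (intro image_eqI[of _ _ "A \<inter> cube n"]) auto
  qed
  then show ?thesis by (rule finite_subset) (auto intro: finite_cube)
qed

definition cyl :: "nat \<Rightarrow> cantor \<Rightarrow> cantor set" where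
  "cyl n x = {y. eqon {..<n} y x}"

lemma open_cyl: "open (cyl n x)"
proof -
  have "cyl n x = {f. \<forall>k\<in>{..<n}. f k \<in> {x k}}" by (auto simp: cyl_def eqon_def)
  moreover have "open {f. \<forall>k\<in>{..<n}. f (id k) \<in> {x k}}"
    by (rule product_topology_basis') (auto intro: open_discrete)
  ultimately show ?thesis by simp
qed

lemma cyl_self: "x \<in> cyl n x"
  by (simp add: cyl_def eqon_refl)

lemma open_contains_cyl:
  assumes "open U" "x \<in> U"
  shows "\<exists>n. cyl n x \<subseteq> U"
proof -
  have "openin (product_topology (\<lambda>_. euclidean) UNIV) U"
    using assms(1) by (simp add: open_fun_def)
  from product_topology_open_contains_basis[OF this assms(2)]
  obtain V :: "nat \<Rightarrow> bool set" where VU: "x \<in> Pi\<^sub>E UNIV V" "\<forall>i. openin euclidean (V i)" "finite {i. V i \<noteq> topspace euclidean}"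
     "Pi\<^sub>E UNIV V \<subseteq> U"
    by (elim exE conjE)
  obtain n where n: "\<And>i. V i \<noteq> UNIV \<Longrightarrow> i < n"
    using VU(3) unfolding finite_nat_set_iff_bounded topspace_euclidean by blast
  have "cyl n x \<subseteq> Pi\<^sub>E UNIV V"
  proof
    fix y assume y: "y \<in> cyl n x"
    have "y i \<in> V i" for i
    proof (cases "V i = UNIV")
      case False
      then have "y i = x i" using n y by (auto simp: cyl_def eqon_def)
      then show ?thesis using PiE_mem[OF VU(1), of i] by simp
    qed simp
    then show "y \<in> Pi\<^sub>E UNIV V" by (simp add: PiE_iff)
  qed
  then show ?thesis using VU(4) by blast
qed

lemma compact_cantor: "compact (UNIV :: cantor set)"
proof -
  have "compactin (product_topology (\<lambda>_. euclidean) UNIV) (PiE UNIV (\<lambda>_::nat. UNIV :: bool set))"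
    by (subst compactin_PiE) (auto intro: finite_imp_compact)
  then show ?thesis by (simp add: euclidean_product_topology PiE_UNIV_domain)
qed

text \<open>For a clopen set, compactness provides finitely many cylinders on each of which
  membership is constant; the maximal depth among them works.\<close>

lemma clopen_iff: "clopen A \<longleftrightarrow> (\<exists>n. meas {..<n} A)"
proof
  assume "\<exists>n. meas {..<n} A"
  then obtain n where n: "meas {..<n} A" by blast
  have op: "open B" if "meas {..<n} B" for B
  proof -
    have "B = (\<Union>x\<in>B. cyl n x)" using that by (auto simp: cyl_def eqon_refl meas_def)
    then show ?thesis using open_cyl by (metis open_UN)
  qed
  show "clopen A" unfolding clopen_def using op[OF n] op[of "- A"] n by (simp add: meas_Compl closed_def)
next
  assume "clopen A"
  then have op: "open A" "open (- A)" by (auto simp: clopen_def)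
  have "\<forall>x. \<exists>n. cyl n x \<subseteq> A \<or> cyl n x \<subseteq> - A"
  proof
    fix x show "\<exists>n. cyl n x \<subseteq> A \<or> cyl n x \<subseteq> - A"
      using open_contains_cyl[OF op(1), of x] open_contains_cyl[OF op(2), of x] by (cases "x \<in> A") blast+
  qed
  from choice[OF this] obtain d where d: "\<forall>x. cyl (d x) x \<subseteq> A \<or> cyl (d x) x \<subseteq> - A" ..
  have "UNIV \<subseteq> (\<Union>x\<in>UNIV. cyl (d x) x)" using cyl_self by blast
  from compactE_image[OF compact_cantor open_cyl this]
  obtain F where F: "finite F" "UNIV \<subseteq> (\<Union>x\<in>F. cyl (d x) x)" by metis
  define n where "n = Max (d ` F)"
  have "x \<in> A \<longleftrightarrow> y \<in> A" if "eqon {..<n} x y" for x y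
  proof -
    obtain z where z: "z \<in> F" "x \<in> cyl (d z) z" using F by blast
    have "d z \<le> n" using z F by (simp add: n_def)
    then have "eqon {..<d z} x y" using that by (auto simp: eqon_def)
    then have "y \<in> cyl (d z) z" using z(2) by (auto simp: cyl_def eqon_def)
    then show ?thesis using spec[OF d, of z] z(2) by blast
  qed
  then show "\<exists>n. meas {..<n} A" by (auto simp: meas_def)
qed

subsection \<open>The group\<close>

text \<open>The element \<open>f\<^sub>A \<sigma>\<close> of the semidirect product, for the class of \<open>f\<^sub>A\<close>.\<close>

definition gel :: "cantor set \<Rightarrow> (cantor \<Rightarrow> cantor) \<Rightarrow> cantor set set \<times> (cantor \<Rightarrow> cantor)" where
  "gel A \<sigma> = ({A, - A}, \<sigma>)"

lemma gel_eq_iff: "gel A \<sigma> = gel B \<tau> \<longleftrightarrow> \<sigma> = \<tau> \<and> (A = B \<or> A = - B)"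
  by (auto simp: gel_def doubleton_eq_iff)

lemma carrier_Gsd: "carrier Gsd = {gel A \<sigma> | A \<sigma>. clopen A \<and> \<sigma> \<in> S2inf}"
  by (auto simp: Gsd_def Ctil_def gel_def)

lemma gel_carrier: "clopen A \<Longrightarrow> \<sigma> \<in> S2inf \<Longrightarrow> gel A \<sigma> \<in> carrier Gsd"
  by (auto simp: carrier_Gsd)

lemma symdiff_Compl: "symdiff A (- C) = - symdiff A C" "symdiff (- A) C = - symdiff A C"
  by (auto simp: symdiff_def)

lemma cmult_classes: "cmult {A, - A} {C, - C} = {symdiff A C, - symdiff A C}"
proof -
  have *: "Z \<in> cmult {A, - A} {C, - C} \<longleftrightarrow> Z = symdiff A C \<or> Z = - symdiff A C" for Z
  proof -
    have "Z \<in> cmult {A, - A} {C, - C} \<longleftrightarrow> (\<exists>U V. Z = symdiff U V \<and> (U = A \<or> U = - A) \<and> (V = C \<or> V = - C))"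
      by (simp add: cmult_def symdiff_def)
    also have "\<dots> \<longleftrightarrow> Z = symdiff A C \<or> Z = symdiff A (- C) \<or> Z = symdiff (- A) C \<or> Z = symdiff (- A) (- C)"
      by metis
    also have "\<dots> \<longleftrightarrow> Z = symdiff A C \<or> Z = - symdiff A C" by (simp add: symdiff_Compl) blast
    finally show ?thesis .
  qed
  show ?thesis by (rule Set.set_eqI) (simp add: *)
qed

text \<open>A bijection commutes with complements, so the action is compatible with identifying a
  set with its complement.\<close>

lemma gel_mult:
  assumes "bij \<sigma>"
  shows "gel A \<sigma> \<otimes>\<^bsub>Gsd\<^esub> gel B \<tau> = gel (symdiff A (\<sigma> ` B)) (\<sigma> \<circ> \<tau>)"
proof -
  have c: "\<sigma> ` (- B) = - (\<sigma> ` B)" using assms by (rule bij_image_Compl_eq)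
  note cmult_classes[of A "\<sigma> ` B"]
  moreover have "cact \<sigma> {B, - B} = {\<sigma> ` B, - \<sigma> ` B}" by (simp add: cact_def c)
  ultimately show ?thesis by (simp add: Gsd_def gel_def)
qed

lemma gel_one: "\<one>\<^bsub>Gsd\<^esub> = gel {} id"
  by (simp add: Gsd_def gel_def)

lemma symdiff_assoc: "symdiff (symdiff A B) C = symdiff A (symdiff B C)"
  by (auto simp: symdiff_def)

lemma symdiff_commute: "symdiff A B = symdiff B A"
  by (auto simp: symdiff_def)

lemma symdiff_simps [simp]: "symdiff A A = {}" "symdiff {} A = A" "symdiff A {} = A"
  by (auto simp: symdiff_def)

lemma image_symdiff:
  assumes "bij \<sigma>"
  shows "\<sigma> ` symdiff A B = symdiff (\<sigma> ` A) (\<sigma> ` B)"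
  using assms by (simp add: symdiff_def image_Un image_set_diff bij_is_inj)

lemma clopen_symdiff:
  assumes "clopen A" "clopen B"
  shows "clopen (symdiff A B)"
proof -
  obtain n m where "meas {..<n} A" "meas {..<m} B" using assms clopen_iff by blast
  then have "meas {..<max n m} A" "meas {..<max n m} B" by (auto elim!: meas_mono)
  then show ?thesis using meas_symdiff clopen_iff by blast
qed

lemma clopen_image:
  assumes "clopen A" "\<sigma> \<in> S2inf"
  shows "clopen (\<sigma> ` A)"
proof -
  obtain n m where "meas {..<n} A" "loc {..<m} \<sigma>" using assms clopen_iff S2inf_iff by blast
  then have "meas {..<max n m} A" "loc {..<max n m} \<sigma>" by (auto elim!: meas_mono loc_mono)
  then show ?thesis using meas_image clopen_iff by blast
qed

lemma clopen_empty: "clopen {}"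
  by (simp add: clopen_def)

lemma Gsd_cases:
  assumes "g \<in> carrier Gsd"
  obtains A \<sigma> where "g = gel A \<sigma>" "clopen A" "\<sigma> \<in> S2inf"
  using assms unfolding carrier_Gsd by blast

lemma group_Gsd: "group Gsd"
proof (rule groupI)
  fix x y assume "x \<in> carrier Gsd" "y \<in> carrier Gsd"
  then obtain A \<sigma> B \<tau> where "x = gel A \<sigma>" "clopen A" "\<sigma> \<in> S2inf" "y = gel B \<tau>" "clopen B" "\<tau> \<in> S2inf"
    by (metis Gsd_cases)
  then show "x \<otimes>\<^bsub>Gsd\<^esub> y \<in> carrier Gsd"
    by (simp add: gel_mult S2inf_bij gel_carrier clopen_symdiff clopen_image S2inf_comp)
next
  show "\<one>\<^bsub>Gsd\<^esub> \<in> carrier Gsd" unfolding gel_one by (intro gel_carrier clopen_empty S2inf_id)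
next
  fix x y z assume "x \<in> carrier Gsd" "y \<in> carrier Gsd" "z \<in> carrier Gsd"
  then obtain A \<sigma> B \<tau> C \<rho> where "x = gel A \<sigma>" "\<sigma> \<in> S2inf" "y = gel B \<tau>" "\<tau> \<in> S2inf" "z = gel C \<rho>"
    by (metis Gsd_cases)
  then show "x \<otimes>\<^bsub>Gsd\<^esub> y \<otimes>\<^bsub>Gsd\<^esub> z = x \<otimes>\<^bsub>Gsd\<^esub> (y \<otimes>\<^bsub>Gsd\<^esub> z)"
    by (simp add: gel_mult S2inf_bij bij_comp image_symdiff symdiff_assoc image_comp comp_assoc)
next
  fix x assume "x \<in> carrier Gsd"
  then obtain A \<sigma> where x: "x = gel A \<sigma>" "clopen A" "\<sigma> \<in> S2inf" by (rule Gsd_cases)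
  then show "\<one>\<^bsub>Gsd\<^esub> \<otimes>\<^bsub>Gsd\<^esub> x = x" unfolding gel_one by (simp add: gel_mult)
  let ?i = "inv_into UNIV \<sigma>"
  have b: "bij \<sigma>" using x S2inf_bij by blast
  have "gel (?i ` A) ?i \<otimes>\<^bsub>Gsd\<^esub> x = \<one>\<^bsub>Gsd\<^esub>"
    unfolding gel_one x(1) using b by (simp add: gel_mult bij_imp_bij_inv bij_is_inj)
  moreover have "gel (?i ` A) ?i \<in> carrier Gsd"
    using x by (intro gel_carrier clopen_image S2inf_inv)
  ultimately show "\<exists>y\<in>carrier Gsd. y \<otimes>\<^bsub>Gsd\<^esub> x = \<one>\<^bsub>Gsd\<^esub>" by blast
qed

lemma gel_inv:
  assumes "clopen A" "\<sigma> \<in> S2inf"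
  shows "inv\<^bsub>Gsd\<^esub> (gel A \<sigma>) = gel (inv_into UNIV \<sigma> ` A) (inv_into UNIV \<sigma>)"
proof (rule group.inv_equality[OF group_Gsd])
  show "gel (inv_into UNIV \<sigma> ` A) (inv_into UNIV \<sigma>) \<otimes>\<^bsub>Gsd\<^esub> gel A \<sigma> = \<one>\<^bsub>Gsd\<^esub>"
    unfolding gel_one using S2inf_bij[OF assms(2)] by (simp add: gel_mult bij_imp_bij_inv bij_is_inj)
qed (use assms in \<open>auto intro!: gel_carrier clopen_image S2inf_inv\<close>)

text \<open>For \<open>J = {..<n}\<close> these are the finite subgroups exhausting the
  group.\<close>

definition Glev :: "nat set \<Rightarrow> (cantor set set \<times> (cantor \<Rightarrow> cantor)) set" where
  "Glev J = {gel A \<sigma> | A \<sigma>. meas J A \<and> loc J \<sigma>}"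

lemma Glev_gel_iff: "gel A \<sigma> \<in> Glev J \<longleftrightarrow> meas J A \<and> loc J \<sigma>"
  by (auto simp: Glev_def gel_eq_iff meas_Compl)

lemma Glev_cases:
  assumes "g \<in> Glev J"
  obtains A \<sigma> where "g = gel A \<sigma>" "meas J A" "loc J \<sigma>"
  using assms unfolding Glev_def by blast

lemma Glev_mono: "J \<subseteq> J' \<Longrightarrow> Glev J \<subseteq> Glev J'"
  unfolding Glev_def using meas_mono loc_mono by blast

lemma Glev_Int:
  assumes "g \<in> Glev J" "g \<in> Glev J'"
  shows "g \<in> Glev (J \<inter> J')"
proof -
  obtain A \<sigma> where "g = gel A \<sigma>" using assms(1) by (rule Glev_cases)
  then show ?thesis using assms by (simp add: Glev_gel_iff meas_Int loc_Int)
qed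

lemma Glev_carrier: "Glev {..<n} \<subseteq> carrier Gsd"
  unfolding Glev_def carrier_Gsd using clopen_iff S2inf_iff by blast

lemma Glev_empty: "Glev {} = {\<one>\<^bsub>Gsd\<^esub>}"
proof
  show "Glev {} \<subseteq> {\<one>\<^bsub>Gsd\<^esub>}"
  proof
    fix g assume "g \<in> Glev {}"
    then obtain A \<sigma> where g: "g = gel A \<sigma>" "meas {} A" "loc {} \<sigma>" by (rule Glev_cases)
    then have "A = {} \<or> A = UNIV" "\<sigma> = id" using meas_empty_coords loc_empty by auto
    then show "g \<in> {\<one>\<^bsub>Gsd\<^esub>}" unfolding gel_one g(1) by (auto simp: gel_eq_iff)
  qed
  show "{\<one>\<^bsub>Gsd\<^esub>} \<subseteq> Glev {}" unfolding gel_one by (simp add: Glev_gel_iff meas_empty loc_id)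
qed

lemma locally_finite_Gsd: "locally_finite_group Gsd (\<lambda>n. Glev {..<n})"
proof -
  interpret group Gsd by (rule group_Gsd)
  show ?thesis
  proof (intro locally_finite_group.intro locally_finite_group_axioms.intro)
    show "group Gsd" by (rule group_Gsd)
    fix n m :: nat
    have "Glev {..<n} \<subseteq> (\<lambda>(A, \<sigma>). gel A \<sigma>) ` ({A. meas {..<n} A} \<times> {\<sigma>. loc {..<n} \<sigma>})"
      by (auto simp: Glev_def)
    then show "finite (Glev {..<n})"
      by (rule finite_subset) (intro finite_imageI finite_cartesian_product finite_meas finite_loc)
    show "Glev {..<n} \<subseteq> Glev {..<m}" if "n \<le> m" using that by (intro Glev_mono) auto
    show "subgroup (Glev {..<n}) Gsd"
    proof (rule subgroupI)
      show "Glev {..<n} \<subseteq> carrier Gsd" by (rule Glev_carrier)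
      have "gel {} id \<in> Glev {..<n}" by (simp add: Glev_gel_iff meas_empty loc_id)
      then show "Glev {..<n} \<noteq> {}" by blast
    next
      fix g assume "g \<in> Glev {..<n}"
      then obtain A \<sigma> where g: "g = gel A \<sigma>" "meas {..<n} A" "loc {..<n} \<sigma>" by (rule Glev_cases)
      then have "clopen A" "\<sigma> \<in> S2inf" using clopen_iff S2inf_iff by blast+
      then show "inv\<^bsub>Gsd\<^esub> g \<in> Glev {..<n}"
        unfolding g(1) by (simp add: gel_inv Glev_gel_iff meas_image loc_inv g)
    next
      fix g h assume "g \<in> Glev {..<n}" "h \<in> Glev {..<n}"
      then obtain A \<sigma> B \<tau> where g: "g = gel A \<sigma>" "meas {..<n} A" "loc {..<n} \<sigma>"
        and h: "h = gel B \<tau>" "meas {..<n} B" "loc {..<n} \<tau>"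
        by (metis Glev_cases)
      then show "g \<otimes>\<^bsub>Gsd\<^esub> h \<in> Glev {..<n}"
        unfolding g(1) h(1) by (simp add: gel_mult locD(1)[OF g(3)] Glev_gel_iff meas_symdiff meas_image loc_comp)
    qed
    show "carrier Gsd = (\<Union>n. Glev {..<n})"
    proof
      show "carrier Gsd \<subseteq> (\<Union>n. Glev {..<n})"
      proof
        fix g assume "g \<in> carrier Gsd"
        then obtain A \<sigma> where g: "g = gel A \<sigma>" "clopen A" "\<sigma> \<in> S2inf" by (rule Gsd_cases)
        then obtain n m where "meas {..<n} A" "loc {..<m} \<sigma>" using clopen_iff S2inf_iff by blast
        then have "meas {..<max n m} A" "loc {..<max n m} \<sigma>" by (auto elim!: meas_mono loc_mono)
        then have "g \<in> Glev {..<max n m}" by (simp add: g(1) Glev_gel_iff)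
        then show "g \<in> (\<Union>n. Glev {..<n})" by blast
      qed
    qed (use Glev_carrier in blast)
  qed
qed

section \<open>The escaping sequence of coordinate permutations\<close>

definition blk :: "nat \<Rightarrow> nat \<Rightarrow> nat \<Rightarrow> nat" where
  "blk n i k = (if n \<le> k \<and> k < n + i then k + i else if n + i \<le> k \<and> k < n + 2 * i then k - i else k)"

lemma blk_blk: "blk n i (blk n i k) = k"
  by (auto simp: blk_def)

lemma coord_perm_bij:
  fixes \<pi> :: "nat \<Rightarrow> nat"
  assumes "\<And>k. \<pi> (\<pi> k) = k"
  shows "bij (\<lambda>x::cantor. x \<circ> \<pi>)"
  by (rule o_bij[of "\<lambda>x::cantor. x \<circ> \<pi>"]) (auto simp: fun_eq_iff assms)

lemma coord_perm_inv:
  fixes \<pi> :: "nat \<Rightarrow> nat"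
  assumes "\<And>k. \<pi> (\<pi> k) = k"
  shows "inv_into UNIV (\<lambda>x::cantor. x \<circ> \<pi>) = (\<lambda>x. x \<circ> \<pi>)"
  by (rule inv_equality) (auto simp: fun_eq_iff assms)

lemma coord_perm_loc:
  fixes \<pi> :: "nat \<Rightarrow> nat"
  assumes "\<And>k. \<pi> (\<pi> k) = k" "\<And>k. k \<ge> N \<Longrightarrow> \<pi> k = k"
  shows "loc {..<N} (\<lambda>x. x \<circ> \<pi>)"
proof (rule locI)
  have "\<pi> k < N" if "k < N" for k using assms that by (metis not_le)
  then show "eqon {..<N} (x \<circ> \<pi>) (y \<circ> \<pi>)" if "eqon {..<N} x y" for x y
    using that by (auto simp: eqon_def)
qed (use assms coord_perm_bij in auto)

lemma coord_perm_conj: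
  fixes \<pi> :: "nat \<Rightarrow> nat"
  assumes \<pi>: "\<And>k. \<pi> (\<pi> k) = k" "\<And>k. k \<ge> N \<Longrightarrow> \<pi> k = k"
    and A: "clopen A" and s: "\<sigma> \<in> S2inf"
  defines "c \<equiv> gel {} (\<lambda>x. x \<circ> \<pi>)"
  shows "inv\<^bsub>Gsd\<^esub> c \<otimes>\<^bsub>Gsd\<^esub> gel A \<sigma> \<otimes>\<^bsub>Gsd\<^esub> c = gel {x. x \<circ> \<pi> \<in> A} (\<lambda>x. \<sigma> (x \<circ> \<pi>) \<circ> \<pi>)"
proof -
  let ?c = "\<lambda>x::cantor. x \<circ> \<pi>"
  have b: "bij ?c" by (rule coord_perm_bij[OF \<pi>(1)])
  have cS: "?c \<in> S2inf" using loc_S2inf[OF coord_perm_loc[OF \<pi>]] .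
  have ci: "inv\<^bsub>Gsd\<^esub> c = gel {} ?c"
    unfolding c_def gel_inv[OF clopen_empty cS] coord_perm_inv[OF \<pi>(1)] by simp
  have im: "?c ` A = {x. x \<circ> \<pi> \<in> A}"
  proof (intro Set.set_eqI iffI)
    fix x assume "x \<in> {x. x \<circ> \<pi> \<in> A}"
    moreover have "x = x \<circ> \<pi> \<circ> \<pi>" by (simp add: fun_eq_iff \<pi>(1))
    ultimately show "x \<in> ?c ` A" by blast
  next
    fix x assume "x \<in> ?c ` A"
    then obtain y where "y \<in> A" "x = y \<circ> \<pi>" by blast
    moreover have "y \<circ> \<pi> \<circ> \<pi> = y" by (simp add: fun_eq_iff \<pi>(1))
    ultimately show "x \<in> {x. x \<circ> \<pi> \<in> A}" by simp
  qed
  show ?thesis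
    unfolding ci unfolding c_def
    by (simp add: gel_mult b S2inf_bij[OF s] bij_comp im) (simp add: gel_eq_iff fun_eq_iff)
qed

lemma coord_perm_conj_Glev:
  fixes \<pi> :: "nat \<Rightarrow> nat"
  assumes \<pi>: "\<And>k. \<pi> (\<pi> k) = k" "\<And>k. k \<ge> N \<Longrightarrow> \<pi> k = k"
    and g: "g \<in> carrier Gsd" "g \<in> Glev J"
  defines "c \<equiv> gel {} (\<lambda>x. x \<circ> \<pi>)"
  shows "inv\<^bsub>Gsd\<^esub> c \<otimes>\<^bsub>Gsd\<^esub> g \<otimes>\<^bsub>Gsd\<^esub> c \<in> Glev (\<pi> ` J)"
proof -
  obtain A \<sigma> where A: "g = gel A \<sigma>" "clopen A" "\<sigma> \<in> S2inf" using g(1) by (rule Gsd_cases)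
  then have J: "meas J A" "loc J \<sigma>" using g(2) by (simp_all add: Glev_gel_iff)
  have e: "eqon J (x \<circ> \<pi>) (y \<circ> \<pi>)" if "eqon (\<pi> ` J) x y" for x y using that by (simp add: eqon_def)
  have "meas (\<pi> ` J) {x. x \<circ> \<pi> \<in> A}" using J(1) e by (auto simp: meas_def)
  moreover have "loc (\<pi> ` J) (\<lambda>x. \<sigma> (x \<circ> \<pi>) \<circ> \<pi>)"
  proof (rule locI)
    have "(\<lambda>x. \<sigma> (x \<circ> \<pi>) \<circ> \<pi>) = (\<lambda>x. x \<circ> \<pi>) \<circ> \<sigma> \<circ> (\<lambda>x. x \<circ> \<pi>)" by (simp add: fun_eq_iff)
    then show "bij (\<lambda>x. \<sigma> (x \<circ> \<pi>) \<circ> \<pi>)"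
      using coord_perm_bij[OF \<pi>(1)] S2inf_bij[OF A(3)] by (simp only: bij_comp)
    show "(\<sigma> (x \<circ> \<pi>) \<circ> \<pi>) k = x k" if "k \<notin> \<pi> ` J" for x k
    proof -
      have "\<pi> k \<notin> J" using that \<pi>(1) by (metis image_eqI)
      then show ?thesis using locD(2)[OF J(2), of "\<pi> k" "x \<circ> \<pi>"] \<pi>(1) by simp
    qed
    show "eqon (\<pi> ` J) (\<sigma> (x \<circ> \<pi>) \<circ> \<pi>) (\<sigma> (y \<circ> \<pi>) \<circ> \<pi>)" if "eqon (\<pi> ` J) x y" for x y
      using locD(3)[OF J(2) e[OF that]] \<pi>(1) by (simp add: eqon_def)
  qed
  ultimately show ?thesis
    unfolding c_def A(1) by (subst coord_perm_conj[OF \<pi> A(2,3)]) (auto simp: Glev_gel_iff)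
qed

text \<open>\<open>blk n i\<close> exchanges the adjacent blocks of length \<open>i\<close> starting
  at \<open>n\<close> and \<open>n + i\<close>. Let \<open>g\<close> have level \<open>m\<close> and
  suppose its conjugate has level \<open>N'\<close>. Conjugating back, \<open>g\<close> uses only
  coordinates below \<open>m\<close> that lie in the image of \<open>{..<N'}\<close>; for
  \<open>i\<close> at least \<open>m\<close> and \<open>N'\<close> these are all below
  \<open>n\<close>.\<close>

lemma escaping_Gsd: "escaping_group Gsd (\<lambda>n. Glev {..<n})"
proof (rule escaping_group.intro[OF locally_finite_Gsd], rule escaping_group_axioms.intro)
  interpret group Gsd by (rule group_Gsd)
  fix n
  define c where "c i = gel {} (\<lambda>x. x \<circ> blk n i)" for i
  have N: "blk n i k = k" if "k \<ge> n + 2 * i" for i k using that by (auto simp: blk_def)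
  have cS: "(\<lambda>x. x \<circ> blk n i) \<in> S2inf" for i
    by (rule loc_S2inf, rule coord_perm_loc[of "blk n i" "n + 2 * i"]) (auto simp: blk_blk N)
  have cc: "c i \<in> carrier Gsd" for i
    unfolding c_def using cS by (intro gel_carrier clopen_empty)
  have com: "inv\<^bsub>Gsd\<^esub> (c i) \<otimes>\<^bsub>Gsd\<^esub> g \<otimes>\<^bsub>Gsd\<^esub> c i = g" if gn: "g \<in> Glev {..<n}" for g i
  proof -
    obtain A \<sigma> where g: "g = gel A \<sigma>" "meas {..<n} A" "loc {..<n} \<sigma>" using gn by (rule Glev_cases)
    have cl: "clopen A" "\<sigma> \<in> S2inf" using g clopen_iff S2inf_iff by blast+
    have e: "eqon {..<n} (x \<circ> blk n i) x" for x by (simp add: eqon_def blk_def)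
    have "{x. x \<circ> blk n i \<in> A} = A" using measD[OF g(2) e] by blast
    moreover have "(\<sigma> (x \<circ> blk n i) \<circ> blk n i) k = \<sigma> x k" for x k
    proof (cases "k < n")
      case True
      then have "blk n i k = k" by (simp add: blk_def)
      then show ?thesis using locD(3)[OF g(3) e[of x]] True by (simp add: eqon_def)
    next
      case False
      then have "\<not> blk n i k < n" by (auto simp: blk_def)
      then show ?thesis using locD(2)[OF g(3)] False blk_blk[of n i k] by simp
    qed
    ultimately show ?thesis
      unfolding c_def g(1) by (subst coord_perm_conj[of "blk n i" "n + 2 * i"]) (auto simp: blk_blk N cl fun_eq_iff gel_eq_iff)
  qed
  have esc: "\<forall>\<^sub>F i in sequentially. inv\<^bsub>Gsd\<^esub> (c i) \<otimes>\<^bsub>Gsd\<^esub> g \<otimes>\<^bsub>Gsd\<^esub> c i \<notin> Glev {..<N'}"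
    if g: "g \<in> carrier Gsd" "g \<notin> Glev {..<n}" for g N'
  proof -
    obtain m where m: "g \<in> Glev {..<m}"
      using g(1) locally_finite_group.Gn_Union[OF locally_finite_Gsd] by blast
    show ?thesis
    proof (rule eventually_sequentiallyI[of "max m N'"])
      fix i assume i: "max m N' \<le> i"
      show "inv\<^bsub>Gsd\<^esub> (c i) \<otimes>\<^bsub>Gsd\<^esub> g \<otimes>\<^bsub>Gsd\<^esub> c i \<notin> Glev {..<N'}"
      proof
        let ?h = "inv\<^bsub>Gsd\<^esub> (c i) \<otimes>\<^bsub>Gsd\<^esub> g \<otimes>\<^bsub>Gsd\<^esub> c i"
        assume h: "?h \<in> Glev {..<N'}"
        have hc: "?h \<in> carrier Gsd" using cc g(1) by simp
        have ci: "inv\<^bsub>Gsd\<^esub> (c i) = c i"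
          unfolding c_def using gel_inv[OF clopen_empty cS[of i]] coord_perm_inv[of "blk n i"] by (simp add: blk_blk)
        have "inv\<^bsub>Gsd\<^esub> (c i) \<otimes>\<^bsub>Gsd\<^esub> ?h \<otimes>\<^bsub>Gsd\<^esub> c i \<in> Glev (blk n i ` {..<N'})"
          using coord_perm_conj_Glev[of "blk n i" "n + 2 * i" ?h "{..<N'}"] blk_blk N hc h unfolding c_def by blast
        moreover have "inv\<^bsub>Gsd\<^esub> (c i) \<otimes>\<^bsub>Gsd\<^esub> ?h \<otimes>\<^bsub>Gsd\<^esub> c i = g"
        proof -
          have cici: "c i \<otimes>\<^bsub>Gsd\<^esub> c i = \<one>\<^bsub>Gsd\<^esub>" using ci cc[of i] by (metis r_inv)
          then have "c i \<otimes>\<^bsub>Gsd\<^esub> (c i \<otimes>\<^bsub>Gsd\<^esub> x) = x" if "x \<in> carrier Gsd" for x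
            using cc[of i] that by (metis l_one m_assoc)
          then show ?thesis using cc[of i] g(1) cici by (simp add: ci m_assoc)
        qed
        ultimately have "g \<in> Glev ({..<m} \<inter> blk n i ` {..<N'})" using m Glev_Int by simp
        moreover have "{..<m} \<inter> blk n i ` {..<N'} \<subseteq> {..<n}" using i by (auto simp: blk_def split: if_splits)
        ultimately show False using Glev_mono g(2) by blast
      qed
    qed
  qed
  show "\<exists>c. (\<forall>i. c i \<in> carrier Gsd) \<and> (\<forall>i. \<forall>g\<in>Glev {..<n}. inv\<^bsub>Gsd\<^esub> (c i) \<otimes>\<^bsub>Gsd\<^esub> g \<otimes>\<^bsub>Gsd\<^esub> c i = g) \<and>
      (\<forall>g\<in>carrier Gsd - Glev {..<n}. \<forall>N. \<forall>\<^sub>F i in sequentially. inv\<^bsub>Gsd\<^esub> (c i) \<otimes>\<^bsub>Gsd\<^esub> g \<otimes>\<^bsub>Gsd\<^esub> c i \<notin> Glev {..<N})"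
    using cc com esc by blast
qed

section \<open>The abelian normal subgroup\<close>

lemma Csub_eq: "Csub = {gel A id | A. clopen A}"
  by (auto simp: Csub_def Ctil_def gel_def)

lemma Csub_gel: "gel A \<sigma> \<in> Csub \<longleftrightarrow> clopen A \<and> \<sigma> = id"
proof -
  have "clopen (- A) \<longleftrightarrow> clopen A" by (simp add: clopen_iff meas_Compl)
  then show ?thesis by (auto simp: Csub_eq gel_eq_iff)
qed

lemma Csub_cases:
  assumes "f \<in> Csub"
  obtains A where "f = gel A id" "clopen A"
  using assms unfolding Csub_eq by blast

lemma Csub_normal: "Csub \<lhd> Gsd"
proof -
  interpret group Gsd by (rule group_Gsd)
  have "subgroup Csub Gsd"
  proof (rule subgroupI)
    show "Csub \<subseteq> carrier Gsd" unfolding Csub_eq using gel_carrier S2inf_id by blast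
    show "Csub \<noteq> {}" unfolding Csub_eq using clopen_empty by blast
    show "inv\<^bsub>Gsd\<^esub> f \<in> Csub" if "f \<in> Csub" for f
      using that by (auto elim!: Csub_cases simp: gel_inv S2inf_id Csub_gel)
    show "f \<otimes>\<^bsub>Gsd\<^esub> h \<in> Csub" if "f \<in> Csub" "h \<in> Csub" for f h
      using that by (auto elim!: Csub_cases simp: gel_mult Csub_gel clopen_symdiff)
  qed
  then show ?thesis
  proof (rule normal_invI)
    fix x h assume "x \<in> carrier Gsd" "h \<in> Csub"
    then obtain A \<sigma> B where x: "x = gel A \<sigma>" "clopen A" "\<sigma> \<in> S2inf" and h: "h = gel B id" "clopen B"
      by (metis Gsd_cases Csub_cases)
    have b: "bij \<sigma>" using S2inf_bij[OF x(3)] .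
    have "\<sigma> \<circ> inv_into UNIV \<sigma> = id" by (rule ext) (simp add: b bij_is_surj surj_f_inv_f)
    then show "x \<otimes>\<^bsub>Gsd\<^esub> h \<otimes>\<^bsub>Gsd\<^esub> inv\<^bsub>Gsd\<^esub> x \<in> Csub"
      unfolding x(1) h(1) using x h b by (simp add: gel_mult gel_inv Csub_gel clopen_symdiff clopen_image S2inf_inv)
  qed
qed

lemma Csub_comm:
  assumes "f \<in> Csub" "h \<in> Csub"
  shows "f \<otimes>\<^bsub>Gsd\<^esub> h = h \<otimes>\<^bsub>Gsd\<^esub> f"
  using assms by (auto elim!: Csub_cases simp: gel_mult symdiff_commute)

lemma Csub_square: "f \<in> Csub \<Longrightarrow> f \<otimes>\<^bsub>Gsd\<^esub> f = \<one>\<^bsub>Gsd\<^esub>"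
  by (auto elim!: Csub_cases simp: gel_mult gel_one)

lemma Csub_comm_group: "comm_group (Gsd\<lparr>carrier := Csub\<rparr>)"
proof -
  interpret group Gsd by (rule group_Gsd)
  have "group (Gsd\<lparr>carrier := Csub\<rparr>)"
    using subgroup_imp_group[OF normal_imp_subgroup[OF Csub_normal]] .
  then show ?thesis by (rule group.group_comm_groupI) (simp add: Csub_comm)
qed

lemma Csub_nontrivial: "Csub \<noteq> {\<one>\<^bsub>Gsd\<^esub>}"
proof -
  let ?A = "{x::cantor. x 0}"
  have "meas {..<1} ?A" by (simp add: meas_def eqon_def)
  then have "gel ?A id \<in> Csub" using clopen_iff by (auto simp: Csub_gel)
  moreover have "gel ?A id \<noteq> \<one>\<^bsub>Gsd\<^esub>"
  proof
    assume "gel ?A id = \<one>\<^bsub>Gsd\<^esub>"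
    then have "?A = {} \<or> ?A = UNIV" by (auto simp: gel_one gel_eq_iff)
    then show False
    proof
      assume "?A = {}"
      then have "(\<lambda>_. True) \<notin> ?A" by blast
      then show False by simp
    next
      assume "?A = UNIV"
      then have "(\<lambda>_. False) \<in> ?A" by blast
      then show False by simp
    qed
  qed
  ultimately show ?thesis by blast
qed

text \<open>The generic set compares the first \<open>n\<close> coordinates with a fresh copy of them.\<close>

lemma Csub_generic: "\<exists>f\<in>Csub. \<forall>r\<in>Glev {..<n}. f \<otimes>\<^bsub>Gsd\<^esub> r \<otimes>\<^bsub>Gsd\<^esub> f \<in> Glev {..<n} \<longrightarrow> r \<in> Csub"
proof -
  \<comment> \<open>Coordinate \<open>2 * n\<close> is a switch: turning it off leaves
    \<open>B\<close> and also its image under any permutation of level \<open>n\<close>, without any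
    change visible at level \<open>n\<close>.\<close>
  define B :: "cantor set" where "B = {x. x (2 * n) \<and> (\<forall>k<n. x k = x (n + k))}"
  have "meas {..<2 * n + 1} B" by (simp add: meas_def eqon_def B_def)
  then have clB: "clopen B" using clopen_iff by blast
  have "r \<in> Csub" if r: "r \<in> Glev {..<n}" and frf: "gel B id \<otimes>\<^bsub>Gsd\<^esub> r \<otimes>\<^bsub>Gsd\<^esub> gel B id \<in> Glev {..<n}" for r
  proof -
    obtain A \<rho> where A: "r = gel A \<rho>" "meas {..<n} A" "loc {..<n} \<rho>" using r by (rule Glev_cases)
    have b: "bij \<rho>" using locD(1)[OF A(3)] .
    have "gel B id \<otimes>\<^bsub>Gsd\<^esub> r \<otimes>\<^bsub>Gsd\<^esub> gel B id = gel (symdiff (symdiff B A) (\<rho> ` B)) \<rho>"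
      unfolding A(1) using b by (simp add: gel_mult)
    then have "meas {..<n} (symdiff (symdiff B A) (\<rho> ` B))" using frf by (simp add: Glev_gel_iff)
    then have "meas {..<n} (symdiff A (symdiff (symdiff B A) (\<rho> ` B)))" using A(2) meas_symdiff by blast
    moreover have "symdiff A (symdiff (symdiff B A) (\<rho> ` B)) = symdiff B (\<rho> ` B)" by (auto simp: symdiff_def)
    ultimately have m: "meas {..<n} (symdiff B (\<rho> ` B))" by simp
    have "\<rho> x = x" for x
    proof (rule ccontr)
      assume "\<rho> x \<noteq> x"
      then obtain k where k: "k < n" "\<rho> x k \<noteq> x k" using locD(2)[OF A(3), of _ x] by (auto simp: fun_eq_iff)
      \<comment> \<open>With both blocks equal to \<open>\<rho> x\<close>, the point
        \<open>v True\<close> lies in \<open>B\<close>, but its preimage under \<open>\<rho>\<close>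
        has first block \<open>x\<close> and second block \<open>\<rho> x\<close>.\<close>
      define v where "v t = (\<lambda>j. if j < n then \<rho> x j else if j < 2 * n then \<rho> x (j - n) else t)" for t :: bool
      have "eqon {..<n} (v True) (v False)" by (simp add: eqon_def v_def)
      moreover have "v True \<in> B" by (simp add: B_def v_def)
      moreover have "v True \<notin> \<rho> ` B"
      proof
        assume "v True \<in> \<rho> ` B"
        then obtain y where y: "y \<in> B" "v True = \<rho> y" by blast
        have "eqon {..<n} (\<rho> y) (\<rho> x)" using y(2)[symmetric] by (simp add: eqon_def v_def)
        then have "eqon {..<n} (inv_into UNIV \<rho> (\<rho> y)) (inv_into UNIV \<rho> (\<rho> x))"
          by (rule locD(3)[OF loc_inv[OF A(3)]])
        then have "eqon {..<n} y x" using b by (simp add: bij_is_inj)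
        then have "y k = x k" using k by (simp add: eqon_def)
        moreover have "y k = y (n + k)" using y(1) k by (simp add: B_def)
        moreover have "y (n + k) = v True (n + k)" using y(2) locD(2)[OF A(3), of "n + k" y] by simp
        moreover have "v True (n + k) = \<rho> x k" using k by (simp add: v_def)
        ultimately show False using k by simp
      qed
      moreover have "v False \<notin> B" by (simp add: B_def v_def)
      moreover have "v False \<notin> \<rho> ` B"
      proof
        assume "v False \<in> \<rho> ` B"
        then obtain y where y: "y \<in> B" "v False = \<rho> y" by blast
        have "y (2 * n) = v False (2 * n)" using y(2) locD(2)[OF A(3), of "2 * n" y] by simp
        then show False using y(1) by (simp add: B_def v_def)
      qed
      ultimately show False using measD[OF m, of "v True" "v False"] by (simp add: symdiff_def)
    qed
    then have "\<rho> = id" by (simp add: fun_eq_iff)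
    moreover have "clopen A" using A(2) clopen_iff by blast
    ultimately show ?thesis by (simp add: A(1) Csub_gel)
  qed
  then show ?thesis using clB by (intro bexI[of _ "gel B id"]) (auto simp: Csub_gel)
qed

subsection \<open>Swaps and flips of cylinders\<close>

definition graft :: "nat \<Rightarrow> cantor \<Rightarrow> cantor \<Rightarrow> cantor" where
  "graft m b x = (\<lambda>k. if k < m then b k else x k)"

text \<open>The transposition of the depth \<open>m\<close> cylinders of \<open>a\<close> and
  \<open>b\<close>; only the first \<open>m\<close> coordinates of these points matter, and equal
  cylinders give the identity.\<close>

definition sw :: "nat \<Rightarrow> cantor \<Rightarrow> cantor \<Rightarrow> cantor \<Rightarrow> cantor" where
  "sw m a b x = (if eqon {..<m} x a then graft m b x else if eqon {..<m} x b then graft m a x else x)"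

text \<open>For \<open>D\<close> of level \<open>j\<close> this exchanges the two halves of each
  depth \<open>j\<close> cylinder inside \<open>D\<close>, so it is a product of disjoint
  transpositions of depth \<open>j + 1\<close>. It preserves every set of level
  \<open>j\<close>.\<close>

definition fl :: "nat \<Rightarrow> cantor set \<Rightarrow> cantor \<Rightarrow> cantor" where
  "fl j D x = (if x \<in> D then x(j := \<not> x j) else x)"

lemma involution:
  assumes "\<And>x. c (c x) = x"
  shows "bij c" "inv_into UNIV c = c" "x \<in> c ` A \<longleftrightarrow> c x \<in> A"
proof -
  show b: "bij c" by (rule o_bij[of c]) (auto simp: assms)
  show i: "inv_into UNIV c = c" by (rule inv_equality) (auto simp: assms)
  show "x \<in> c ` A \<longleftrightarrow> c x \<in> A" using mem_image_bij[OF b, of x A] by (simp add: i)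
qed

lemma eqon_graft: "eqon {..<m} (graft m b x) b"
  by (simp add: eqon_def graft_def)

lemma graft_eqon: "eqon {..<m} x b \<Longrightarrow> graft m b x = x"
  by (auto simp: eqon_def graft_def)

lemma graft_graft: "graft m a (graft m b x) = graft m a x"
  by (auto simp: graft_def)

lemma graft_cong: "eqon {..<m} a b \<Longrightarrow> graft m a x = graft m b x"
  by (auto simp: eqon_def graft_def)

lemma sw_left: "eqon {..<m} x a \<Longrightarrow> eqon {..<m} (sw m a b x) b"
  by (simp add: sw_def eqon_graft)

lemma sw_right: "eqon {..<m} x b \<Longrightarrow> eqon {..<m} (sw m a b x) a"
proof (cases "eqon {..<m} x a")
  case True
  assume "eqon {..<m} x b"
  then show ?thesis using True by (simp add: sw_def graft_eqon)
qed (simp add: sw_def eqon_graft)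

lemma sw_other: "\<not> eqon {..<m} x a \<Longrightarrow> \<not> eqon {..<m} x b \<Longrightarrow> sw m a b x = x"
  by (simp add: sw_def)

lemma sw_sw: "sw m a b (sw m a b x) = x"
proof (cases "eqon {..<m} x a")
  case True
  show ?thesis
  proof (cases "eqon {..<m} b a")
    case True': True
    then have "eqon {..<m} x b" using True eqon_sym eqon_trans by blast
    then show ?thesis using True by (simp add: sw_def graft_eqon)
  next
    case False
    then have "\<not> eqon {..<m} (graft m b x) a" using eqon_graft eqon_sym eqon_trans by blast
    then show ?thesis using True by (simp add: sw_def eqon_graft graft_graft graft_eqon)
  qed
next
  case False
  then show ?thesis using graft_eqon[of m x b] by (simp add: sw_def eqon_graft graft_graft)
qed

lemma sw_image_mem: "x \<in> sw m a b ` A \<longleftrightarrow> sw m a b x \<in> A"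
  by (rule involution(3)) (rule sw_sw)

lemma sw_above: "m \<le> k \<Longrightarrow> sw m a b x k = x k"
  by (simp add: sw_def graft_def)

lemma sw_loc: "loc {..<m} (sw m a b)"
proof (rule locI)
  show "bij (sw m a b)" by (rule involution(1)) (rule sw_sw)
  fix x y assume xy: "eqon {..<m} x y"
  then have "eqon {..<m} x a \<longleftrightarrow> eqon {..<m} y a" "eqon {..<m} x b \<longleftrightarrow> eqon {..<m} y b"
    using eqon_sym eqon_trans by blast+
  then show "eqon {..<m} (sw m a b x) (sw m a b y)"
    using xy by (auto simp: sw_def) (auto simp: eqon_def graft_def)
qed (simp add: sw_above)

lemma sw_image_eq:
  assumes "meas {..<m} A" "a \<in> A \<longleftrightarrow> b \<in> A"
  shows "sw m a b ` A = A"
proof -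
  have "sw m a b x \<in> A \<longleftrightarrow> x \<in> A" for x
  proof -
    consider "eqon {..<m} x a" | "eqon {..<m} x b" | "\<not> eqon {..<m} x a" "\<not> eqon {..<m} x b" by blast
    then show ?thesis
    proof cases
      case 1
      then show ?thesis using measD[OF assms(1) sw_left[OF 1, of b]] measD[OF assms(1) 1] assms(2) by blast
    next
      case 2
      then show ?thesis using measD[OF assms(1) sw_right[OF 2, of a]] measD[OF assms(1) 2] assms(2) by blast
    qed (simp add: sw_other)
  qed
  then show ?thesis using sw_image_mem[of _ m a b A] by blast
qed

text \<open>The swap moves only the halves with coordinate \<open>n\<close> equal to
  \<open>False\<close>. The image of \<open>B\<close> therefore loses one half of the depth
  \<open>n\<close> cylinder of \<open>a\<close> and keeps the other.\<close>

lemma sw_not_meas: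
  assumes B: "meas {..<n} B" and a: "a \<in> B" and b: "b \<notin> B"
  shows "\<not> meas {..<n} (sw (Suc n) (a(n := False)) (b(n := False)) ` B)"
proof
  let ?a = "a(n := False)" and ?b = "b(n := False)" and ?a1 = "a(n := True)"
  let ?c = "sw (Suc n) ?a ?b"
  assume m: "meas {..<n} (?c ` B)"
  have "eqon {..<Suc n} (?c ?a) ?b" by (rule sw_left[OF eqon_refl])
  then have "eqon {..<n} (?c ?a) b" by (simp add: eqon_def)
  then have "?a \<notin> ?c ` B" using measD[OF B] b sw_image_mem by blast
  moreover have "?a1 \<in> ?c ` B"
  proof -
    have "?c ?a1 = ?a1" by (rule sw_other) (auto simp: eqon_def)
    moreover have "?a1 \<in> B" using measD[OF B, of ?a1 a] a by (simp add: eqon_def)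
    ultimately show ?thesis using sw_image_mem[of ?a1 "Suc n" ?a ?b B] by simp
  qed
  moreover have "eqon {..<n} ?a ?a1" by (simp add: eqon_def)
  ultimately show False using measD[OF m] by blast
qed

lemma eqon_loc_iff:
  assumes "loc J h"
  shows "eqon J (h x) (h y) \<longleftrightarrow> eqon J x y"
proof
  assume "eqon J (h x) (h y)"
  then have "eqon J (inv_into UNIV h (h x)) (inv_into UNIV h (h y))" using locD(3)[OF loc_inv[OF assms]] by blast
  then show "eqon J x y" using locD(1)[OF assms] by (simp add: bij_is_inj)
qed (rule locD(3)[OF assms])

lemma sw_conj:
  assumes h: "loc {..<m} h"
  shows "h (sw m u v x) = sw m (h u) (h v) (h x)"
proof -
  have g: "h (graft m v x) = graft m (h v) (h x)" for v
  proof
    fix k show "h (graft m v x) k = graft m (h v) (h x) k"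
    proof (cases "k < m")
      case True
      then show ?thesis using locD(3)[OF h eqon_graft[of m v x]] by (simp add: eqon_def graft_def)
    next
      case False
      then show ?thesis using locD(2)[OF h] by (simp add: graft_def)
    qed
  qed
  show ?thesis by (simp add: sw_def eqon_loc_iff[OF h] g)
qed

lemma sw_cong:
  assumes "eqon {..<m} a a'" "eqon {..<m} b b'"
  shows "sw m a b = sw m a' b'"
proof
  fix x
  have "eqon {..<m} x a \<longleftrightarrow> eqon {..<m} x a'" "eqon {..<m} x b \<longleftrightarrow> eqon {..<m} x b'"
    using assms eqon_sym eqon_trans by blast+
  then show "sw m a b x = sw m a' b' x" using graft_cong[OF assms(1)] graft_cong[OF assms(2)] by (simp add: sw_def)
qed

text \<open>One swap carries \<open>x\<close> to \<open>x'\<close>; a second carries the image of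
  \<open>y\<close> to \<open>y'\<close> and fixes the cylinder of \<open>x'\<close>, which differs
  from both cylinders it exchanges.\<close>

lemma loc_two_transitive:
  assumes "\<not> eqon {..<j} x y" "\<not> eqon {..<j} x' y'"
  obtains h where "loc {..<j} h" "eqon {..<j} (h x) x'" "eqon {..<j} (h y) y'"
proof -
  define y1 where "y1 = sw j x x' y"
  define h where "h = sw j y1 y' \<circ> sw j x x'"
  have 1: "eqon {..<j} (sw j x x' x) x'" by (rule sw_left[OF eqon_refl])
  have "\<not> eqon {..<j} (sw j x x' x) y1" unfolding y1_def eqon_loc_iff[OF sw_loc] by (rule assms(1))
  then have "\<not> eqon {..<j} (sw j x x' x) y1" "\<not> eqon {..<j} (sw j x x' x) y'"
    using 1 assms(2) eqon_sym eqon_trans by blast+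
  then have "eqon {..<j} (h x) x'" using sw_other 1 by (simp add: h_def)
  moreover have "eqon {..<j} (h y) y'" unfolding h_def using sw_left[OF eqon_refl] by (simp add: y1_def)
  moreover have "loc {..<j} h" unfolding h_def by (intro loc_comp sw_loc)
  ultimately show ?thesis using that by blast
qed

lemma lift_perm_transpose:
  assumes "a \<in> cube m" "b \<in> cube m"
  shows "lift_perm m (Transposition.transpose a b) = sw m a b"
proof
  fix x
  have e: "eqon {..<m} x v \<longleftrightarrow> trunc m x = v" if "v \<in> cube m" for v
    using that cube_eqI[OF trunc_in_cube that] eqon_trunc eqon_sym eqon_trans by metis
  show "lift_perm m (Transposition.transpose a b) x = sw m a b x"
    using e[OF assms(1)] e[OF assms(2)]
    by (auto simp: lift_perm_def sw_def graft_def Transposition.transpose_def trunc_def fun_eq_iff)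
qed

lemma fl_fl: "meas {..<j} D \<Longrightarrow> fl j D (fl j D x) = x"
  using measD[of "{..<j}" D "x(j := \<not> x j)" x] by (auto simp: fl_def eqon_def)

lemma eqon_fl: "eqon {..<j} (fl j D x) x"
  by (simp add: fl_def eqon_def)

lemma fl_mem: "meas {..<j} B \<Longrightarrow> fl j D x \<in> B \<longleftrightarrow> x \<in> B"
  using measD eqon_fl by blast

lemma fl_loc:
  assumes "meas {..<j} D"
  shows "loc {..<Suc j} (fl j D)"
proof (rule locI)
  show "bij (fl j D)" by (rule involution(1)[OF fl_fl[OF assms]])
  fix x y assume xy: "eqon {..<Suc j} x y"
  then have "x \<in> D \<longleftrightarrow> y \<in> D" by (intro measD[OF assms]) (simp add: eqon_def)
  then show "eqon {..<Suc j} (fl j D x) (fl j D y)" using xy by (simp add: fl_def eqon_def)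
qed (simp add: fl_def)

lemma fl_image_eq:
  assumes "meas {..<j} D" "meas {..<j} B"
  shows "fl j D ` B = B"
  using involution(3)[OF fl_fl[OF assms(1)], of _ B] fl_mem[OF assms(2)] by blast

lemma loc_fun_upd:
  assumes "loc {..<j} h"
  shows "h (x(j := v)) = (h x)(j := v)"
proof
  fix k
  have "eqon {..<j} (h (x(j := v))) (h x)" by (rule locD(3)[OF assms]) (simp add: eqon_def)
  then show "h (x(j := v)) k = ((h x)(j := v)) k"
    using locD(2)[OF assms, of k] by (cases "k < j") (auto simp: eqon_def)
qed

lemma fl_conj:
  assumes h: "loc {..<j} h"
  shows "h (fl j D x) = fl j (h ` D) (h x)"
proof -
  have "h x j = x j" using locD(2)[OF h] by simp
  moreover have "h x \<in> h ` D \<longleftrightarrow> x \<in> D" using locD(1)[OF h] by (simp add: bij_is_inj inj_image_mem_iff)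
  ultimately show ?thesis by (simp add: fl_def loc_fun_upd[OF h])
qed

lemma fl_Un:
  assumes "meas {..<j} D" "D \<inter> D' = {}"
  shows "fl j D (fl j D' x) = fl j (D \<union> D') x"
  using fl_mem[OF assms(1), of D' x] assms(2) by (auto simp: fl_def)

lemma meas_cyl: "n \<le> m \<Longrightarrow> meas {..<m} (cyl n x)"
  unfolding meas_def cyl_def by (auto simp: eqon_def)

lemma cyl_image:
  assumes "loc {..<j} h"
  shows "h ` cyl j x = cyl j (h x)"
proof (intro Set.set_eqI)
  fix y
  have b: "bij h" using locD(1)[OF assms] .
  have "y \<in> h ` cyl j x \<longleftrightarrow> eqon {..<j} (inv_into UNIV h y) x"
    unfolding mem_image_bij[OF b] cyl_def by simp
  also have "\<dots> \<longleftrightarrow> eqon {..<j} (h (inv_into UNIV h y)) (h x)" by (simp only: eqon_loc_iff[OF assms])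
  also have "\<dots> \<longleftrightarrow> y \<in> cyl j (h x)" using b by (simp add: cyl_def bij_is_surj surj_f_inv_f)
  finally show "y \<in> h ` cyl j x \<longleftrightarrow> y \<in> cyl j (h x)" .
qed

lemma cyl_cong: "eqon {..<j} x y \<Longrightarrow> cyl j x = cyl j y"
  unfolding cyl_def using eqon_sym eqon_trans by blast

lemma cyl_disjoint: "\<not> eqon {..<j} x y \<Longrightarrow> cyl j x \<inter> cyl j y = {}"
  unfolding cyl_def using eqon_sym eqon_trans by blast

lemma cyl_split: "cyl (Suc j) (a(j := False)) \<union> cyl (Suc j) (a(j := True)) = cyl j a"
proof (intro Set.set_eqI)
  fix x
  have "eqon {..<Suc j} x (a(j := v)) \<longleftrightarrow> eqon {..<j} x a \<and> x j = v" for v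
    by (auto simp: eqon_def less_Suc_eq)
  then show "x \<in> cyl (Suc j) (a(j := False)) \<union> cyl (Suc j) (a(j := True)) \<longleftrightarrow> x \<in> cyl j a"
    by (auto simp: cyl_def)
qed

lemma fl_cyl_eq_sw: "fl j (cyl j a) = sw (Suc j) (a(j := False)) (a(j := True))"
proof
  fix x
  have e: "eqon {..<Suc j} x (a(j := v)) \<longleftrightarrow> eqon {..<j} x a \<and> x j = v" for v
    by (auto simp: eqon_def less_Suc_eq)
  show "fl j (cyl j a) x = sw (Suc j) (a(j := False)) (a(j := True)) x"
    unfolding sw_def e by (auto simp: fl_def cyl_def graft_def eqon_def fun_eq_iff less_Suc_eq)
qed

lemma gel_conj:
  assumes "c \<in> S2inf" "clopen B" "\<tau> \<in> S2inf"
  shows "gel {} c \<otimes>\<^bsub>Gsd\<^esub> gel B \<tau> \<otimes>\<^bsub>Gsd\<^esub> inv\<^bsub>Gsd\<^esub> (gel {} c) = gel (c ` B) (c \<circ> \<tau> \<circ> inv_into UNIV c)"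
  using assms by (simp add: gel_inv clopen_empty gel_mult S2inf_bij bij_comp)

lemma gel_conj_involution:
  assumes "c \<in> S2inf" "\<And>x. c (c x) = x" "clopen B" "\<tau> \<in> S2inf"
  shows "gel {} c \<otimes>\<^bsub>Gsd\<^esub> gel B \<tau> \<otimes>\<^bsub>Gsd\<^esub> inv\<^bsub>Gsd\<^esub> (gel {} c) = gel (c ` B) (c \<circ> \<tau> \<circ> c)"
  using gel_conj[OF assms(1,3,4)] by (simp only: involution(2)[OF assms(2)])

subsection \<open>Invariant subalgebras\<close>

locale Gsd_vNa = generic_invariant_vNa Gsd "\<lambda>n. Glev {..<n}" M Csub for M
begin

lemma perm_carrier: "loc {..<m} c \<Longrightarrow> gel {} c \<in> carrier Gsd"
  by (intro gel_carrier clopen_empty loc_S2inf)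

lemma meas_clopen: "meas {..<m} A \<Longrightarrow> clopen A"
  using clopen_iff by blast

text \<open>\<open>E_centralizer\<close> for a swap that may be deeper than \<open>n\<close>: the
  conjugated support point must still have level \<open>n\<close>. Contradictions arise from swaps
  that violate this.\<close>

lemma E_sw_conj:
  assumes g: "g \<in> Glev {..<n}" and k: "E g (gel B \<tau>) \<noteq> 0"
    and comm: "gel {} (sw m a b) \<otimes>\<^bsub>Gsd\<^esub> g = g \<otimes>\<^bsub>Gsd\<^esub> gel {} (sw m a b)"
  shows "meas {..<n} (sw m a b ` B)" "loc {..<n} (sw m a b \<circ> \<tau> \<circ> sw m a b)"
proof -
  let ?c = "sw m a b"
  have gc: "g \<in> carrier Gsd" using g Glev_carrier by blast
  have kn: "gel B \<tau> \<in> Glev {..<n}" using E_support[OF g k] .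
  then have kc: "gel B \<tau> \<in> carrier Gsd" using Glev_carrier by blast
  have B: "clopen B" "\<tau> \<in> S2inf" using kn meas_clopen loc_S2inf by (auto simp: Glev_gel_iff)
  have cc: "gel {} ?c \<in> carrier Gsd" by (rule perm_carrier[OF sw_loc])
  have "E g (gel {} ?c \<otimes>\<^bsub>Gsd\<^esub> gel B \<tau> \<otimes>\<^bsub>Gsd\<^esub> inv\<^bsub>Gsd\<^esub> (gel {} ?c)) \<noteq> 0"
    using E_centralizer[OF gc cc kc comm] k by simp
  moreover have "gel {} ?c \<otimes>\<^bsub>Gsd\<^esub> gel B \<tau> \<otimes>\<^bsub>Gsd\<^esub> inv\<^bsub>Gsd\<^esub> (gel {} ?c) = gel (?c ` B) (?c \<circ> \<tau> \<circ> ?c)"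
    using loc_S2inf[OF sw_loc] sw_sw B by (rule gel_conj_involution)
  ultimately have "gel (?c ` B) (?c \<circ> \<tau> \<circ> ?c) \<in> Glev {..<n}" using E_support[OF g] by simp
  then show "meas {..<n} (?c ` B)" "loc {..<n} (?c \<circ> \<tau> \<circ> ?c)" by (simp_all add: Glev_gel_iff)
qed

lemma sw_commutes_set:
  assumes "meas {..<m} A" "a \<in> A \<longleftrightarrow> b \<in> A"
  shows "gel {} (sw m a b) \<otimes>\<^bsub>Gsd\<^esub> gel A id = gel A id \<otimes>\<^bsub>Gsd\<^esub> gel {} (sw m a b)"
  using sw_image_eq[OF assms] locD(1)[OF sw_loc[of m a b]] by (simp add: gel_mult)

text \<open>Conjugation by the swaps preserving \<open>A\<close> would move any other element of the support
  of \<open>E (gel A id)\<close> out of the finite subgroup containing it.\<close>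

lemma E_Csub_support:
  assumes A: "meas {..<n} A" and k: "E (gel A id) k \<noteq> 0"
  shows "k = gel A id \<or> k = \<one>\<^bsub>Gsd\<^esub>"
proof -
  have g: "gel A id \<in> Glev {..<n}" using A loc_id by (simp add: Glev_gel_iff)
  have "k \<in> Glev {..<n}" using E_support[OF g k] .
  then obtain B \<tau> where B: "k = gel B \<tau>" "meas {..<n} B" "loc {..<n} \<tau>" by (rule Glev_cases)
  have kB: "E (gel A id) (gel B \<tau>) \<noteq> 0" using k B(1) by simp
  have An: "meas {..<Suc n} A" by (rule meas_mono[OF A]) auto
  have same: "x(n := v) \<in> A \<longleftrightarrow> x \<in> A" for x v by (rule measD[OF A]) (simp add: eqon_def)
  have "\<tau> x = x" for x
  proof (rule ccontr)
    assume "\<tau> x \<noteq> x"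
    then have ne: "\<not> eqon {..<n} (\<tau> x) x" using locD(2)[OF B(3), of _ x] by (auto simp: fun_eq_iff eqon_def)
    \<comment> \<open>These halves of one depth \<open>n\<close> cylinder lie on the same side of
      \<open>A\<close>, so the swap commutes with \<open>gel A id\<close>. As \<open>\<tau>\<close>
      moves the cylinder away, the second swap does not undo the first, and coordinate
      \<open>n\<close> changes.\<close>
    let ?a = "x(n := False)" and ?b = "x(n := True)"
    let ?c = "sw (Suc n) ?a ?b"
    have "loc {..<n} (?c \<circ> \<tau> \<circ> ?c)"
      by (rule E_sw_conj(2)[OF g kB sw_commutes_set[OF An]]) (simp only: same)
    then have "(?c \<circ> \<tau> \<circ> ?c) ?a n = ?a n" by (rule locD(2)) simp
    moreover have "(?c \<circ> \<tau> \<circ> ?c) ?a n = True"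
    proof -
      have ca: "eqon {..<Suc n} (?c ?a) ?b" by (rule sw_left[OF eqon_refl])
      have "eqon {..<n} (?c ?a) x" using ca by (simp add: eqon_def)
      then have t: "eqon {..<n} (\<tau> (?c ?a)) (\<tau> x)" by (rule locD(3)[OF B(3)])
      have "\<not> eqon {..<n} (\<tau> (?c ?a)) x" using t ne eqon_sym eqon_trans by blast
      then have "\<not> eqon {..<Suc n} (\<tau> (?c ?a)) ?a" "\<not> eqon {..<Suc n} (\<tau> (?c ?a)) ?b" by (auto simp: eqon_def)
      then have "?c (\<tau> (?c ?a)) = \<tau> (?c ?a)" by (rule sw_other)
      moreover have "\<tau> (?c ?a) n = ?c ?a n" using locD(2)[OF B(3)] by simp
      moreover have "?c ?a n" using ca by (simp add: eqon_def)
      ultimately show ?thesis by simp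
    qed
    ultimately show False by simp
  qed
  then have t: "\<tau> = id" by (simp add: fun_eq_iff)
  \<comment> \<open>If \<open>B\<close> separated two points on the same side of \<open>A\<close>,
    swapping half cylinders at them would preserve \<open>A\<close> but ruin the level of
    \<open>B\<close>. So \<open>B\<close> is a union of sides of \<open>A\<close>.\<close>
  have "a \<in> B \<longleftrightarrow> b \<in> B" if "a \<in> A \<longleftrightarrow> b \<in> A" for a b
  proof -
    have *: False if ab: "a \<in> A \<longleftrightarrow> b \<in> A" and "a \<in> B" "b \<notin> B" for a b
    proof -
      have "meas {..<n} (sw (Suc n) (a(n := False)) (b(n := False)) ` B)"
        by (rule E_sw_conj(1)[OF g kB sw_commutes_set[OF An]]) (simp only: same ab)
      then show False using sw_not_meas[OF B(2)] that by blast
    qed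
    show ?thesis using *[of a b] *[of b a] that by blast
  qed
  then have "B = {} \<or> B = UNIV \<or> B = A \<or> B = - A" by blast
  then show ?thesis by (auto simp: B(1) t gel_one gel_eq_iff)
qed

lemma E_Csub:
  assumes f: "f \<in> Csub" "f \<noteq> \<one>\<^bsub>Gsd\<^esub>" and nz: "E f f \<noteq> 0"
  shows "f \<in> N"
proof -
  have fc: "f \<in> carrier Gsd" using A_carrier f by blast
  obtain A where A: "f = gel A id" "clopen A" using f(1) by (rule Csub_cases)
  obtain n where n: "meas {..<n} A" using A(2) clopen_iff by blast
  \<comment> \<open>The scalars belong to \<open>M\<close> and are orthogonal to a nontrivial
    \<open>f\<close>, which removes the identity from the support.\<close>
  have "inner_l2 Gsd (delta \<one>\<^bsub>Gsd\<^esub>) (E f) = cnj (delta \<one>\<^bsub>Gsd\<^esub> f)" by (rule E_inner[OF fc P_one])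
  then have "E f \<one>\<^bsub>Gsd\<^esub> = 0" using f(2) by (simp add: inner_delta_left) (simp add: delta_def)
  have "delta f \<in> P"
  proof (rule E_dichotomy[OF fc _ nz])
    fix k assume k: "E f k \<noteq> 0"
    then have "k = gel A id \<or> k = \<one>\<^bsub>Gsd\<^esub>" using E_Csub_support[OF n] A(1) by blast
    then show "k = f" using k \<open>E f \<one>\<^bsub>Gsd\<^esub> = 0\<close> A(1) by auto
  qed
  then show ?thesis using fc by (simp add: N_def)
qed

lemma N_mult: "a \<in> N \<Longrightarrow> b \<in> N \<Longrightarrow> a \<otimes>\<^bsub>Gsd\<^esub> b \<in> N"
  using subgroup.m_closed[OF N_subgroup] .

lemma N_conj: "x \<in> carrier Gsd \<Longrightarrow> a \<in> N \<Longrightarrow> x \<otimes>\<^bsub>Gsd\<^esub> a \<otimes>\<^bsub>Gsd\<^esub> inv\<^bsub>Gsd\<^esub> x \<in> N"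
  using N_normal normal_inv_iff by blast

lemma N_sw_conj:
  assumes "gel B \<tau> \<in> N" "meas {..<m} B" "loc {..<m} \<tau>"
  shows "gel (sw m' a b ` B) (sw m' a b \<circ> \<tau> \<circ> sw m' a b) \<in> N"
proof -
  have "gel {} (sw m' a b) \<otimes>\<^bsub>Gsd\<^esub> gel B \<tau> \<otimes>\<^bsub>Gsd\<^esub> inv\<^bsub>Gsd\<^esub> (gel {} (sw m' a b)) \<in> N"
    by (rule N_conj[OF perm_carrier[OF sw_loc] assms(1)])
  then show ?thesis
    using gel_conj_involution[OF loc_S2inf[OF sw_loc] sw_sw meas_clopen[OF assms(2)] loc_S2inf[OF assms(3)]] by simp
qed

lemma N_symdiff: "gel A id \<in> N \<Longrightarrow> gel B id \<in> N \<Longrightarrow> gel (symdiff A B) id \<in> N"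
  using N_mult[of "gel A id" "gel B id"] by (simp add: gel_mult)

text \<open>Comparing \<open>A\<close> with its image under a swap across its boundary isolates two
  cylinders, and two-transitivity reaches any two of the same depth. Choosing the two halves of one
  cylinder gives a single cylinder, so the parity of the number of cylinders is no restriction;
  symmetric differences give the rest.\<close>

lemma Csub_subset_N:
  assumes f: "f \<in> Csub" "f \<noteq> \<one>\<^bsub>Gsd\<^esub>" "f \<in> N"
  shows "Csub \<subseteq> N"
proof -
  obtain A where A: "f = gel A id" "clopen A" using f(1) by (rule Csub_cases)
  obtain n where n: "meas {..<n} A" using A(2) clopen_iff by blast
  have "A \<noteq> {}" "A \<noteq> UNIV" using f(2) A(1) by (auto simp: gel_one gel_eq_iff)
  then obtain a b where ab: "a \<in> A" "b \<notin> A" by blast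
  have AN: "gel A id \<in> N" using f(3) A(1) by simp
  have pair: "gel (cyl m x \<union> cyl m y) id \<in> N" if m: "n \<le> m" and xy: "\<not> eqon {..<m} x y" for m x y
  proof -
    have Am: "meas {..<m} A" by (rule meas_mono[OF n]) (use m in auto)
    have nab: "\<not> eqon {..<m} a b" using measD[OF Am, of a b] ab by blast
    have "gel (sw m a b ` A) id \<in> N"
      using N_sw_conj[OF AN Am loc_id, of m a b] by (simp add: fun_eq_iff sw_sw comp_def id_def)
    then have "gel (symdiff A (sw m a b ` A)) id \<in> N" by (rule N_symdiff[OF AN])
    moreover have "symdiff A (sw m a b ` A) = cyl m a \<union> cyl m b"
    proof (intro Set.set_eqI)
      fix x
      consider (a) "eqon {..<m} x a" | (b) "eqon {..<m} x b" | (o) "\<not> eqon {..<m} x a" "\<not> eqon {..<m} x b" by blast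
      then show "x \<in> symdiff A (sw m a b ` A) \<longleftrightarrow> x \<in> cyl m a \<union> cyl m b"
      proof cases
        case a
        then show ?thesis using measD[OF Am a] measD[OF Am sw_left[OF a, of b]] ab
          by (simp add: symdiff_def sw_image_mem cyl_def)
      next
        case b
        then show ?thesis using measD[OF Am b] measD[OF Am sw_right[OF b, of a]] ab
          by (simp add: symdiff_def sw_image_mem cyl_def)
      next
        case o
        then show ?thesis by (simp add: symdiff_def sw_image_mem cyl_def sw_other)
      qed
    qed
    ultimately have 0: "gel (cyl m a \<union> cyl m b) id \<in> N" by simp
    obtain h where h: "loc {..<m} h" "eqon {..<m} (h a) x" "eqon {..<m} (h b) y"
      using loc_two_transitive[OF nab xy] .
    have "gel {} h \<otimes>\<^bsub>Gsd\<^esub> gel (cyl m a \<union> cyl m b) id \<otimes>\<^bsub>Gsd\<^esub> inv\<^bsub>Gsd\<^esub> (gel {} h) \<in> N"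
      by (rule N_conj[OF perm_carrier[OF h(1)] 0])
    moreover have "clopen (cyl m a \<union> cyl m b)"
      using meas_cyl[of m m] by (intro meas_clopen[of m]) (auto simp: meas_def)
    moreover have "h \<circ> inv_into UNIV h = id"
      by (rule ext) (simp add: locD(1)[OF h(1)] bij_is_surj surj_f_inv_f)
    moreover have "h ` (cyl m a \<union> cyl m b) = cyl m x \<union> cyl m y"
      using cyl_image[OF h(1)] cyl_cong[OF h(2)] cyl_cong[OF h(3)] by (simp add: image_Un)
    ultimately show ?thesis using gel_conj[OF loc_S2inf[OF h(1)] _ S2inf_id] by simp
  qed
  have cylN: "gel (cyl m x) id \<in> N" if "n \<le> m" for m x
    using pair[of "Suc m" "x(m := False)" "x(m := True)"] that cyl_split[of m x] by (simp add: eqon_def)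
  have union: "gel (\<Union>v\<in>Q. cyl m v) id \<in> N" if m: "n \<le> m" and "finite Q" "Q \<subseteq> cube m" for m Q
    using that(2,3)
  proof (induction Q)
    case empty
    then show ?case using subgroup.one_closed[OF N_subgroup] by (simp add: gel_one id_def)
  next
    case (insert v Q)
    have "cyl m v \<inter> (\<Union>v\<in>Q. cyl m v) = {}"
    proof -
      have "\<not> eqon {..<m} v w" if "w \<in> Q" for w using insert that cube_eqI by blast
      then show ?thesis using cyl_disjoint by blast
    qed
    then have sd: "symdiff (cyl m v) (\<Union>v\<in>Q. cyl m v) = (\<Union>v\<in>insert v Q. cyl m v)" by (auto simp: symdiff_def)
    have "gel (\<Union>v\<in>Q. cyl m v) id \<in> N" using insert by blast
    from N_symdiff[OF cylN[OF m, of v] this] show ?case unfolding sd .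
  qed
  show ?thesis
  proof
    fix h assume "h \<in> Csub"
    then obtain D where D: "h = gel D id" "clopen D" by (rule Csub_cases)
    then obtain k where k: "meas {..<k} D" using clopen_iff by blast
    define m where "m = max n k"
    have Dm: "meas {..<m} D" by (rule meas_mono[OF k]) (auto simp: m_def)
    have "D = (\<Union>v\<in>D \<inter> cube m. cyl m v)"
    proof (intro Set.set_eqI iffI)
      fix x assume "x \<in> D"
      then have "trunc m x \<in> D \<inter> cube m" using measD[OF Dm eqon_trunc[of m x]] trunc_in_cube by blast
      moreover have "x \<in> cyl m (trunc m x)" using eqon_sym[OF eqon_trunc] by (simp add: cyl_def)
      ultimately show "x \<in> (\<Union>v\<in>D \<inter> cube m. cyl m v)" by blast
    next
      fix x assume "x \<in> (\<Union>v\<in>D \<inter> cube m. cyl m v)"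
      then show "x \<in> D" using measD[OF Dm] by (auto simp: cyl_def)
    qed
    then show "h \<in> N" using union[of m "D \<inter> cube m"] finite_cube[of m] by (simp add: D(1) m_def)
  qed
qed

text \<open>The commutator is taken with the flip on the cylinder of \<open>x = \<sigma> y\<close>.
  The flip preserves \<open>C\<close>, so the set components cancel, and what remains is the flip on
  this cylinder and on its preimage under \<sigma>, the cylinder of \<open>y\<close>.\<close>

lemma flip_in_N:
  assumes AN: "Csub \<subseteq> N" and g: "gel C \<sigma> \<in> Glev {..<n}" and nz: "E (gel C \<sigma>) (gel C \<sigma>) \<noteq> 0"
    and s1: "\<sigma> \<noteq> id" and j: "n < j"
  obtains x y where "\<not> eqon {..<n} x y" "gel {} (fl j (cyl j x \<union> cyl j y)) \<in> N"
proof -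
  have C: "meas {..<n} C" "loc {..<n} \<sigma>" using g by (simp_all add: Glev_gel_iff)
  have sj: "loc {..<j} \<sigma>" by (rule loc_mono[OF C(2)]) (use j in auto)
  have b: "bij \<sigma>" using locD(1)[OF C(2)] .
  let ?i = "inv_into UNIV \<sigma>"
  have ij: "loc {..<j} ?i" by (rule loc_inv[OF sj])
  obtain y where y: "\<sigma> y \<noteq> y" using s1 by (auto simp: fun_eq_iff)
  define x where "x = \<sigma> y"
  have iy: "?i x = y" using b by (simp add: x_def bij_is_inj)
  have xy: "\<not> eqon {..<n} x y"
    using y locD(2)[OF C(2), of _ y] by (auto simp: x_def fun_eq_iff eqon_def)
  have xyj: "\<not> eqon {..<j} x y" using xy eqon_mono[of "{..<n}" "{..<j}"] j by auto
  define D where "D = cyl j x"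
  define D' where "D' = cyl j y"
  have mD: "meas {..<j} D" "meas {..<j} D'" by (simp_all add: D_def D'_def meas_cyl)
  have mDD: "meas {..<j} (D \<union> D')" using mD by (auto simp: meas_def)
  define c where "c = gel {} (fl j D)"
  have cl: "loc {..<Suc j} (fl j D)" by (rule fl_loc[OF mD(1)])
  have ccar: "c \<in> carrier Gsd" unfolding c_def by (rule perm_carrier[OF cl])
  have cS: "fl j D \<in> S2inf" using loc_S2inf[OF cl] .
  have cb: "bij (fl j D)" using S2inf_bij[OF cS] .
  have lift: "meas {..<j} B" if "meas {..<n} B" for B by (rule meas_mono[OF that]) (use j in auto)
  have cinv: "inv\<^bsub>Gsd\<^esub> c = c"
    unfolding c_def gel_inv[OF clopen_empty cS] by (simp add: involution(2)[OF fl_fl[OF mD(1)]])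
  have rho: "inv\<^bsub>Gsd\<^esub> (gel C \<sigma>) \<otimes>\<^bsub>Gsd\<^esub> c \<otimes>\<^bsub>Gsd\<^esub> gel C \<sigma> \<otimes>\<^bsub>Gsd\<^esub> inv\<^bsub>Gsd\<^esub> c = gel {} (fl j (D \<union> D'))"
  proof -
    have "?i \<circ> fl j D \<circ> \<sigma> \<circ> fl j D = fl j (D \<union> D')"
    proof
      fix z
      have "?i (fl j D (\<sigma> (fl j D z))) = fl j (?i ` D) (?i (\<sigma> (fl j D z)))" by (rule fl_conj[OF ij])
      also have "\<dots> = fl j D' (fl j D z)"
        using cyl_image[OF ij, of x] b by (simp add: D_def D'_def iy bij_is_inj)
      also have "\<dots> = fl j (D \<union> D') z"
        using fl_Un[OF mD(2), of D z] cyl_disjoint[OF xyj] by (simp add: D_def D'_def Int_commute Un_commute)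
      finally show "(?i \<circ> fl j D \<circ> \<sigma> \<circ> fl j D) z = fl j (D \<union> D') z" by simp
    qed
    moreover have "bij ?i" using b by (rule bij_imp_bij_inv)
    moreover have "(\<lambda>z. ?i (fl j D z)) ` C = ?i ` C"
      using fl_image_eq[OF mD(1) lift[OF C(1)]] by (simp add: image_image[symmetric])
    ultimately show ?thesis
      unfolding cinv unfolding c_def gel_inv[OF meas_clopen[OF C(1)] loc_S2inf[OF C(2)]]
      by (simp add: gel_mult b cb bij_comp comp_assoc[symmetric] image_comp[symmetric] fl_image_eq[OF mD(1) lift[OF C(1)]])
  qed
  have "inv\<^bsub>Gsd\<^esub> (gel C \<sigma>) \<otimes>\<^bsub>Gsd\<^esub> c \<otimes>\<^bsub>Gsd\<^esub> gel C \<sigma> \<otimes>\<^bsub>Gsd\<^esub> inv\<^bsub>Gsd\<^esub> c \<in> N"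
  proof (rule commutator_in_N[OF AN g nz ccar])
    fix f assume f: "f \<in> Csub" "f \<in> Glev {..<n}"
    then obtain B where B: "f = gel B id" "clopen B" by (metis Csub_cases)
    have Bn: "meas {..<n} B" using f(2) B(1) by (simp add: Glev_gel_iff)
    show "c \<otimes>\<^bsub>Gsd\<^esub> f = f \<otimes>\<^bsub>Gsd\<^esub> c"
      unfolding c_def B(1) using fl_image_eq[OF mD(1) lift[OF Bn]] cb by (simp add: gel_mult)
    assume f1: "f \<noteq> \<one>\<^bsub>Gsd\<^esub>"
    let ?r = "fl j (D \<union> D')"
    have rl: "loc {..<Suc j} ?r" by (rule fl_loc[OF mDD])
    have rb: "bij ?r" using locD(1)[OF rl] .
    have rG: "gel {} ?r \<in> Glev {..<Suc j}" using rl by (simp add: Glev_gel_iff meas_empty)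
    have "E (gel {} ?r) (gel B ?r) = 0"
    proof (rule ccontr)
      assume nzr: "E (gel {} ?r) (gel B ?r) \<noteq> 0"
      have "B \<noteq> {}" "B \<noteq> UNIV" using f1 B(1) by (auto simp: gel_one gel_eq_iff)
      then obtain w w' where w: "w \<in> B" "w' \<notin> B" by blast
      \<comment> \<open>Here \<open>n < j\<close> is essential: coordinate \<open>n\<close> is free
        at level \<open>n\<close> but prescribed in \<open>D\<close> and \<open>D'\<close>. Since
        \<open>x\<close> and \<open>y\<close> differ below \<open>n\<close>, at most one of the two
        has to be avoided.\<close>
      have avoid: "\<exists>u. eqon {..<n} u w \<and> u \<notin> D \<union> D'" for w
      proof -
        define u where "u = w(n := (if eqon {..<n} w x then \<not> x n else \<not> y n))"
        have uw: "eqon {..<n} u w" by (simp add: u_def eqon_def)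
        have nj: "{..<n} \<subseteq> {..<j}" using j by auto
        have "u \<notin> D"
        proof
          assume "u \<in> D"
          then have ux: "eqon {..<j} u x" by (simp add: D_def cyl_def)
          then have "eqon {..<n} w x" using uw eqon_mono[OF nj] eqon_sym eqon_trans by blast
          then have "u n = (\<not> x n)" by (simp add: u_def)
          then show False using ux j by (auto simp: eqon_def)
        qed
        moreover have "u \<notin> D'"
        proof
          assume "u \<in> D'"
          then have uy: "eqon {..<j} u y" by (simp add: D'_def cyl_def)
          then have "eqon {..<n} w y" using uw eqon_mono[OF nj] eqon_sym eqon_trans by blast
          then have "\<not> eqon {..<n} w x" using xy eqon_sym eqon_trans by blast
          then have "u n = (\<not> y n)" by (simp add: u_def)
          then show False using uy j by (auto simp: eqon_def)
        qed
        ultimately show ?thesis using uw by blast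
      qed
      obtain u where u: "eqon {..<n} u w" "u \<notin> D \<union> D'" using avoid by blast
      obtain v where v: "eqon {..<n} v w'" "v \<notin> D \<union> D'" using avoid by blast
      have uB: "u \<in> B" "v \<notin> B" using measD[OF Bn] u(1) v(1) w by blast+
      have Bj: "meas {..<Suc j} B" by (rule meas_mono[OF Bn]) (use j in auto)
      \<comment> \<open>The flip \<open>?r\<close> has level \<open>Suc j\<close>, so the swap goes
        one coordinate deeper. It acts outside \<open>D \<union> D'\<close>, where \<open>?r\<close>
        is the identity, and hence commutes with it, while \<open>sw_not_meas\<close> shows that it
        destroys the level of \<open>B\<close>.\<close>
      let ?u = "u(Suc j := False)" and ?v = "v(Suc j := False)"
      let ?c = "sw (Suc (Suc j)) ?u ?v"
      have weaken: "eqon {..<j} z t" if "eqon {..<Suc (Suc j)} z (t(Suc j := False))" for z t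
        using that by (simp add: eqon_def)
      have off: "\<not> eqon {..<Suc (Suc j)} z (t(Suc j := False))" if "z \<in> D \<union> D'" "t \<notin> D \<union> D'" for z t
      proof
        assume "eqon {..<Suc (Suc j)} z (t(Suc j := False))"
        from measD[OF mDD weaken[OF this]] show False using that by blast
      qed
      have fixes_D: "?c z = z" if "z \<in> D \<union> D'" for z
        using off[OF that u(2)] off[OF that v(2)] by (rule sw_other)
      have pres: "?c z \<notin> D \<union> D'" if "z \<notin> D \<union> D'" for z
      proof
        assume *: "?c z \<in> D \<union> D'"
        have "z = ?c z" using fixes_D[OF *] by (simp only: sw_sw)
        then show False using * that by simp
      qed
      have "?c (?r z) = ?r (?c z)" for z
      proof (cases "z \<in> D \<union> D'")
        case True
        then have "?r z \<in> D \<union> D'" using fl_mem[OF mDD] by blast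
        then show ?thesis using fixes_D True by simp
      next
        case False
        then show ?thesis using pres[OF False] by (simp add: fl_def)
      qed
      then have "gel {} ?c \<otimes>\<^bsub>Gsd\<^esub> gel {} ?r = gel {} ?r \<otimes>\<^bsub>Gsd\<^esub> gel {} ?c"
        using rb locD(1)[OF sw_loc] by (simp add: gel_mult gel_eq_iff fun_eq_iff)
      then have "meas {..<Suc j} (?c ` B)" by (rule E_sw_conj(1)[OF rG nzr])
      then show False using sw_not_meas[OF Bj uB] by blast
    qed
    then show "E (inv\<^bsub>Gsd\<^esub> (gel C \<sigma>) \<otimes>\<^bsub>Gsd\<^esub> c \<otimes>\<^bsub>Gsd\<^esub> gel C \<sigma> \<otimes>\<^bsub>Gsd\<^esub> inv\<^bsub>Gsd\<^esub> c)
        (f \<otimes>\<^bsub>Gsd\<^esub> (inv\<^bsub>Gsd\<^esub> (gel C \<sigma>) \<otimes>\<^bsub>Gsd\<^esub> c \<otimes>\<^bsub>Gsd\<^esub> gel C \<sigma> \<otimes>\<^bsub>Gsd\<^esub> inv\<^bsub>Gsd\<^esub> c)) = 0"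
      unfolding rho B(1) by (simp add: gel_mult)
  qed
  then have "gel {} (fl j (cyl j x \<union> cyl j y)) \<in> N" unfolding rho by (simp add: D_def D'_def)
  then show ?thesis using that xy by blast
qed

text \<open>Conjugating the given flips yields flips on any two cylinders of the same depth, which
  are even permutations at that depth. The fact \<open>one\<close> overcomes parity by taking the
  two halves of one cylinder, and all transpositions of a sufficiently large depth follow by
  conjugation.\<close>

lemma perm_in_N:
  assumes flip: "\<And>j. n < j \<Longrightarrow> \<exists>x y. \<not> eqon {..<n} x y \<and> gel {} (fl j (cyl j x \<union> cyl j y)) \<in> N"
    and \<sigma>: "\<sigma> \<in> S2inf"
  shows "gel {} \<sigma> \<in> N"
proof -
  have conj: "gel {} (h \<circ> \<tau> \<circ> inv_into UNIV h) \<in> N"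
    if "gel {} \<tau> \<in> N" "loc {..<k} h" "loc {..<k'} \<tau>" for h \<tau> k k'
    using N_conj[OF perm_carrier[OF that(2)] that(1)]
      gel_conj[OF loc_S2inf[OF that(2)] clopen_empty loc_S2inf[OF that(3)]] by simp
  have hinv: "h (inv_into UNIV h z) = z" if "loc {..<k} h" for h :: "cantor \<Rightarrow> cantor" and z k
    using locD(1)[OF that] by (simp add: bij_is_surj surj_f_inv_f)
  have two: "gel {} (fl j (cyl j x' \<union> cyl j y')) \<in> N" if j: "n < j" and xy': "\<not> eqon {..<j} x' y'" for j x' y'
  proof -
    obtain x y where xy: "\<not> eqon {..<n} x y" "gel {} (fl j (cyl j x \<union> cyl j y)) \<in> N" using flip[OF j] by blast
    have "\<not> eqon {..<j} x y" using xy(1) eqon_mono[of "{..<n}" "{..<j}"] j by auto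
    then obtain h where h: "loc {..<j} h" "eqon {..<j} (h x) x'" "eqon {..<j} (h y) y'"
      using loc_two_transitive[OF _ xy'] by blast
    have m: "meas {..<j} (cyl j x \<union> cyl j y)" using meas_cyl[of j j] by (auto simp: meas_def)
    have "gel {} (h \<circ> fl j (cyl j x \<union> cyl j y) \<circ> inv_into UNIV h) \<in> N"
      by (rule conj[OF xy(2) h(1) fl_loc[OF m]])
    moreover have "h \<circ> fl j (cyl j x \<union> cyl j y) \<circ> inv_into UNIV h = fl j (cyl j x' \<union> cyl j y')"
      using cyl_image[OF h(1)] cyl_cong[OF h(2)] cyl_cong[OF h(3)]
      by (simp add: fun_eq_iff fl_conj[OF h(1)] hinv[OF h(1)] image_Un)
    ultimately show ?thesis by simp
  qed
  have one: "gel {} (fl j (cyl j a)) \<in> N" if j: "n < j" for j a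
  proof -
    have "\<not> eqon {..<Suc j} (a(j := False)) (a(j := True))" by (simp add: eqon_def)
    from two[OF _ this] have *: "gel {} (fl (Suc j) (cyl j a)) \<in> N" using j by (simp add: cyl_split)
    txt \<open>Exchanging two coordinates turns a product of two transpositions into a single one, one level up.\<close>
    define \<pi> where "\<pi> = Transposition.transpose j (Suc j)"
    have \<pi>: "\<pi> (\<pi> k) = k" "k \<ge> Suc (Suc j) \<Longrightarrow> \<pi> k = k" for k by (auto simp: \<pi>_def Transposition.transpose_def)
    define c where "c = gel {} (\<lambda>x. x \<circ> \<pi>)"
    have cc: "c \<in> carrier Gsd" unfolding c_def by (rule perm_carrier[OF coord_perm_loc[of \<pi> "Suc (Suc j)"]]) (simp_all add: \<pi>)
    have ml: "meas {..<Suc j} (cyl j a)" by (rule meas_cyl) simp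
    have "inv\<^bsub>Gsd\<^esub> c \<otimes>\<^bsub>Gsd\<^esub> gel {} (fl (Suc j) (cyl j a)) \<otimes>\<^bsub>Gsd\<^esub> inv\<^bsub>Gsd\<^esub> (inv\<^bsub>Gsd\<^esub> c) \<in> N"
      by (rule N_conj[OF inv_closed[OF cc] *])
    then have "inv\<^bsub>Gsd\<^esub> c \<otimes>\<^bsub>Gsd\<^esub> gel {} (fl (Suc j) (cyl j a)) \<otimes>\<^bsub>Gsd\<^esub> c \<in> N" using cc by simp
    moreover have "inv\<^bsub>Gsd\<^esub> c \<otimes>\<^bsub>Gsd\<^esub> gel {} (fl (Suc j) (cyl j a)) \<otimes>\<^bsub>Gsd\<^esub> c
        = gel {} (\<lambda>x. fl (Suc j) (cyl j a) (x \<circ> \<pi>) \<circ> \<pi>)"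
      using coord_perm_conj[of \<pi> "Suc (Suc j)" "{}" "fl (Suc j) (cyl j a)"] \<pi> clopen_empty loc_S2inf[OF fl_loc[OF ml]]
      by (simp add: c_def)
    moreover have "(\<lambda>x. fl (Suc j) (cyl j a) (x \<circ> \<pi>) \<circ> \<pi>) = fl j (cyl j a)"
    proof
      fix x :: cantor
      have "x \<circ> \<pi> \<in> cyl j a \<longleftrightarrow> x \<in> cyl j a" by (simp add: cyl_def eqon_def \<pi>_def Transposition.transpose_def)
      then show "fl (Suc j) (cyl j a) (x \<circ> \<pi>) \<circ> \<pi> = fl j (cyl j a) x"
        by (auto simp: fl_def fun_eq_iff \<pi>_def Transposition.transpose_def split: if_splits)
    qed
    ultimately show ?thesis by simp
  qed
  have swN: "gel {} (sw (Suc j) u v) \<in> N" if j: "n < j" and uv: "\<not> eqon {..<Suc j} u v" for j u v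
  proof -
    let ?a = "u(j := False)" and ?b = "u(j := True)"
    have "\<not> eqon {..<Suc j} ?a ?b" by (simp add: eqon_def)
    then obtain h where h: "loc {..<Suc j} h" "eqon {..<Suc j} (h ?a) u" "eqon {..<Suc j} (h ?b) v"
      using loc_two_transitive[OF _ uv] by blast
    have "gel {} (sw (Suc j) ?a ?b) \<in> N" using one[OF j, of u] by (simp only: fl_cyl_eq_sw)
    then have "gel {} (h \<circ> sw (Suc j) ?a ?b \<circ> inv_into UNIV h) \<in> N" by (rule conj[OF _ h(1) sw_loc])
    moreover have "h \<circ> sw (Suc j) ?a ?b \<circ> inv_into UNIV h = sw (Suc j) u v"
      using sw_cong[OF h(2,3)] by (simp add: fun_eq_iff sw_conj[OF h(1)] hinv[OF h(1)])
    ultimately show ?thesis by simp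
  qed
  obtain k where k: "loc {..<k} \<sigma>" using \<sigma> S2inf_iff by blast
  \<comment> \<open>Deep enough for \<sigma> to act on the first \<open>Suc j\<close> coordinates
    and for \<open>swN\<close>, which requires \<open>n < j\<close>.\<close>
  define j where "j = max k (Suc n)"
  define m where "m = Suc j"
  have jn: "n < j" by (simp add: j_def)
  have "loc {..<m} \<sigma>" by (rule loc_mono[OF k]) (auto simp: m_def j_def)
  then obtain p where p: "p permutes cube m" "\<sigma> = lift_perm m p" by (rule loc_lift_perm)
  have "gel {} (lift_perm m p) \<in> N" using p(1) finite_cube[of m]
  proof (induction rule: permutes_induct)
    case id
    show ?case unfolding lift_perm_id using subgroup.one_closed[OF N_subgroup] by (simp only: gel_one)
  next
    case (swap a b p)
    have "gel {} (lift_perm m (Transposition.transpose a b)) \<in> N"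
    proof (cases "a = b")
      case True
      then show ?thesis using subgroup.one_closed[OF N_subgroup] by (simp add: gel_one lift_perm_id)
    next
      case False
      then have "\<not> eqon {..<m} a b" using cube_eqI swap by blast
      then have "gel {} (sw m a b) \<in> N" unfolding m_def by (rule swN[OF jn])
      then show ?thesis by (simp only: lift_perm_transpose[OF swap(1,2)])
    qed
    then have "gel {} (lift_perm m (Transposition.transpose a b)) \<otimes>\<^bsub>Gsd\<^esub> gel {} (lift_perm m p) \<in> N"
      using swap by (intro N_mult)
    moreover have "lift_perm m (Transposition.transpose a b) \<circ> lift_perm m p = lift_perm m (Transposition.transpose a b \<circ> p)"
      using lift_perm_comp swap by (simp add: fun_eq_iff)
    moreover have "bij (lift_perm m (Transposition.transpose a b))"
      unfolding lift_perm_transpose[OF swap(1,2)] by (rule locD(1)[OF sw_loc])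
    ultimately have "gel {} (lift_perm m (Transposition.transpose a b \<circ> p)) \<in> N" by (simp add: gel_mult)
    then show ?case by (simp only: comp_def)
  qed
  then show ?thesis using p(2) by simp
qed

text \<open>Once \<open>Csub\<close> is contained in \<open>N\<close>, multiplying by the set
  component reduces membership of \<open>k\<close> to that of its permutation part.\<close>

lemma support_in_N:
  assumes a: "a \<in> P" and k: "a k \<noteq> 0"
  shows "delta k \<in> P"
proof (cases "\<exists>f\<in>Csub. f \<noteq> \<one>\<^bsub>Gsd\<^esub> \<and> E f f \<noteq> 0")
  case False
  then have "k = \<one>\<^bsub>Gsd\<^esub>" using support_trivial[OF _ a k] by blast
  then show ?thesis using P_one by simp
next
  case True
  then obtain f where "f \<in> Csub" "f \<noteq> \<one>\<^bsub>Gsd\<^esub>" "f \<in> N" using E_Csub by blast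
  then have AN: "Csub \<subseteq> N" by (rule Csub_subset_N)
  have kc: "k \<in> carrier Gsd" using P_support[OF a k] .
  then obtain C \<sigma> where C: "k = gel C \<sigma>" "clopen C" "\<sigma> \<in> S2inf" by (rule Gsd_cases)
  have CN: "gel C id \<in> N" using AN C(2) by (auto simp: Csub_gel)
  have "k \<in> N"
  proof (cases "\<sigma> = id")
    case True
    then show ?thesis using CN C(1) by simp
  next
    case False
    obtain n where n: "k \<in> Glev {..<n}" using kc Gn_Union by blast
    have "gel {} \<sigma> \<in> N"
    proof (rule perm_in_N[OF _ C(3)])
      fix j assume j: "n < j"
      obtain x y where "\<not> eqon {..<n} x y" "gel {} (fl j (cyl j x \<union> cyl j y)) \<in> N"
        by (rule flip_in_N[OF AN n[unfolded C(1)] E_nonzero[OF a k, unfolded C(1)] False j])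
      then show "\<exists>x y. \<not> eqon {..<n} x y \<and> gel {} (fl j (cyl j x \<union> cyl j y)) \<in> N" by blast
    qed
    then have "gel C id \<otimes>\<^bsub>Gsd\<^esub> gel {} \<sigma> \<in> N" using CN N_mult by blast
    then show ?thesis using C(1) by (simp add: gel_mult)
  qed
  then show ?thesis by (simp add: N_def)
qed

lemma M_group_algebra: "\<exists>N. N \<lhd> Gsd \<and> M = grpvN Gsd N"
proof (intro exI conjI)
  show "N \<lhd> Gsd" by (rule N_normal)
  show "M = grpvN Gsd N" unfolding N_def by (rule M_eq_grpvN) (rule support_in_N)
qed

end

theorem ISR_Gsd: "ISR Gsd"
  unfolding ISR_def
proof (intro allI impI)
  fix M assume M: "is_vNa Gsd M \<and> M \<subseteq> grpvN Gsd (carrier Gsd) \<and> G_invariant Gsd M"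
  interpret escaping_group Gsd "\<lambda>n. Glev {..<n}" by (rule escaping_Gsd)
  interpret Gsd_vNa M
  proof (intro Gsd_vNa.intro generic_invariant_vNa.intro invariant_vNa.intro
      invariant_vNa_axioms.intro generic_invariant_vNa_axioms.intro)
    show "escaping_group Gsd (\<lambda>n. Glev {..<n})" by (rule escaping_Gsd)
  qed (use M Csub_normal Csub_comm Csub_square Csub_generic in auto)
  show "\<exists>N. N \<lhd> Gsd \<and> M = grpvN Gsd N" by (rule M_group_algebra)
qed

theorem theorem3p9:
  shows "group Gsd \<and> amenable_grp Gsd \<and> icc_grp Gsd \<and>
         Csub \<lhd> Gsd \<and> comm_group (Gsd\<lparr>carrier := Csub\<rparr>) \<and> Csub \<noteq> {\<one>\<^bsub>Gsd\<^esub>} \<and>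
         ISR Gsd"
proof -
  interpret escaping_group Gsd "\<lambda>n. Glev {..<n}" by (rule escaping_Gsd)
  have "Glev {..<0} = {\<one>\<^bsub>Gsd\<^esub>}" using Glev_empty by simp
  then have "icc_grp Gsd" by (rule icc)
  then show ?thesis
    using group_Gsd amenable Csub_normal Csub_comm_group Csub_nontrivial ISR_Gsd by blast
qed

end
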